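(* Let $(M^{2n+s},\phi,\xi_i,\eta_j,g)$ be a metric $f$-manifold whose characteristic vector fields commute, i.e. $[\xi_i,\xi_j]=0$ for all $i,j\in\{1,\dots,s\}$. Suppose that each $\xi_i$ is a Killing vector field and that $N^{(1)}$ is totally skew-symmetric. Then $(M^{2n+s},\phi,\xi_i,\eta_j,g)$ admits a unique metric connection $\nabla$ with skew-torsion $T$ preserving the structure, that is, satisfying $\nabla g=0$, $\nabla\phi=0$, $\nabla\xi_i=0$, $\nabla\eta_i=0$ for all $i=1,\dots,s$. The torsion 3-form is given by $$T=\sum_{i=1}^{s}\eta_i\wedge d\eta_i+d^{\phi}F+N^{(1)}-\sum_{i=1}^{s}\eta_i\wedge(\xi_i\lrcorner N^{(1)}),$$ and it satisfies $T(\xi_i,\xi_j)=0$ for all $i,j\in\{1,\dots,s\}$ and $\xi_j\lrcorner T=d\eta_j=2\nabla^g\eta_j$ for all $j=1,\dots,s$.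
   Context: Manifolds are smooth and connected. A metric $f$-manifold $(M^{2n+s},\phi,\xi_i,\eta_j,g)$ is a $(2n+s)$-dimensional manifold $M$ with a $(1,1)$-tensor field $\phi$ of constant rank $2n$ satisfying $\phi^3+\phi=0$, global vector fields $\xi_1,\dots,\xi_s$ (the characteristic vector fields) and 1-forms $\eta_1,\dots,\eta_s$ with $\ker\phi=\langle\xi_1,\dots,\xi_s\rangle$, $\eta_i(\xi_j)=\delta_{ij}$, $\eta_i\circ\phi=0$, $\phi^2=-\mathrm{Id}+\sum_i\eta_i\otimes\xi_i$, and a Riemannian metric $g$ with $g(\phi X,\phi Y)=g(X,Y)-\sum_i\eta_i(X)\eta_i(Y)$. (For $s=0$ terms involving $\xi_i,\eta_i$ are omitted.) $\nabla^g$ is the Levi-Civita connection of $g$; $\nabla^g\eta_j$ denotes the bilinear form $(X,Y)\mapsto(\nabla^g_X\eta_j)Y$. The fundamental 2-form is $F(X,Y)=g(X,\phi Y)$, and $d^{\phi}F(X,Y,Z):=-dF(\phi X,\phi Y,\phi Z)$. Convention: $d\eta(X,Y)=X\eta(Y)-Y\eta(X)-\eta([X,Y])$, and correspondingly (no numerical factors) for 2-forms; $u\wedge v=u\otimes v-v\otimes u$ for 1-forms, and for a 1-form $\eta$ and a 2-form $\omega$, $(\eta\wedge\omega)(X,Y,Z)=\eta(X)\omega(Y,Z)-\eta(Y)\omega(X,Z)+\eta(Z)\omega(X,Y)$. The Nijenhuis tensor is $N^{(1)}=N_\phi+\sum_i d\eta_i\otimes\xi_i$ with $N_\phi(X,Y)=[\phi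 X,\phi Y]+\phi^2[X,Y]-\phi[X,\phi Y]-\phi[\phi X,Y]$; write $N^{(1)}(X,Y,Z)=g(N^{(1)}(X,Y),Z)$, and call $N^{(1)}$ totally skew-symmetric if this is a 3-form. A connection has skew-torsion if $T(X,Y,Z):=g(T(X,Y),Z)$ is a 3-form, where $T(X,Y)=\nabla_XY-\nabla_YX-[X,Y]$; the same letter $T$ denotes the vector-valued 2-form and the 3-form. *)

theory Defs
  imports "HOL-Analysis.Analysis"
begin

section \<open>Smooth manifolds\<close>

text \<open>
  The manifold is a whole (Hausdorff, second countable) topological type \<open>'m\<close>; its model space
  is a Euclidean space \<open>'e\<close>. The smooth structure is the one generated by a smooth atlas \<open>A\<close>,
  not necessarily maximal. A chart is a pair \<open>(U, c)\<close>; only the values of \<open>c\<close> on \<open>U\<close> matter.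
\<close>

primrec Ck_on ::
  "nat \<Rightarrow> 'a::real_normed_vector set \<Rightarrow> ('a \<Rightarrow> 'b::real_normed_vector) \<Rightarrow> bool" where
  "Ck_on 0 S f \<longleftrightarrow> continuous_on S f"
| "Ck_on (Suc k) S f \<longleftrightarrow>
     (\<forall>x\<in>S. f differentiable (at x)) \<and>
     (\<forall>v. Ck_on k S (\<lambda>x. frechet_derivative f (at x) v))"

text \<open>Intended for open \<open>S\<close> and finite-dimensional domain: all iterated directional derivatives
  exist and are continuous.\<close>

definition smooth_on :: "'a::real_normed_vector set \<Rightarrow> ('a \<Rightarrow> 'b::real_normed_vector) \<Rightarrow> bool" where
  "smooth_on S f \<longleftrightarrow> (\<forall>k. Ck_on k S f)"

type_synonym ('m, 'e) chart = "'m set \<times> ('m \<Rightarrow> 'e)"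

type_synonym ('m, 'e) atlas = "('m, 'e) chart set"

abbreviation chart_dom :: "('m, 'e) chart \<Rightarrow> 'm set" where
  "chart_dom c \<equiv> fst c"

abbreviation chart_map :: "('m, 'e) chart \<Rightarrow> 'm \<Rightarrow> 'e" where
  "chart_map c \<equiv> snd c"

abbreviation chart_range :: "('m, 'e) chart \<Rightarrow> 'e set" where
  "chart_range c \<equiv> chart_map c ` chart_dom c"

definition chart_inv :: "('m, 'e) chart \<Rightarrow> 'e \<Rightarrow> 'm" where
  "chart_inv c = inv_into (chart_dom c) (chart_map c)"

definition is_chart :: "('m::topological_space, 'e::euclidean_space) chart \<Rightarrow> bool" where
  "is_chart c \<longleftrightarrow> open (chart_dom c) \<and> open (chart_range c) \<and>
     homeomorphism (chart_dom c) (chart_range c) (chart_map c) (chart_inv c)"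

definition transition :: "('m, 'e) chart \<Rightarrow> ('m, 'e) chart \<Rightarrow> 'e \<Rightarrow> 'e" where
  "transition c d = chart_map d \<circ> chart_inv c"

definition smooth_atlas ::
  "('m::{t2_space, second_countable_topology}, 'e::euclidean_space) atlas \<Rightarrow> bool" where
  "smooth_atlas A \<longleftrightarrow>
     (\<forall>c\<in>A. is_chart c) \<and>
     (\<Union>c\<in>A. chart_dom c) = UNIV \<and>
     (\<forall>c\<in>A. \<forall>d\<in>A. smooth_on (chart_map c ` (chart_dom c \<inter> chart_dom d)) (transition c d))"

definition smooth_connected_manifold ::
  "('m::{t2_space, second_countable_topology}, 'e::euclidean_space) atlas \<Rightarrow> bool" where
  "smooth_connected_manifold A \<longleftrightarrow> smooth_atlas A \<and> connected (UNIV :: 'm set)"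

section \<open>Tangent vectors, functions and vector fields\<close>

text \<open>
  At every point \<open>p\<close> one chart of the atlas around \<open>p\<close> is selected once and for all, and the
  tangent space at \<open>p\<close> is identified with \<open>'e\<close> through it: \<open>v :: 'e\<close>, placed at \<open>p\<close>, stands for
  the tangent vector whose components in \<open>chart_at A p\<close> are \<open>v\<close>. The selected chart jumps from
  point to point, so smoothness of tensor fields is always tested on components with respect to
  a fixed chart \<open>c\<close>; \<open>to_chart\<close> and \<open>from_chart\<close> are the Jacobians of the change of coordinates.
\<close>

definition chart_at :: "('m, 'e) atlas \<Rightarrow> 'm \<Rightarrow> ('m, 'e) chart" where
  "chart_at A p = (SOME c. c \<in> A \<and> p \<in> chart_dom c)"

definition to_chart ::
  "('m, 'e::euclidean_space) atlas \<Rightarrow> ('m, 'e) chart \<Rightarrow> 'm \<Rightarrow> 'e \<Rightarrow> 'e" where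
  "to_chart A c p v =
     frechet_derivative (transition (chart_at A p) c) (at (chart_map (chart_at A p) p)) v"

definition from_chart ::
  "('m, 'e::euclidean_space) atlas \<Rightarrow> ('m, 'e) chart \<Rightarrow> 'm \<Rightarrow> 'e \<Rightarrow> 'e" where
  "from_chart A c p v =
     frechet_derivative (transition c (chart_at A p)) (at (chart_map c p)) v"

type_synonym 'm scalar_field = "'m \<Rightarrow> real"

type_synonym ('m, 'e) vector_field = "'m \<Rightarrow> 'e"

type_synonym ('m, 'e) one_form = "'m \<Rightarrow> 'e \<Rightarrow> real"

type_synonym ('m, 'e) endo_field = "'m \<Rightarrow> 'e \<Rightarrow> 'e"

type_synonym ('m, 'e) bilinear_field = "'m \<Rightarrow> 'e \<Rightarrow> 'e \<Rightarrow> real"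

definition smooth_fun :: "('m, 'e::euclidean_space) atlas \<Rightarrow> 'm scalar_field \<Rightarrow> bool" where
  "smooth_fun A f \<longleftrightarrow> (\<forall>c\<in>A. smooth_on (chart_range c) (f \<circ> chart_inv c))"

definition vf_rep ::
  "('m, 'e::euclidean_space) atlas \<Rightarrow> ('m, 'e) chart \<Rightarrow> ('m, 'e) vector_field \<Rightarrow> 'e \<Rightarrow> 'e" where
  "vf_rep A c X x = to_chart A c (chart_inv c x) (X (chart_inv c x))"

definition smooth_vf :: "('m, 'e::euclidean_space) atlas \<Rightarrow> ('m, 'e) vector_field \<Rightarrow> bool" where
  "smooth_vf A X \<longleftrightarrow> (\<forall>c\<in>A. smooth_on (chart_range c) (vf_rep A c X))"

definition smooth_one_form :: "('m, 'e::euclidean_space) atlas \<Rightarrow> ('m, 'e) one_form \<Rightarrow> bool" where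
  "smooth_one_form A \<alpha> \<longleftrightarrow>
     (\<forall>p. linear (\<alpha> p)) \<and>
     (\<forall>c\<in>A. \<forall>u. smooth_on (chart_range c)
        (\<lambda>x. let p = chart_inv c x in \<alpha> p (from_chart A c p u)))"

definition smooth_endo :: "('m, 'e::euclidean_space) atlas \<Rightarrow> ('m, 'e) endo_field \<Rightarrow> bool" where
  "smooth_endo A \<phi> \<longleftrightarrow>
     (\<forall>p. linear (\<phi> p)) \<and>
     (\<forall>c\<in>A. \<forall>u. smooth_on (chart_range c)
        (\<lambda>x. let p = chart_inv c x in to_chart A c p (\<phi> p (from_chart A c p u))))"

definition riemannian_metric ::
  "('m, 'e::euclidean_space) atlas \<Rightarrow> ('m, 'e) bilinear_field \<Rightarrow> bool" where
  "riemannian_metric A g \<longleftrightarrow>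
     (\<forall>p. bilinear (g p)) \<and>
     (\<forall>p u v. g p u v = g p v u) \<and>
     (\<forall>p u. u \<noteq> 0 \<longrightarrow> g p u u > 0) \<and>
     (\<forall>c\<in>A. \<forall>u v. smooth_on (chart_range c)
        (\<lambda>x. let p = chart_inv c x in g p (from_chart A c p u) (from_chart A c p v)))"

text \<open>Evaluation of tensor fields on vector fields.\<close>

definition form_app :: "('m, 'e) one_form \<Rightarrow> ('m, 'e) vector_field \<Rightarrow> 'm scalar_field" where
  "form_app \<alpha> X = (\<lambda>p. \<alpha> p (X p))"

definition endo_app :: "('m, 'e) endo_field \<Rightarrow> ('m, 'e) vector_field \<Rightarrow> ('m, 'e) vector_field" where
  "endo_app \<phi> X = (\<lambda>p. \<phi> p (X p))"

definition bil_app ::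
  "('m, 'e) bilinear_field \<Rightarrow> ('m, 'e) vector_field \<Rightarrow> ('m, 'e) vector_field \<Rightarrow> 'm scalar_field" where
  "bil_app g X Y = (\<lambda>p. g p (X p) (Y p))"

definition dir_deriv ::
  "('m, 'e::euclidean_space) atlas \<Rightarrow> ('m, 'e) vector_field \<Rightarrow> 'm scalar_field \<Rightarrow> 'm scalar_field" where
  "dir_deriv A X f = (\<lambda>p. let c = chart_at A p in
     frechet_derivative (f \<circ> chart_inv c) (at (chart_map c p)) (X p))"

text \<open>In the coordinates of a chart, \<open>[X,Y] = DY(X) - DX(Y)\<close>; at \<open>p\<close> this is read off in
  \<open>chart_at A p\<close>, where the components of \<open>X\<close> at \<open>p\<close> are \<open>X p\<close> itself.\<close>

definition lie_bracket ::
  "('m, 'e::euclidean_space) atlas \<Rightarrow> ('m, 'e) vector_field \<Rightarrow> ('m, 'e) vector_field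
     \<Rightarrow> ('m, 'e) vector_field" where
  "lie_bracket A X Y = (\<lambda>p. let c = chart_at A p in
     frechet_derivative (vf_rep A c Y) (at (chart_map c p)) (X p) -
     frechet_derivative (vf_rep A c X) (at (chart_map c p)) (Y p))"

section \<open>Differential forms\<close>

text \<open>Forms of degree 2 and 3 are represented by their action on vector fields. The exterior
  derivative and the wedge product carry no numerical factors.\<close>

type_synonym ('m, 'e) two_form =
  "('m, 'e) vector_field \<Rightarrow> ('m, 'e) vector_field \<Rightarrow> 'm scalar_field"

type_synonym ('m, 'e) three_form =
  "('m, 'e) vector_field \<Rightarrow> ('m, 'e) vector_field \<Rightarrow> ('m, 'e) vector_field \<Rightarrow> 'm scalar_field"

text \<open>A 3-form is an alternating map, \<open>C\<^sup>\<infinity>\<close>-trilinear on smooth vector fields. Linearity in the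
  first slot suffices because of skew-symmetry.\<close>

definition is_three_form :: "('m, 'e::euclidean_space) atlas \<Rightarrow> ('m, 'e) three_form \<Rightarrow> bool" where
  "is_three_form A B \<longleftrightarrow>
     (\<forall>X Y Z. smooth_vf A X \<and> smooth_vf A Y \<and> smooth_vf A Z \<longrightarrow>
        smooth_fun A (B X Y Z) \<and>
        (\<forall>X'. smooth_vf A X' \<longrightarrow>
           B (\<lambda>p. X p + X' p) Y Z = (\<lambda>p. B X Y Z p + B X' Y Z p)) \<and>
        (\<forall>f. smooth_fun A f \<longrightarrow> B (\<lambda>p. f p *\<^sub>R X p) Y Z = (\<lambda>p. f p * B X Y Z p)) \<and>
        B Y X Z = (\<lambda>p. - B X Y Z p) \<and>
        B X Z Y = (\<lambda>p. - B X Y Z p))"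

definition ext_deriv1 ::
  "('m, 'e::euclidean_space) atlas \<Rightarrow> ('m, 'e) one_form \<Rightarrow> ('m, 'e) two_form" where
  "ext_deriv1 A \<alpha> X Y = (\<lambda>p.
     dir_deriv A X (form_app \<alpha> Y) p - dir_deriv A Y (form_app \<alpha> X) p
     - form_app \<alpha> (lie_bracket A X Y) p)"

definition ext_deriv2 ::
  "('m, 'e::euclidean_space) atlas \<Rightarrow> ('m, 'e) two_form \<Rightarrow> ('m, 'e) three_form" where
  "ext_deriv2 A \<omega> X Y Z = (\<lambda>p.
     dir_deriv A X (\<omega> Y Z) p - dir_deriv A Y (\<omega> X Z) p + dir_deriv A Z (\<omega> X Y) p
     - \<omega> (lie_bracket A X Y) Z p + \<omega> (lie_bracket A X Z) Y p - \<omega> (lie_bracket A Y Z) X p)"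

definition wedge12 :: "('m, 'e) one_form \<Rightarrow> ('m, 'e) two_form \<Rightarrow> ('m, 'e) three_form" where
  "wedge12 \<alpha> \<omega> X Y Z = (\<lambda>p.
     form_app \<alpha> X p * \<omega> Y Z p - form_app \<alpha> Y p * \<omega> X Z p + form_app \<alpha> Z p * \<omega> X Y p)"

definition contract3 :: "('m, 'e) vector_field \<Rightarrow> ('m, 'e) three_form \<Rightarrow> ('m, 'e) two_form" where
  "contract3 X B Y Z = B X Y Z"

section \<open>Affine connections\<close>

type_synonym ('m, 'e) connection =
  "('m, 'e) vector_field \<Rightarrow> ('m, 'e) vector_field \<Rightarrow> ('m, 'e) vector_field"

text \<open>\<open>D X Y\<close> is the covariant derivative of \<open>Y\<close> along \<open>X\<close>. A connection is an operation on
  smooth vector fields only; the last clause fixes the irrelevant values elsewhere, so that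
  connections are equal iff they agree on smooth vector fields.\<close>

definition affine_connection ::
  "('m, 'e::euclidean_space) atlas \<Rightarrow> ('m, 'e) connection \<Rightarrow> bool" where
  "affine_connection A D \<longleftrightarrow>
     (\<forall>X Y. smooth_vf A X \<and> smooth_vf A Y \<longrightarrow> smooth_vf A (D X Y)) \<and>
     (\<forall>X X' Y. smooth_vf A X \<and> smooth_vf A X' \<and> smooth_vf A Y \<longrightarrow>
        D (\<lambda>p. X p + X' p) Y = (\<lambda>p. D X Y p + D X' Y p)) \<and>
     (\<forall>X Y Y'. smooth_vf A X \<and> smooth_vf A Y \<and> smooth_vf A Y' \<longrightarrow>
        D X (\<lambda>p. Y p + Y' p) = (\<lambda>p. D X Y p + D X Y' p)) \<and>
     (\<forall>f X Y. smooth_fun A f \<and> smooth_vf A X \<and> smooth_vf A Y \<longrightarrow>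
        D (\<lambda>p. f p *\<^sub>R X p) Y = (\<lambda>p. f p *\<^sub>R D X Y p)) \<and>
     (\<forall>f X Y. smooth_fun A f \<and> smooth_vf A X \<and> smooth_vf A Y \<longrightarrow>
        D X (\<lambda>p. f p *\<^sub>R Y p) = (\<lambda>p. f p *\<^sub>R D X Y p + dir_deriv A X f p *\<^sub>R Y p)) \<and>
     (\<forall>X Y. \<not> (smooth_vf A X \<and> smooth_vf A Y) \<longrightarrow> D X Y = (\<lambda>_. 0))"

definition torsion ::
  "('m, 'e::euclidean_space) atlas \<Rightarrow> ('m, 'e) connection
     \<Rightarrow> ('m, 'e) vector_field \<Rightarrow> ('m, 'e) vector_field \<Rightarrow> ('m, 'e) vector_field" where
  "torsion A D X Y = (\<lambda>p. D X Y p - D Y X p - lie_bracket A X Y p)"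

definition torsion3 ::
  "('m, 'e::euclidean_space) atlas \<Rightarrow> ('m, 'e) bilinear_field \<Rightarrow> ('m, 'e) connection
     \<Rightarrow> ('m, 'e) three_form" where
  "torsion3 A g D X Y Z = bil_app g (torsion A D X Y) Z"

definition skew_torsion ::
  "('m, 'e::euclidean_space) atlas \<Rightarrow> ('m, 'e) bilinear_field \<Rightarrow> ('m, 'e) connection \<Rightarrow> bool" where
  "skew_torsion A g D \<longleftrightarrow> is_three_form A (torsion3 A g D)"

definition nabla_metric ::
  "('m, 'e::euclidean_space) atlas \<Rightarrow> ('m, 'e) connection \<Rightarrow> ('m, 'e) bilinear_field
     \<Rightarrow> ('m, 'e) three_form" where
  "nabla_metric A D g X Y Z = (\<lambda>p.
     dir_deriv A X (bil_app g Y Z) p - bil_app g (D X Y) Z p - bil_app g Y (D X Z) p)"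

definition nabla_endo ::
  "('m, 'e::euclidean_space) connection \<Rightarrow> ('m, 'e) endo_field
     \<Rightarrow> ('m, 'e) vector_field \<Rightarrow> ('m, 'e) vector_field \<Rightarrow> ('m, 'e) vector_field" where
  "nabla_endo D \<phi> X Y = (\<lambda>p. D X (endo_app \<phi> Y) p - endo_app \<phi> (D X Y) p)"

definition nabla_form ::
  "('m, 'e::euclidean_space) atlas \<Rightarrow> ('m, 'e) connection \<Rightarrow> ('m, 'e) one_form
     \<Rightarrow> ('m, 'e) two_form" where
  "nabla_form A D \<alpha> X Y = (\<lambda>p. dir_deriv A X (form_app \<alpha> Y) p - form_app \<alpha> (D X Y) p)"

definition metric_connection ::
  "('m, 'e::euclidean_space) atlas \<Rightarrow> ('m, 'e) bilinear_field \<Rightarrow> ('m, 'e) connection \<Rightarrow> bool" where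
  "metric_connection A g D \<longleftrightarrow> affine_connection A D \<and>
     (\<forall>X Y Z. smooth_vf A X \<and> smooth_vf A Y \<and> smooth_vf A Z \<longrightarrow>
        nabla_metric A D g X Y Z = (\<lambda>_. 0))"

definition levi_civita ::
  "('m, 'e::euclidean_space) atlas \<Rightarrow> ('m, 'e) bilinear_field \<Rightarrow> ('m, 'e) connection" where
  "levi_civita A g = (THE D. metric_connection A g D \<and>
     (\<forall>X Y. smooth_vf A X \<and> smooth_vf A Y \<longrightarrow> torsion A D X Y = (\<lambda>_. 0)))"

text \<open>\<open>L\<^sub>\<xi> g = 0\<close>, with the Lie derivative written out on vector fields.\<close>

definition killing ::
  "('m, 'e::euclidean_space) atlas \<Rightarrow> ('m, 'e) bilinear_field \<Rightarrow> ('m, 'e) vector_field \<Rightarrow> bool" where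
  "killing A g \<xi> \<longleftrightarrow> smooth_vf A \<xi> \<and>
     (\<forall>X Y. smooth_vf A X \<and> smooth_vf A Y \<longrightarrow>
        (\<lambda>p. dir_deriv A \<xi> (bil_app g X Y) p
              - bil_app g (lie_bracket A \<xi> X) Y p
              - bil_app g X (lie_bracket A \<xi> Y) p) = (\<lambda>_. 0))"

section \<open>Metric \<open>f\<close>-manifolds\<close>

definition metric_f_manifold ::
  "('m::{t2_space, second_countable_topology}, 'e::euclidean_space) atlas \<Rightarrow> nat \<Rightarrow> nat
     \<Rightarrow> ('m, 'e) endo_field \<Rightarrow> (nat \<Rightarrow> ('m, 'e) vector_field) \<Rightarrow> (nat \<Rightarrow> ('m, 'e) one_form)
     \<Rightarrow> ('m, 'e) bilinear_field \<Rightarrow> bool" where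
  "metric_f_manifold A n s \<phi> \<xi> \<eta> g \<longleftrightarrow>
     smooth_connected_manifold A \<and>
     DIM('e) = 2 * n + s \<and>
     smooth_endo A \<phi> \<and>
     (\<forall>p. dim (range (\<phi> p)) = 2 * n) \<and>
     (\<forall>p v. \<phi> p (\<phi> p (\<phi> p v)) + \<phi> p v = 0) \<and>
     (\<forall>i\<in>{1..s}. smooth_vf A (\<xi> i)) \<and>
     (\<forall>i\<in>{1..s}. smooth_one_form A (\<eta> i)) \<and>
     (\<forall>p. {v. \<phi> p v = 0} = span ((\<lambda>i. \<xi> i p) ` {1..s})) \<and>
     (\<forall>i\<in>{1..s}. \<forall>j\<in>{1..s}. \<forall>p. \<eta> i p (\<xi> j p) = (if i = j then 1 else 0)) \<and>
     (\<forall>i\<in>{1..s}. \<forall>p v. \<eta> i p (\<phi> p v) = 0) \<and>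
     (\<forall>p v. \<phi> p (\<phi> p v) = - v + (\<Sum>i=1..s. \<eta> i p v *\<^sub>R \<xi> i p)) \<and>
     riemannian_metric A g \<and>
     (\<forall>p u v. g p (\<phi> p u) (\<phi> p v) = g p u v - (\<Sum>i=1..s. \<eta> i p u * \<eta> i p v))"

definition fundamental_form ::
  "('m, 'e) endo_field \<Rightarrow> ('m, 'e) bilinear_field \<Rightarrow> ('m, 'e) two_form" where
  "fundamental_form \<phi> g X Y = bil_app g X (endo_app \<phi> Y)"

definition d_phi_F ::
  "('m, 'e::euclidean_space) atlas \<Rightarrow> ('m, 'e) endo_field \<Rightarrow> ('m, 'e) bilinear_field
     \<Rightarrow> ('m, 'e) three_form" where
  "d_phi_F A \<phi> g X Y Z = (\<lambda>p.
     - ext_deriv2 A (fundamental_form \<phi> g) (endo_app \<phi> X) (endo_app \<phi> Y) (endo_app \<phi> Z) p)"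

definition nijenhuis_phi ::
  "('m, 'e::euclidean_space) atlas \<Rightarrow> ('m, 'e) endo_field
     \<Rightarrow> ('m, 'e) vector_field \<Rightarrow> ('m, 'e) vector_field \<Rightarrow> ('m, 'e) vector_field" where
  "nijenhuis_phi A \<phi> X Y = (\<lambda>p.
     lie_bracket A (endo_app \<phi> X) (endo_app \<phi> Y) p
     + endo_app \<phi> (endo_app \<phi> (lie_bracket A X Y)) p
     - endo_app \<phi> (lie_bracket A X (endo_app \<phi> Y)) p
     - endo_app \<phi> (lie_bracket A (endo_app \<phi> X) Y) p)"

definition nijenhuis1 ::
  "('m, 'e::euclidean_space) atlas \<Rightarrow> nat \<Rightarrow> ('m, 'e) endo_field
     \<Rightarrow> (nat \<Rightarrow> ('m, 'e) vector_field) \<Rightarrow> (nat \<Rightarrow> ('m, 'e) one_form)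
     \<Rightarrow> ('m, 'e) vector_field \<Rightarrow> ('m, 'e) vector_field \<Rightarrow> ('m, 'e) vector_field" where
  "nijenhuis1 A s \<phi> \<xi> \<eta> X Y = (\<lambda>p.
     nijenhuis_phi A \<phi> X Y p + (\<Sum>i=1..s. ext_deriv1 A (\<eta> i) X Y p *\<^sub>R \<xi> i p))"

definition nijenhuis1_form ::
  "('m, 'e::euclidean_space) atlas \<Rightarrow> nat \<Rightarrow> ('m, 'e) endo_field
     \<Rightarrow> (nat \<Rightarrow> ('m, 'e) vector_field) \<Rightarrow> (nat \<Rightarrow> ('m, 'e) one_form)
     \<Rightarrow> ('m, 'e) bilinear_field \<Rightarrow> ('m, 'e) three_form" where
  "nijenhuis1_form A s \<phi> \<xi> \<eta> g X Y Z = bil_app g (nijenhuis1 A s \<phi> \<xi> \<eta> X Y) Z"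

definition structure_preserving ::
  "('m, 'e::euclidean_space) atlas \<Rightarrow> nat \<Rightarrow> ('m, 'e) endo_field
     \<Rightarrow> (nat \<Rightarrow> ('m, 'e) vector_field) \<Rightarrow> (nat \<Rightarrow> ('m, 'e) one_form)
     \<Rightarrow> ('m, 'e) connection \<Rightarrow> bool" where
  "structure_preserving A s \<phi> \<xi> \<eta> D \<longleftrightarrow>
     (\<forall>X Y. smooth_vf A X \<and> smooth_vf A Y \<longrightarrow> nabla_endo D \<phi> X Y = (\<lambda>_. 0)) \<and>
     (\<forall>i\<in>{1..s}. \<forall>X. smooth_vf A X \<longrightarrow> D X (\<xi> i) = (\<lambda>_. 0)) \<and>
     (\<forall>i\<in>{1..s}. \<forall>X Y. smooth_vf A X \<and> smooth_vf A Y \<longrightarrow>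
        nabla_form A D (\<eta> i) X Y = (\<lambda>_. 0))"

end

theory Submission
  imports Defs
begin

text \<open>
  A metric connection is determined by its torsion. If the torsion \<open>T\<close> is a 3-form, it is recovered
  from a Koszul formula with the additional summand \<open>T/2\<close>; conversely, for every 3-form \<open>T\<close> this
  formula defines a metric connection with torsion \<open>T\<close> (\<open>metric_connection_koszul\<close>,
  \<open>metric_connection_skew_connection\<close>), and \<open>T = 0\<close> gives the Levi-Civita connection. So everything
  reduces to algebra with the torsion.

  \<^emph>\<open>Uniqueness.\<close> Let \<open>\<nabla>\<close> be metric with torsion 3-form \<open>T\<close> and \<open>\<nabla>\<xi>\<^sub>i = 0\<close>, hence \<open>\<nabla>\<eta>\<^sub>i = 0\<close>. Put
  \<open>S(X,Y,Z) = g((\<nabla>\<^sub>X\<phi>)Y,Z)\<close>. Expanding all derivatives and brackets by \<open>\<nabla>\<close> and \<open>T\<close> gives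
  \<open>\<xi>\<^sub>i \<lrcorner> T = d\<eta>\<^sub>i\<close> (\<open>T3_\<xi>\<close>), and
  \<open>dF(X,Y,Z) = T(X,Y,\<phi>Z) - T(X,Z,\<phi>Y) + T(Y,Z,\<phi>X)\<close>,
  \<open>N(X,Y,Z) = T(X,Y,Z) - T(\<phi>X,\<phi>Y,Z) - T(X,\<phi>Y,\<phi>Z) - T(\<phi>X,Y,\<phi>Z)\<close>,
  both up to terms in \<open>S\<close> (\<open>ext_deriv2_F\<close>, \<open>N3_torsion\<close>). If \<open>S = 0\<close>, adding \<open>d\<^sup>\<phi>F\<close> and \<open>N\<close> leaves
  \<open>T - \<Sum> \<eta>\<^sub>i \<and> (d\<eta>\<^sub>i \<circ> \<phi>)\<close>, while \<open>\<xi>\<^sub>i \<lrcorner> N = d\<eta>\<^sub>i - d\<eta>\<^sub>i \<circ> \<phi>\<close>. This is the torsion formula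
  (\<open>torsion_eq_char_torsion\<close>), and the torsion determines \<open>\<nabla>\<close>.

  \<^emph>\<open>Existence.\<close> Prescribe the 3-form \<open>T\<close> of the formula. Since the \<open>\<xi>\<^sub>i\<close> commute and are Killing,
  \<open>\<xi>\<^sub>i \<lrcorner> T = d\<eta>\<^sub>i = 2\<nabla>\<^sup>g\<eta>\<^sub>i\<close>, and the \<open>T/2\<close> in the Koszul formula cancels \<open>\<nabla>\<^sup>g\<xi>\<^sub>i\<close>: the connection
  satisfies \<open>\<nabla>\<xi>\<^sub>i = 0\<close> (\<open>char_connection\<close>). The identities above, now with the terms in \<open>S\<close>, yield
  \<open>S(X,Y,Z) + S(Y,Z,X) = S(Z,X,Y)\<close> on the image of \<open>\<phi>\<close>, which forces \<open>S = 0\<close> there; the total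
  skew-symmetry of \<open>N\<close> gives \<open>\<nabla>\<^sub>\<xi>\<phi> = 0\<close> (\<open>S3_horizontal_eq_0\<close>, \<open>\<phi>_parallel\<close>).

  The calculus on manifolds needed for this is developed on global smooth fields. Cutoff functions
  provide enough of them: every tangent vector extends to a smooth field, smooth fields are
  characterised by their action on smooth functions (which yields the rules for the Lie bracket), and
  a functional on fields that is linear over the functions is represented through the metric by a
  smooth field (\<open>covector_field_representation\<close>).
\<close>

section \<open>Calculus of smooth maps between open sets\<close>

lemma Ck_on_cong:
  assumes "open S" "\<And>x. x \<in> S \<Longrightarrow> f x = g x" "Ck_on k S f"
  shows "Ck_on k S g"
  using assms(2,3)
proof (induction k arbitrary: f g)
  case 0
  then show ?case by (simp cong: continuous_on_cong)
next
  case (Suc k)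
  have d: "(g has_derivative frechet_derivative f (at x)) (at x)" if x: "x \<in> S" for x
  proof -
    have "(f has_derivative frechet_derivative f (at x)) (at x)"
      using Suc.prems(2) x by (auto simp: frechet_derivative_works)
    then show ?thesis
      by (rule has_derivative_transform_within_open[OF _ assms(1) x]) (rule Suc.prems(1))
  qed
  have "Ck_on k S (\<lambda>x. frechet_derivative g (at x) v)" for v
  proof (rule Suc.IH)
    show "frechet_derivative f (at x) v = frechet_derivative g (at x) v" if "x \<in> S" for x
      using frechet_derivative_at[OF d[OF that]] by simp
    show "Ck_on k S (\<lambda>x. frechet_derivative f (at x) v)"
      using Suc.prems(2) by simp
  qed
  then show ?case
    using d by (auto simp: differentiable_def)
qed

lemma Ck_on_Suc_intro:
  assumes "open S" and d: "\<And>x. x \<in> S \<Longrightarrow> (f has_derivative f' x) (at x)"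
    and c: "\<And>v. Ck_on k S (\<lambda>x. f' x v)"
  shows "Ck_on (Suc k) S f"
proof -
  have "f' x v = frechet_derivative f (at x) v" if "x \<in> S" for x v
    using frechet_derivative_at[OF d[OF that]] by simp
  then have "Ck_on k S (\<lambda>x. frechet_derivative f (at x) v)" for v
    by (intro Ck_on_cong[OF assms(1) _ c])
  then show ?thesis
    using d by (auto simp: differentiable_def)
qed

lemma Ck_on_Suc_has_derivative:
  "Ck_on (Suc k) S f \<Longrightarrow> x \<in> S \<Longrightarrow> (f has_derivative frechet_derivative f (at x)) (at x)"
  by (auto simp: frechet_derivative_works)

lemma Ck_on_SucD: "Ck_on (Suc k) S f \<Longrightarrow> Ck_on k S f"
proof (induction k arbitrary: f)
  case 0
  then show ?case
    by (auto intro!: continuous_at_imp_continuous_on differentiable_imp_continuous_within)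
next
  case (Suc k)
  have "Ck_on (Suc k) S (\<lambda>x. frechet_derivative f (at x) v)" for v
    using Suc.prems by simp
  then have "Ck_on k S (\<lambda>x. frechet_derivative f (at x) v)" for v
    by (rule Suc.IH)
  then show ?case using Suc.prems by simp
qed

lemma Ck_on_subset: "Ck_on k S f \<Longrightarrow> T \<subseteq> S \<Longrightarrow> Ck_on k T f"
  by (induction k arbitrary: f) (auto intro: continuous_on_subset)

lemma Ck_on_local:
  assumes "\<And>x. x \<in> S \<Longrightarrow> \<exists>U. open U \<and> x \<in> U \<and> Ck_on k U f"
  shows "Ck_on k S f"
  using assms
proof (induction k arbitrary: f)
  case 0
  have "isCont f x" if x: "x \<in> S" for x
  proof -
    obtain U where "open U" "x \<in> U" "continuous_on U f" using 0[OF x] by auto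
    then show ?thesis by (simp add: continuous_on_eq_continuous_at)
  qed
  then show ?case by (simp add: continuous_at_imp_continuous_on)
next
  case (Suc k)
  have "Ck_on k S (\<lambda>x. frechet_derivative f (at x) v)" for v
  proof (rule Suc.IH)
    fix x assume "x \<in> S"
    then obtain U where "open U" "x \<in> U" "Ck_on (Suc k) U f" using Suc.prems by blast
    then show "\<exists>U. open U \<and> x \<in> U \<and> Ck_on k U (\<lambda>x. frechet_derivative f (at x) v)" by auto
  qed
  moreover have "f differentiable (at x)" if "x \<in> S" for x
    using Suc.prems[OF that] by auto
  ultimately show ?case by simp
qed

lemma Ck_on_const: "Ck_on k S (\<lambda>x. c)"
  by (induction k arbitrary: c) auto

lemma Ck_on_bounded_linear:
  assumes "bounded_linear L" "open S" "Ck_on k S f"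
  shows "Ck_on k S (\<lambda>x. L (f x))"
  using assms(3)
proof (induction k arbitrary: f)
  case 0
  then show ?case using assms(1) by (simp add: bounded_linear.continuous_on)
next
  case (Suc k)
  show ?case
    by (rule Ck_on_Suc_intro[OF assms(2) bounded_linear.has_derivative[OF assms(1)
          Ck_on_Suc_has_derivative[OF Suc.prems]]])
      (use Suc assms in auto)
qed

lemma Ck_on_add:
  assumes "open S" "Ck_on k S f" "Ck_on k S g"
  shows "Ck_on k S (\<lambda>x. f x + g x)"
  using assms(2,3)
proof (induction k arbitrary: f g)
  case 0
  then show ?case by (simp add: continuous_on_add)
next
  case (Suc k)
  show ?case
    by (rule Ck_on_Suc_intro[OF assms(1) has_derivative_add[OF
          Ck_on_Suc_has_derivative[OF Suc.prems(1)] Ck_on_Suc_has_derivative[OF Suc.prems(2)]]])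
      (use Suc assms in auto)
qed

lemma Ck_on_bilinear:
  assumes "bounded_bilinear B" "open S" "Ck_on k S f" "Ck_on k S g"
  shows "Ck_on k S (\<lambda>x. B (f x) (g x))"
  using assms(3,4)
proof (induction k arbitrary: f g)
  case 0
  then show ?case using assms(1) by (simp add: bounded_bilinear.continuous_on)
next
  case (Suc k)
  have f: "Ck_on k S f" and g: "Ck_on k S g"
    using Suc.prems Ck_on_SucD by blast+
  show ?case
    by (rule Ck_on_Suc_intro[OF assms(2) bounded_bilinear.FDERIV[OF assms(1)
          Ck_on_Suc_has_derivative[OF Suc.prems(1)] Ck_on_Suc_has_derivative[OF Suc.prems(2)]]])
      (use Suc assms f g in \<open>auto intro!: Ck_on_add\<close>)
qed

lemma Ck_on_sum:
  assumes "open S" "\<And>i. i \<in> I \<Longrightarrow> Ck_on k S (f i)"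
  shows "Ck_on k S (\<lambda>x. \<Sum>i\<in>I. f i x)"
  using assms(2)
  by (induction I rule: infinite_finite_induct) (auto intro: Ck_on_const Ck_on_add assms(1))

lemma linear_expand:
  assumes "linear L"
  shows "L (v :: 'a::euclidean_space) = (\<Sum>b\<in>Basis. (v \<bullet> b) *\<^sub>R L b)"
proof -
  have "L v = L (\<Sum>b\<in>Basis. (v \<bullet> b) *\<^sub>R b)"
    by (simp add: euclidean_representation)
  also have "\<dots> = (\<Sum>b\<in>Basis. (v \<bullet> b) *\<^sub>R L b)"
    by (simp add: linear_sum[OF assms] linear_scale[OF assms])
  finally show ?thesis .
qed

lemma Ck_on_compose:
  fixes f :: "'b::euclidean_space \<Rightarrow> 'c::real_normed_vector"
  assumes "open S" "open T" "g ` S \<subseteq> T" "Ck_on k T f" "Ck_on k S g"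
  shows "Ck_on k S (\<lambda>x. f (g x))"
  using assms(4,5)
proof (induction k arbitrary: f)
  case 0
  then show ?case
    using continuous_on_compose2[OF _ _ assms(3), of f] by simp
next
  case (Suc k)
  have gx: "g x \<in> T" if "x \<in> S" for x using that assms(3) by auto
  have g: "Ck_on k S g" using Suc.prems Ck_on_SucD by blast
  define Df where "Df = (\<lambda>y. frechet_derivative f (at y))"
  define Dg where "Dg = (\<lambda>y. frechet_derivative g (at y))"
  show ?case
  proof (rule Ck_on_Suc_intro[OF assms(1)])
    fix x assume x: "x \<in> S"
    have f': "(f has_derivative Df (g x)) (at (g x))"
      unfolding Df_def by (rule Ck_on_Suc_has_derivative[OF Suc.prems(1) gx[OF x]])
    have g': "(g has_derivative Dg x) (at x)"
      unfolding Dg_def by (rule Ck_on_Suc_has_derivative[OF Suc.prems(2) x])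
    have "((\<lambda>x. f (g x)) has_derivative (\<lambda>v. Df (g x) (Dg x v))) (at x)"
      by (rule has_derivative_compose[OF g' f'])
    also have "(\<lambda>v. Df (g x) (Dg x v)) = (\<lambda>v. \<Sum>b\<in>Basis. (Dg x v \<bullet> b) *\<^sub>R Df (g x) b)"
      by (rule ext) (rule linear_expand[OF has_derivative_linear[OF f']])
    finally show "((\<lambda>x. f (g x)) has_derivative
        (\<lambda>v. \<Sum>b\<in>Basis. (Dg x v \<bullet> b) *\<^sub>R Df (g x) b)) (at x)" .
  next
    fix v
    have "Ck_on k S (\<lambda>x. Df (g x) b)" for b
      by (rule Suc.IH) (use Suc.prems g in \<open>auto simp: Df_def\<close>)
    moreover have "Ck_on k S (\<lambda>x. Dg x v \<bullet> b)" for b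
      using Suc.prems(2) by (simp add: Dg_def Ck_on_bounded_linear[OF bounded_linear_inner_left assms(1)])
    ultimately show "Ck_on k S (\<lambda>x. \<Sum>b\<in>Basis. (Dg x v \<bullet> b) *\<^sub>R Df (g x) b)"
      by (intro Ck_on_sum Ck_on_bilinear[OF bounded_bilinear_scaleR] assms(1))
  qed
qed

lemma smooth_on_cong:
  "open S \<Longrightarrow> (\<And>x. x \<in> S \<Longrightarrow> f x = g x) \<Longrightarrow> smooth_on S f \<Longrightarrow> smooth_on S g"
  unfolding smooth_on_def using Ck_on_cong by blast

lemma smooth_on_subset: "smooth_on S f \<Longrightarrow> T \<subseteq> S \<Longrightarrow> smooth_on T f"
  unfolding smooth_on_def using Ck_on_subset by blast

lemma smooth_on_local:
  "(\<And>x. x \<in> S \<Longrightarrow> \<exists>U. open U \<and> x \<in> U \<and> smooth_on U f) \<Longrightarrow> smooth_on S f"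
  unfolding smooth_on_def by (meson Ck_on_local)

lemma smooth_on_const: "smooth_on S (\<lambda>x. c)"
  by (simp add: smooth_on_def Ck_on_const)

lemma smooth_on_bounded_linear:
  "bounded_linear L \<Longrightarrow> open S \<Longrightarrow> smooth_on S f \<Longrightarrow> smooth_on S (\<lambda>x. L (f x))"
  by (simp add: smooth_on_def Ck_on_bounded_linear)

lemma smooth_on_add:
  "open S \<Longrightarrow> smooth_on S f \<Longrightarrow> smooth_on S g \<Longrightarrow> smooth_on S (\<lambda>x. f x + g x)"
  by (simp add: smooth_on_def Ck_on_add)

lemma smooth_on_minus: "open S \<Longrightarrow> smooth_on S f \<Longrightarrow> smooth_on S (\<lambda>x. - f x)"
  by (rule smooth_on_bounded_linear[OF bounded_linear_minus[OF bounded_linear_ident]])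

lemma smooth_on_diff:
  "open S \<Longrightarrow> smooth_on S f \<Longrightarrow> smooth_on S g \<Longrightarrow> smooth_on S (\<lambda>x. f x - g x)"
  using smooth_on_add[OF _ _ smooth_on_minus, of S f g] by simp

lemma smooth_on_bilinear:
  "bounded_bilinear B \<Longrightarrow> open S \<Longrightarrow> smooth_on S f \<Longrightarrow> smooth_on S g \<Longrightarrow>
    smooth_on S (\<lambda>x. B (f x) (g x))"
  by (simp add: smooth_on_def Ck_on_bilinear)

lemmas smooth_on_scaleR = smooth_on_bilinear[OF bounded_bilinear_scaleR]

lemma smooth_on_mult:
  fixes f g :: "_ \<Rightarrow> real"
  shows "open S \<Longrightarrow> smooth_on S f \<Longrightarrow> smooth_on S g \<Longrightarrow> smooth_on S (\<lambda>x. f x * g x)"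
  by (rule smooth_on_bilinear[OF bounded_bilinear_mult])

lemmas smooth_on_inner = smooth_on_bilinear[OF bounded_bilinear_inner]

lemma smooth_on_sum:
  "open S \<Longrightarrow> (\<And>i. i \<in> I \<Longrightarrow> smooth_on S (f i)) \<Longrightarrow> smooth_on S (\<lambda>x. \<Sum>i\<in>I. f i x)"
  by (simp add: smooth_on_def Ck_on_sum)

lemma smooth_on_compose:
  fixes f :: "'b::euclidean_space \<Rightarrow> 'c::real_normed_vector"
  shows "open S \<Longrightarrow> open T \<Longrightarrow> g ` S \<subseteq> T \<Longrightarrow> smooth_on T f \<Longrightarrow> smooth_on S g \<Longrightarrow>
    smooth_on S (\<lambda>x. f (g x))"
  unfolding smooth_on_def using Ck_on_compose by blast

lemma smooth_on_ident: "open S \<Longrightarrow> smooth_on S (\<lambda>x. x)"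
  unfolding smooth_on_def
proof
  fix k assume S: "open S"
  show "Ck_on k S (\<lambda>x. x)"
  proof (cases k)
    case (Suc j)
    show ?thesis unfolding Suc
      by (rule Ck_on_Suc_intro[OF S has_derivative_ident]) (simp add: Ck_on_const)
  qed (simp add: continuous_on_id)
qed

lemma smooth_on_has_derivative:
  "smooth_on S f \<Longrightarrow> x \<in> S \<Longrightarrow> (f has_derivative frechet_derivative f (at x)) (at x)"
  unfolding smooth_on_def using Ck_on_Suc_has_derivative by blast

lemma smooth_on_continuous: "smooth_on S f \<Longrightarrow> continuous_on S f"
  unfolding smooth_on_def by (metis Ck_on.simps(1))

lemma smooth_on_frechet_derivative:
  "smooth_on S f \<Longrightarrow> smooth_on S (\<lambda>x. frechet_derivative f (at x) v)"
  unfolding smooth_on_def by (metis Ck_on.simps(2))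

text \<open>A smooth family of linear maps is smooth jointly with its argument: expand the argument in
  the standard basis.\<close>

lemma smooth_on_linear_combination:
  fixes L :: "'a::real_normed_vector \<Rightarrow> 'e::euclidean_space \<Rightarrow> 'b::real_normed_vector"
  assumes "open S" "\<And>x. x \<in> S \<Longrightarrow> linear (L x)" "\<And>b. smooth_on S (\<lambda>x. L x b)" "smooth_on S v"
  shows "smooth_on S (\<lambda>x. L x (v x))"
proof (rule smooth_on_cong[OF assms(1)])
  show "(\<Sum>b\<in>Basis. (v x \<bullet> b) *\<^sub>R L x b) = L x (v x)" if "x \<in> S" for x
    by (rule linear_expand[symmetric, OF assms(2)[OF that]])
  show "smooth_on S (\<lambda>x. \<Sum>b\<in>Basis. (v x \<bullet> b) *\<^sub>R L x b)"
    by (intro smooth_on_sum smooth_on_scaleR smooth_on_inner assms smooth_on_const)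
qed

lemma smooth_on_frechet_derivative_field:
  fixes f :: "'a::euclidean_space \<Rightarrow> 'b::real_normed_vector"
  assumes "open S" "smooth_on S f" "smooth_on S v"
  shows "smooth_on S (\<lambda>x. frechet_derivative f (at x) (v x))"
  by (rule smooth_on_linear_combination[OF assms(1), where L = "\<lambda>x. frechet_derivative f (at x)"])
    (use assms in \<open>auto intro: has_derivative_linear smooth_on_has_derivative smooth_on_frechet_derivative\<close>)

lemma smooth_on_inverse: "smooth_on (- {0::real}) inverse"
  unfolding smooth_on_def
proof
  have o: "open (- {0::real})" by auto
  show "Ck_on k (- {0::real}) inverse" for k
  proof (induction k)
    case 0
    show ?case by (auto intro!: continuous_on_inverse continuous_on_id)
  next
    case (Suc k)
    show ?case
      by (rule Ck_on_Suc_intro[OF o has_derivative_inverse'])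
        (use o in \<open>auto intro!: Ck_on_bounded_linear[OF bounded_linear_minus[OF bounded_linear_ident]]
           Ck_on_bilinear[OF bounded_bilinear_mult] Ck_on_const Suc\<close>)
  qed
qed

lemma smooth_on_divide:
  fixes f g :: "'a::euclidean_space \<Rightarrow> real"
  assumes "open S" "smooth_on S f" "smooth_on S g" "\<And>x. x \<in> S \<Longrightarrow> g x \<noteq> 0"
  shows "smooth_on S (\<lambda>x. f x / g x)"
  unfolding divide_inverse
  by (intro smooth_on_mult smooth_on_compose[OF _ _ _ smooth_on_inverse] assms)
     (use assms in auto)

text \<open>The second difference of \<open>f\<close> over a small parallelogram equals, by two applications of the
  mean value theorem, either mixed second derivative at some nearby point.\<close>

lemma second_difference_mean_value:
  fixes f :: "'a::real_normed_vector \<Rightarrow> real"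
  assumes t: "0 < t"
    and S: "\<And>a b. 0 \<le> a \<Longrightarrow> a \<le> t \<Longrightarrow> 0 \<le> b \<Longrightarrow> b \<le> t \<Longrightarrow> x + a *\<^sub>R u + b *\<^sub>R v \<in> S"
    and f: "Ck_on 2 S f"
  obtains a b where "0 \<le> a" "a \<le> t" "0 \<le> b" "b \<le> t"
    "f (x + t *\<^sub>R u + t *\<^sub>R v) - f (x + t *\<^sub>R u) - f (x + t *\<^sub>R v) + f x
      = t * t * frechet_derivative (\<lambda>y. frechet_derivative f (at y) u) (at (x + a *\<^sub>R u + b *\<^sub>R v)) v"
proof -
  define fu where "fu = (\<lambda>y. frechet_derivative f (at y) u)"
  have f': "(f has_derivative frechet_derivative f (at y)) (at y)" if "y \<in> S" for y
    using f that by (intro Ck_on_Suc_has_derivative[of 1]) (auto simp: numeral_2_eq_2)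
  have fu': "(fu has_derivative frechet_derivative fu (at y)) (at y)" if "y \<in> S" for y
    using f that unfolding fu_def
    by (intro Ck_on_Suc_has_derivative[of 0]) (auto simp: numeral_2_eq_2)
  define h where "h = (\<lambda>a. f (x + a *\<^sub>R u + t *\<^sub>R v) - f (x + a *\<^sub>R u))"
  have h': "(h has_real_derivative fu (x + a *\<^sub>R u + t *\<^sub>R v) - fu (x + a *\<^sub>R u)) (at a)"
    if a: "0 \<le> a" "a \<le> t" for a
  proof -
    have 1: "((\<lambda>a. x + a *\<^sub>R u + t *\<^sub>R v) has_derivative (\<lambda>r. r *\<^sub>R u)) (at a)"
      and 2: "((\<lambda>a. x + a *\<^sub>R u) has_derivative (\<lambda>r. r *\<^sub>R u)) (at a)"
      by (auto intro!: derivative_eq_intros)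
    have m1: "x + a *\<^sub>R u + t *\<^sub>R v \<in> S" and m2: "x + a *\<^sub>R u \<in> S"
      using S[of a t] S[of a 0] a t by auto
    have "(h has_derivative (\<lambda>r. frechet_derivative f (at (x + a *\<^sub>R u + t *\<^sub>R v)) (r *\<^sub>R u)
        - frechet_derivative f (at (x + a *\<^sub>R u)) (r *\<^sub>R u))) (at a)"
      unfolding h_def
      by (intro has_derivative_diff has_derivative_compose[OF 1 f'[OF m1]]
          has_derivative_compose[OF 2 f'[OF m2]])
    moreover have "(\<lambda>r. frechet_derivative f (at (x + a *\<^sub>R u + t *\<^sub>R v)) (r *\<^sub>R u)
        - frechet_derivative f (at (x + a *\<^sub>R u)) (r *\<^sub>R u))
        = (*) (fu (x + a *\<^sub>R u + t *\<^sub>R v) - fu (x + a *\<^sub>R u))"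
      using linear_scale[OF has_derivative_linear[OF f'[OF m1]]]
        linear_scale[OF has_derivative_linear[OF f'[OF m2]]]
      by (auto simp: fu_def algebra_simps)
    ultimately show ?thesis
      by (simp add: has_field_derivative_def)
  qed
  obtain a where a: "0 < a" "a < t"
    and ha: "h t - h 0 = (t - 0) * (fu (x + a *\<^sub>R u + t *\<^sub>R v) - fu (x + a *\<^sub>R u))"
    using MVT2[OF t, of h "\<lambda>a. fu (x + a *\<^sub>R u + t *\<^sub>R v) - fu (x + a *\<^sub>R u)"] h' by blast
  define k where "k = (\<lambda>b. fu (x + a *\<^sub>R u + b *\<^sub>R v))"
  have k': "(k has_real_derivative frechet_derivative fu (at (x + a *\<^sub>R u + b *\<^sub>R v)) v) (at b)"
    if b: "0 \<le> b" "b \<le> t" for b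
  proof -
    have 1: "((\<lambda>b. x + a *\<^sub>R u + b *\<^sub>R v) has_derivative (\<lambda>r. r *\<^sub>R v)) (at b)"
      by (auto intro!: derivative_eq_intros)
    have m: "x + a *\<^sub>R u + b *\<^sub>R v \<in> S"
      using S[of a b] a b by auto
    have "(k has_derivative (\<lambda>r. frechet_derivative fu (at (x + a *\<^sub>R u + b *\<^sub>R v)) (r *\<^sub>R v))) (at b)"
      unfolding k_def by (rule has_derivative_compose[OF 1 fu'[OF m]])
    moreover have "(\<lambda>r. frechet_derivative fu (at (x + a *\<^sub>R u + b *\<^sub>R v)) (r *\<^sub>R v))
       = (*) (frechet_derivative fu (at (x + a *\<^sub>R u + b *\<^sub>R v)) v)"
      using linear_scale[OF has_derivative_linear[OF fu'[OF m]]]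
      by (auto simp: algebra_simps)
    ultimately show ?thesis
      by (simp add: has_field_derivative_def)
  qed
  obtain b where b: "0 < b" "b < t"
    and kb: "k t - k 0 = (t - 0) * frechet_derivative fu (at (x + a *\<^sub>R u + b *\<^sub>R v)) v"
    using MVT2[OF t, of k "\<lambda>b. frechet_derivative fu (at (x + a *\<^sub>R u + b *\<^sub>R v)) v"] k' by blast
  show ?thesis
  proof (rule that[of a b])
    show "f (x + t *\<^sub>R u + t *\<^sub>R v) - f (x + t *\<^sub>R u) - f (x + t *\<^sub>R v) + f x
      = t * t * frechet_derivative (\<lambda>y. frechet_derivative f (at y) u) (at (x + a *\<^sub>R u + b *\<^sub>R v)) v"
      using ha kb by (simp add: h_def k_def fu_def)
  qed (use a b in auto)
qed

text \<open>The second difference is symmetric in \<open>u\<close> and \<open>v\<close>, so the two mixed derivatives agree at points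
  arbitrarily close to \<open>x\<close>; by continuity they agree at \<open>x\<close>.\<close>

lemma second_derivative_symmetric:
  fixes f :: "'a::real_normed_vector \<Rightarrow> real"
  assumes S: "open S" "x \<in> S" and f: "Ck_on 2 S f"
  shows "frechet_derivative (\<lambda>y. frechet_derivative f (at y) u) (at x) v
       = frechet_derivative (\<lambda>y. frechet_derivative f (at y) v) (at x) u"
proof (rule ccontr)
  define P where "P = (\<lambda>u v y. frechet_derivative (\<lambda>y. frechet_derivative f (at y) u) (at y) v)"
  assume "\<not> ?thesis"
  then have pos: "0 < dist (P u v x) (P v u x)" (is "0 < ?e") by (simp add: P_def)
  have "continuous_on S (P u v)" for u v
    using f by (auto simp: numeral_2_eq_2 P_def)
  then have cont: "isCont (P u v) x" for u v
    using S continuous_on_eq_continuous_at by blast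
  obtain d1 where d1: "d1 > 0" "\<And>y. dist y x < d1 \<Longrightarrow> dist (P u v y) (P u v x) < ?e / 2"
    using cont[of u v] pos unfolding continuous_at_eps_delta by (meson half_gt_zero)
  obtain d2 where d2: "d2 > 0" "\<And>y. dist y x < d2 \<Longrightarrow> dist (P v u y) (P v u x) < ?e / 2"
    using cont[of v u] pos unfolding continuous_at_eps_delta by (meson half_gt_zero)
  obtain d3 where d3: "d3 > 0" "\<And>y. dist y x < d3 \<Longrightarrow> y \<in> S"
    using S by (auto simp: open_dist)
  define d where "d = min d1 (min d2 d3)"
  have d: "d > 0" using d1 d2 d3 by (simp add: d_def)
  \<comment> \<open>the whole parallelogram with sides \<open>t u\<close>, \<open>t v\<close> lies within distance \<open>d\<close> of \<open>x\<close>\<close>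
  define t where "t = d / (norm u + norm v + 1)"
  have nn: "norm u + norm v + 1 > 0" by (simp add: add_nonneg_pos)
  have t: "t > 0" using d nn by (simp add: t_def)
  have near: "dist (x + a *\<^sub>R u + b *\<^sub>R v) x < d"
    if "0 \<le> a" "a \<le> t" "0 \<le> b" "b \<le> t" for a b
  proof -
    have "dist (x + a *\<^sub>R u + b *\<^sub>R v) x = norm (a *\<^sub>R u + b *\<^sub>R v)"
      by (simp add: dist_norm)
    also have "\<dots> \<le> a * norm u + b * norm v"
      using norm_triangle_ineq[of "a *\<^sub>R u" "b *\<^sub>R v"] that by simp
    also have "\<dots> \<le> t * norm u + t * norm v"
      using that by (intro add_mono mult_right_mono) auto
    also have "\<dots> < t * (norm u + norm v + 1)"
      using t by (simp add: algebra_simps)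
    also have "\<dots> = d" using nn by (simp add: t_def)
    finally show ?thesis .
  qed
  obtain a b where ab: "0 \<le> a" "a \<le> t" "0 \<le> b" "b \<le> t" and
    e1: "f (x + t *\<^sub>R u + t *\<^sub>R v) - f (x + t *\<^sub>R u) - f (x + t *\<^sub>R v) + f x
      = t * t * P u v (x + a *\<^sub>R u + b *\<^sub>R v)"
    using second_difference_mean_value[OF t _ f, of x u v] near d3 unfolding P_def d_def
    by (metis min_less_iff_conj)
  have near': "dist (x + a *\<^sub>R v + b *\<^sub>R u) x < d"
    if "0 \<le> a" "a \<le> t" "0 \<le> b" "b \<le> t" for a b
    using near[of b a] that by (simp add: algebra_simps)
  obtain a' b' where ab': "0 \<le> a'" "a' \<le> t" "0 \<le> b'" "b' \<le> t" and
    e2: "f (x + t *\<^sub>R v + t *\<^sub>R u) - f (x + t *\<^sub>R v) - f (x + t *\<^sub>R u) + f x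
      = t * t * P v u (x + a' *\<^sub>R v + b' *\<^sub>R u)"
    using second_difference_mean_value[OF t _ f, of x v u] near' d3 unfolding P_def d_def
    by (metis min_less_iff_conj)
  have "t * t * P u v (x + a *\<^sub>R u + b *\<^sub>R v) = t * t * P v u (x + a' *\<^sub>R v + b' *\<^sub>R u)"
    unfolding e1[symmetric] e2[symmetric] by (simp add: algebra_simps)
  then have "P u v (x + a *\<^sub>R u + b *\<^sub>R v) = P v u (x + a' *\<^sub>R v + b' *\<^sub>R u)"
    using t by simp
  moreover have "dist (P u v (x + a *\<^sub>R u + b *\<^sub>R v)) (P u v x) < ?e / 2"
    using near[OF ab] by (intro d1) (simp add: d_def)
  moreover have "dist (P v u (x + a' *\<^sub>R v + b' *\<^sub>R u)) (P v u x) < ?e / 2"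
    using near'[OF ab'] by (intro d2) (simp add: d_def)
  ultimately show False
    by (metis dist_triangle_half_r order_less_irrefl)
qed

text \<open>The second-order terms of the two iterated derivatives cancel by symmetry; what is left is the
  coordinate expression of the Lie bracket applied to \<open>f\<close>.\<close>

lemma commutator_of_derivatives:
  fixes f :: "'e::euclidean_space \<Rightarrow> real"
  assumes S: "open S" "x \<in> S" and f: "smooth_on S f" and X: "smooth_on S X" and Y: "smooth_on S Y"
  shows "frechet_derivative (\<lambda>y. frechet_derivative f (at y) (Y y)) (at x) (X x)
       - frechet_derivative (\<lambda>y. frechet_derivative f (at y) (X y)) (at x) (Y x)
       = frechet_derivative f (at x) (frechet_derivative Y (at x) (X x) - frechet_derivative X (at x) (Y x))"
proof -
  define Df where "Df = (\<lambda>y. frechet_derivative f (at y))"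
  define D2 where "D2 = (\<lambda>b. frechet_derivative (\<lambda>y. Df y b) (at x))"
  have D2: "((\<lambda>y. Df y b) has_derivative D2 b) (at x)" for b
    unfolding D2_def Df_def by (rule smooth_on_has_derivative[OF smooth_on_frechet_derivative[OF f] S(2)])
  have linDf: "linear (Df y)" if "y \<in> S" for y
    unfolding Df_def using has_derivative_linear[OF smooth_on_has_derivative[OF f that]] .
  have *: "frechet_derivative (\<lambda>y. Df y (Z y)) (at x) u
      = Df x (frechet_derivative Z (at x) u) + (\<Sum>b\<in>Basis. \<Sum>b'\<in>Basis. (Z x \<bullet> b) * ((u \<bullet> b') * D2 b b'))"
    if Z: "smooth_on S Z" for Z u
  proof -
    define DZ where "DZ = frechet_derivative Z (at x)"
    have DZ: "((\<lambda>y. Z y \<bullet> b) has_derivative (\<lambda>u. DZ u \<bullet> b)) (at x)" for b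
      unfolding DZ_def by (intro bounded_linear.has_derivative[OF bounded_linear_inner_left]
          smooth_on_has_derivative[OF Z S(2)])
    have "((\<lambda>y. \<Sum>b\<in>Basis. (Z y \<bullet> b) * Df y b) has_derivative
        (\<lambda>u. \<Sum>b\<in>Basis. (Z x \<bullet> b) * D2 b u + (DZ u \<bullet> b) * Df x b)) (at x)"
      by (intro has_derivative_sum has_derivative_mult DZ D2)
    then have "((\<lambda>y. Df y (Z y)) has_derivative
        (\<lambda>u. \<Sum>b\<in>Basis. (Z x \<bullet> b) * D2 b u + (DZ u \<bullet> b) * Df x b)) (at x)"
    proof (rule has_derivative_transform_within_open[OF _ S])
      show "(\<Sum>b\<in>Basis. (Z y \<bullet> b) * Df y b) = Df y (Z y)" if "y \<in> S" for y
        using linear_expand[OF linDf[OF that], of "Z y"] by simp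
    qed
    from fun_cong[OF frechet_derivative_at[OF this], of u]
    have "frechet_derivative (\<lambda>y. Df y (Z y)) (at x) u
        = (\<Sum>b\<in>Basis. (Z x \<bullet> b) * D2 b u + (DZ u \<bullet> b) * Df x b)"
      by simp
    also have "\<dots> = (\<Sum>b\<in>Basis. (Z x \<bullet> b) * D2 b u) + (\<Sum>b\<in>Basis. (DZ u \<bullet> b) *\<^sub>R Df x b)"
      by (simp add: sum.distrib)
    also have "(\<Sum>b\<in>Basis. (DZ u \<bullet> b) *\<^sub>R Df x b) = Df x (DZ u)"
      by (rule linear_expand[OF linDf[OF S(2)], symmetric])
    also have "(\<Sum>b\<in>Basis. (Z x \<bullet> b) * D2 b u)
        = (\<Sum>b\<in>Basis. \<Sum>b'\<in>Basis. (Z x \<bullet> b) * ((u \<bullet> b') * D2 b b'))"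
    proof (rule sum.cong[OF refl])
      fix b :: 'e
      have "D2 b u = (\<Sum>b'\<in>Basis. (u \<bullet> b') *\<^sub>R D2 b b')"
        by (rule linear_expand[OF has_derivative_linear[OF D2]])
      then show "(Z x \<bullet> b) * D2 b u = (\<Sum>b'\<in>Basis. (Z x \<bullet> b) * ((u \<bullet> b') * D2 b b'))"
        by (simp add: sum_distrib_left)
    qed
    finally show ?thesis by (simp add: DZ_def)
  qed
  have sym: "D2 b b' = D2 b' b" for b b'
    unfolding D2_def Df_def
    by (rule second_derivative_symmetric[OF S]) (use f in \<open>simp add: smooth_on_def del: Ck_on.simps\<close>)
  have "(\<Sum>b\<in>Basis. \<Sum>b'\<in>Basis. (Y x \<bullet> b) * ((X x \<bullet> b') * D2 b b'))
      = (\<Sum>b\<in>Basis. \<Sum>b'\<in>Basis. (X x \<bullet> b) * ((Y x \<bullet> b') * D2 b b'))"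
    by (subst sum.swap) (simp add: sym mult.left_commute)
  then show ?thesis
    using *[OF X, of "Y x"] *[OF Y, of "X x"] linear_diff[OF linDf[OF S(2)]]
    by (simp add: Df_def)
qed

section \<open>Bump functions\<close>

text \<open>The powers of \<open>1/t\<close> are included because differentiating \<open>exp (- 1/t)\<close> produces them.\<close>

definition flat_fun :: "nat \<Rightarrow> real \<Rightarrow> real" where
  "flat_fun m t = (if t \<le> 0 then 0 else inverse t ^ m * exp (- inverse t))"

lemma flat_fun_tendsto_0: "(flat_fun m \<longlongrightarrow> 0) (at 0)"
proof -
  have "((\<lambda>t. inverse t ^ m / exp (inverse t)) \<longlongrightarrow> (0::real)) (at_right 0)"
    by (rule filterlim_compose[OF tendsto_power_div_exp_0 filterlim_inverse_at_top_right])
  then have "(flat_fun m \<longlongrightarrow> 0) (at_right 0)"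
    by (rule Lim_transform_eventually)
      (auto simp: flat_fun_def eventually_at_right_field exp_minus field_simps intro!: exI[of _ 1])
  moreover have "(flat_fun m \<longlongrightarrow> 0) (at_left 0)"
    by (rule Lim_transform_eventually[OF tendsto_const])
      (auto simp: flat_fun_def eventually_at_left_field intro!: exI[of _ "-1"])
  ultimately show ?thesis
    by (rule filterlim_split_at[rotated])
qed

text \<open>The family is closed under differentiation; at \<open>0\<close> the difference quotient of
  one member is the next member, which tends to \<open>0\<close>.\<close>

lemma flat_fun_has_derivative:
  "(flat_fun m has_real_derivative flat_fun (m + 2) t - real m * flat_fun (m + 1) t) (at t)"
proof -
  consider "t < 0" | "t = 0" | "t > 0" by linarith
  then show ?thesis
  proof cases
    case 1
    have "((\<lambda>_. 0) has_real_derivative 0) (at t)" by simp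
    then have "(flat_fun m has_real_derivative 0) (at t)"
      by (rule has_field_derivative_transform_within_open[where S="{..<0}"])
         (use 1 in \<open>auto simp: flat_fun_def\<close>)
    then show ?thesis using 1 by (simp add: flat_fun_def)
  next
    case 2
    have "(\<lambda>h. (flat_fun m (0 + h) - flat_fun m 0) / h) = flat_fun (m + 1)"
      by (auto simp: flat_fun_def fun_eq_iff field_simps)
    then have "(flat_fun m has_real_derivative 0) (at 0)"
      unfolding DERIV_def using flat_fun_tendsto_0[of "m + 1"] by simp
    then show ?thesis using 2 by (simp add: flat_fun_def)
  next
    case 3
    have "((\<lambda>t. inverse t ^ m * exp (- inverse t)) has_real_derivative
       flat_fun (m + 2) t - real m * flat_fun (m + 1) t) (at t)"
      using 3
      by (auto intro!: derivative_eq_intros simp: flat_fun_def field_simps power2_eq_square)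
        (cases m, auto)
    then show ?thesis
      by (rule has_field_derivative_transform_within_open[where S="{0<..}"])
         (use 3 in \<open>auto simp: flat_fun_def\<close>)
  qed
qed

lemma smooth_on_flat_fun: "smooth_on UNIV (flat_fun m)"
  unfolding smooth_on_def
proof
  show "Ck_on k UNIV (flat_fun m)" for k
  proof (induction k arbitrary: m)
    case 0
    show ?case
      by (auto intro!: continuous_at_imp_continuous_on DERIV_isCont flat_fun_has_derivative)
  next
    case (Suc k)
    show ?case
      by (rule Ck_on_Suc_intro[OF open_UNIV flat_fun_has_derivative[unfolded has_field_derivative_def]])
        (auto intro!: Ck_on_bilinear[OF bounded_bilinear_mult] Ck_on_const Suc
            Ck_on_add Ck_on_bounded_linear[OF bounded_linear_minus[OF bounded_linear_ident]]
           simp only: diff_conv_add_uminus open_UNIV)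
  qed
qed

lemma flat_fun_0_pos: "t > 0 \<Longrightarrow> flat_fun 0 t > 0"
  and flat_fun_0_nonneg: "flat_fun 0 t \<ge> 0"
  and flat_fun_nonpos: "t \<le> 0 \<Longrightarrow> flat_fun m t = 0"
  by (auto simp: flat_fun_def)

text \<open>The quotient \<open>a / (a + b)\<close>, where \<open>a\<close> is positive exactly on the ball of radius \<open>r\<close> and \<open>b\<close> exactly
  outside the closed ball of radius \<open>r / 2\<close>. These two sets cover the space, so the denominator has no zeros.\<close>

lemma exists_bump:
  fixes x :: "'a::euclidean_space"
  assumes "r > 0"
  obtains \<beta> :: "'a \<Rightarrow> real" where "smooth_on UNIV \<beta>" "\<And>y. dist y x < r / 2 \<Longrightarrow> \<beta> y = 1"
    "\<And>y. dist y x \<ge> r \<Longrightarrow> \<beta> y = 0"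
proof -
  define q where "q = (\<lambda>y. (y - x) \<bullet> (y - x))"
  define \<beta> where "\<beta> = (\<lambda>y. flat_fun 0 (r\<^sup>2 - q y) / (flat_fun 0 (r\<^sup>2 - q y) + flat_fun 0 (q y - (r/2)\<^sup>2)))"
  have qd: "q y = (dist y x)\<^sup>2" for y
    by (simp add: q_def dist_norm power2_norm_eq_inner)
  have q: "smooth_on UNIV q" unfolding q_def
    by (intro smooth_on_inner smooth_on_diff smooth_on_ident smooth_on_const open_UNIV)
  have lt: "(r/2)\<^sup>2 < r\<^sup>2" using assms by (simp add: power2_eq_square)
  have nz: "flat_fun 0 (r\<^sup>2 - q y) + flat_fun 0 (q y - (r/2)\<^sup>2) \<noteq> 0" for y
  proof (cases "q y < r\<^sup>2")
    case True
    then show ?thesis using flat_fun_0_pos[of "r\<^sup>2 - q y"] flat_fun_0_nonneg[of "q y - (r/2)\<^sup>2"] by linarith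
  next
    case False
    then show ?thesis using lt flat_fun_0_pos[of "q y - (r/2)\<^sup>2"] flat_fun_0_nonneg[of "r\<^sup>2 - q y"] by linarith
  qed
  show ?thesis
  proof (rule that[of \<beta>])
    show "smooth_on UNIV \<beta>" unfolding \<beta>_def
      by (intro smooth_on_divide smooth_on_add smooth_on_compose[OF _ _ _ smooth_on_flat_fun]
            smooth_on_diff q smooth_on_const open_UNIV nz) auto
    show "\<beta> y = 1" if "dist y x < r / 2" for y
    proof -
      have "q y < (r/2)\<^sup>2" unfolding qd using that by (intro power_strict_mono) auto
      then show ?thesis using nz[of y] by (simp add: \<beta>_def flat_fun_nonpos)
    qed
    show "\<beta> y = 0" if "dist y x \<ge> r" for y
    proof -
      have "q y \<ge> r\<^sup>2" unfolding qd using that assms by (intro power_mono) auto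
      then show ?thesis by (simp add: \<beta>_def flat_fun_nonpos)
    qed
  qed
qed

section \<open>Smooth dependence of the solution of a linear system\<close>

lemma linear_diff_bound:
  fixes L M :: "'e::euclidean_space \<Rightarrow> 'e"
  assumes "linear L" "linear M"
  shows "norm (L u - M u) \<le> (\<Sum>b\<in>Basis. norm (L b - M b)) * norm u"
proof -
  have "L u - M u = (\<Sum>b\<in>Basis. (u \<bullet> b) *\<^sub>R (L b - M b))"
    unfolding scaleR_diff_right sum_subtractf
    by (intro arg_cong2[where f=minus] linear_expand assms)
  also have "norm \<dots> \<le> (\<Sum>b\<in>Basis. norm (L b - M b) * norm u)"
  proof (rule sum_norm_le)
    fix b :: 'e assume "b \<in> Basis"
    then have "\<bar>u \<bullet> b\<bar> \<le> norm u" by (rule Basis_le_norm)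
    then show "norm ((u \<bullet> b) *\<^sub>R (L b - M b)) \<le> norm (L b - M b) * norm u"
      by (simp add: mult.commute mult_right_mono)
  qed
  finally show ?thesis by (simp add: sum_distrib_right)
qed

text \<open>An injective linear map stays bounded below under small perturbations, so the solutions of
  nearby systems are controlled by the right-hand sides.\<close>

lemma linear_family_bounded_below:
  fixes G :: "'a::real_normed_vector \<Rightarrow> 'e::euclidean_space \<Rightarrow> 'e"
  assumes "open S" "x \<in> S" and lin: "\<And>y. y \<in> S \<Longrightarrow> linear (G y)" and "inj (G x)"
    and cont: "\<And>u. continuous_on S (\<lambda>y. G y u)"
  obtains m where "m > 0" "\<forall>u. m * norm u \<le> norm (G x u)"
    "eventually (\<lambda>y. y \<in> S \<and> (\<forall>u. m * norm u \<le> 2 * norm (G y u))) (at x)"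
    "((\<lambda>y. \<Sum>b\<in>Basis. norm (G y b - G x b)) \<longlongrightarrow> 0) (at x)"
proof -
  obtain m where m: "m > 0" "\<And>u. m * norm u \<le> norm (G x u)"
    using linear_inj_bounded_below_pos[OF lin[OF assms(2)] assms(4)] by blast
  have "((\<lambda>y. G y b) \<longlongrightarrow> G x b) (at x)" for b
    using cont[of b] assms(1,2) continuous_on_eq_continuous_at isCont_def by blast
  then have "((\<lambda>y. \<Sum>b\<in>Basis. norm (G y b - G x b)) \<longlongrightarrow> (\<Sum>b\<in>(Basis::'e set). norm (G x b - G x b))) (at x)"
    by (intro tendsto_intros)
  then have lim: "((\<lambda>y. \<Sum>b\<in>Basis. norm (G y b - G x b)) \<longlongrightarrow> 0) (at x)" by simp
  have "eventually (\<lambda>y. (\<Sum>b\<in>Basis. norm (G y b - G x b)) < m / 2) (at x)"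
    using order_tendstoD(2)[OF lim, of "m / 2"] m(1) by simp
  moreover have "eventually (\<lambda>y. y \<in> S) (at x)"
    using assms(1,2) by (rule eventually_at_in_open')
  ultimately have "eventually (\<lambda>y. y \<in> S \<and> (\<forall>u. m * norm u \<le> 2 * norm (G y u))) (at x)"
  proof eventually_elim
    case (elim y)
    have "m * norm u \<le> 2 * norm (G y u)" for u
    proof -
      have "norm (G x u - G y u) \<le> (\<Sum>b\<in>Basis. norm (G x b - G y b)) * norm u"
        by (rule linear_diff_bound[OF lin[OF assms(2)] lin]) (use elim in simp)
      also have "\<dots> \<le> m / 2 * norm u"
        using elim by (intro mult_right_mono) (auto simp: norm_minus_commute)
      finally show ?thesis
        using m(2)[of u] norm_triangle_ineq2[of "G x u" "G y u"] by linarith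
    qed
    then show ?case using elim by simp
  qed
  with m lim show ?thesis using that by blast
qed

text \<open>The difference \<open>w y - w x\<close> solves the system at \<open>y\<close> with right-hand side \<open>h y - G y (w x)\<close>, which
  tends to \<open>0\<close>.\<close>

lemma linear_solve_continuous:
  fixes G :: "'a::real_normed_vector \<Rightarrow> 'e::euclidean_space \<Rightarrow> 'e"
  assumes "open S" and lin: "\<And>y. y \<in> S \<Longrightarrow> linear (G y)" and "\<And>y. y \<in> S \<Longrightarrow> inj (G y)"
    and cont: "\<And>u. continuous_on S (\<lambda>y. G y u)" and h: "continuous_on S h"
    and w: "\<And>y. y \<in> S \<Longrightarrow> G y (w y) = h y"
  shows "continuous_on S w"
proof (rule continuous_at_imp_continuous_on, rule ballI)
  fix x assume x: "x \<in> S"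
  obtain m where m: "m > 0"
    and ev: "eventually (\<lambda>y. y \<in> S \<and> (\<forall>u. m * norm u \<le> 2 * norm (G y u))) (at x)"
    by (rule linear_family_bounded_below[OF assms(1) x lin assms(3)[OF x] cont])
  have "((\<lambda>y. 2 / m * norm (h y - G y (w x))) \<longlongrightarrow> 2 / m * norm (h x - G x (w x))) (at x)"
    using cont[of "w x"] h assms(1) x
    by (intro tendsto_intros) (auto simp: continuous_on_eq_continuous_at isCont_def)
  then have "((\<lambda>y. 2 / m * norm (h y - G y (w x))) \<longlongrightarrow> 0) (at x)" using w[OF x] by simp
  then have "((\<lambda>y. w y - w x) \<longlongrightarrow> 0) (at x)"
  proof (rule Lim_null_comparison[rotated])
    show "eventually (\<lambda>y. norm (w y - w x) \<le> 2 / m * norm (h y - G y (w x))) (at x)"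
      using ev
    proof eventually_elim
      case (elim y)
      have "m * norm (w y - w x) \<le> 2 * norm (G y (w y - w x))" using elim by blast
      also have "G y (w y - w x) = h y - G y (w x)"
        using elim w by (simp add: linear_diff[OF lin])
      finally show ?case using m by (simp add: field_simps)
    qed
  qed
  then show "isCont w x" by (simp add: isCont_def LIM_zero_iff)
qed

text \<open>Writing \<open>H y = h y - G y (w x)\<close>, which vanishes at \<open>x\<close>, one has \<open>w y - w x = (G y)\<inverse> (H y)\<close>;
  since \<open>H\<close> is already of first order, replacing \<open>(G y)\<inverse>\<close> by \<open>(G x)\<inverse>\<close> costs only a higher-order term.\<close>

lemma linear_solve_has_derivative:
  fixes G :: "'a::real_normed_vector \<Rightarrow> 'e::euclidean_space \<Rightarrow> 'e"
  assumes "open S" and x: "x \<in> S" and lin: "\<And>y. y \<in> S \<Longrightarrow> linear (G y)"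
    and inj: "\<And>y. y \<in> S \<Longrightarrow> inj (G y)"
    and cont: "\<And>u. continuous_on S (\<lambda>y. G y u)"
    and w: "\<And>y. y \<in> S \<Longrightarrow> G y (w y) = h y"
    and h': "(h has_derivative h') (at x)"
    and G': "((\<lambda>y. G y (w x)) has_derivative G') (at x)"
  shows "(w has_derivative (\<lambda>v. inv (G x) (h' v - G' v))) (at x)"
proof -
  obtain m where m: "m > 0" "\<forall>u. m * norm u \<le> norm (G x u)"
    and ev: "eventually (\<lambda>y. y \<in> S \<and> (\<forall>u. m * norm u \<le> 2 * norm (G y u))) (at x)"
    and lim: "((\<lambda>y. \<Sum>b\<in>Basis. norm (G y b - G x b)) \<longlongrightarrow> 0) (at x)"
    by (rule linear_family_bounded_below[OF assms(1) x lin inj[OF x] cont]) blast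
  define \<delta> where "\<delta> = (\<lambda>y. \<Sum>b\<in>Basis. norm (G y b - G x b))"
  define H where "H = (\<lambda>y. h y - G y (w x))"
  define H' where "H' = (\<lambda>v. h' v - G' v)"
  define K where "K = (\<lambda>v. inv (G x) (H' v))"
  define q where "q = (\<lambda>y. norm (H y - H x - H' (y - x)) / norm (y - x))"
  have H': "(H has_derivative H') (at x)"
    unfolding H_def H'_def by (intro has_derivative_diff h' G')
  have Hx: "H x = 0" using w[OF x] by (simp add: H_def)
  have bij: "bij (G x)"
    using inj[OF x] linear_injective_imp_surjective[OF lin[OF x]] by (simp add: bij_def)
  have GK: "G x (K v) = H' v" for v
    unfolding K_def using bij by (simp add: bij_is_surj surj_f_inv_f)
  have linK: "linear K"
  proof -
    have "linear (inv (G x))"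
      using inj_linear_imp_inv_linear[OF lin[OF x] inj[OF x]] .
    then have "linear (inv (G x) \<circ> H')"
      using has_derivative_linear[OF H'] linear_compose by blast
    then show ?thesis by (simp add: K_def o_def)
  qed
  have bK: "bounded_linear K"
  proof -
    obtain B where B: "\<And>v. norm (H' v) \<le> B * norm v"
      using bounded_linear.nonneg_bounded[OF has_derivative_bounded_linear[OF H']]
      by (metis mult.commute)
    have "norm (K v) \<le> norm v * (B / m)" for v
    proof -
      have "m * norm (K v) \<le> B * norm v" using m(2)[rule_format, of "K v"] GK B[of v] by simp
      then show ?thesis using m(1) by (simp add: field_simps)
    qed
    then show ?thesis
      using linK unfolding bounded_linear_def bounded_linear_axioms_def by blast
  qed
  obtain B where B: "\<And>v. norm (H' v) \<le> B * norm v"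
    using bounded_linear.nonneg_bounded[OF has_derivative_bounded_linear[OF H']]
    by (metis mult.commute)
  have qlim: "(q \<longlongrightarrow> 0) (at x)"
    using H' unfolding has_derivative_iff_norm q_def by simp
  have dlim: "(\<delta> \<longlongrightarrow> 0) (at x)" using lim by (simp add: \<delta>_def)
  have "((\<lambda>y. 1 / m * (q y + \<delta> y * (2 / m * (q y + B)))) \<longlongrightarrow> 1 / m * (0 + 0 * (2 / m * (0 + B)))) (at x)"
    by (intro tendsto_intros qlim dlim)
  then have lim0: "((\<lambda>y. 1 / m * (q y + \<delta> y * (2 / m * (q y + B)))) \<longlongrightarrow> 0) (at x)" by simp
  have ev': "eventually (\<lambda>y. norm (norm ((w y - w x) - K (y - x)) / norm (y - x))
      \<le> 1 / m * (q y + \<delta> y * (2 / m * (q y + B)))) (at x)"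
    using ev eventually_neq_at_within[of x x UNIV]
  proof eventually_elim
    case (elim y)
    define n where "n = norm (y - x)"
    have n: "n > 0" using elim by (simp add: n_def)
    have \<delta>0: "\<delta> y \<ge> 0" by (simp add: \<delta>_def sum_nonneg)
    have nH: "norm (H y - H' (y - x)) = q y * n"
      using n by (simp add: q_def Hx n_def)
    have Gy: "G y (w y - w x) = H y"
      using elim w by (simp add: linear_diff[OF lin] H_def)
    have "m * norm (w y - w x) \<le> 2 * norm (H y)"
      using elim Gy by metis
    also have "norm (H y) \<le> norm (H y - H' (y - x)) + norm (H' (y - x))"
      using norm_triangle_ineq[of "H y - H' (y - x)" "H' (y - x)"] by simp
    also have "\<dots> \<le> q y * n + B * n" using nH B[of "y - x"] by (simp add: n_def)
    finally have ww: "norm (w y - w x) \<le> 2 / m * (q y + B) * n"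
      using m(1) by (simp add: field_simps)
    have "G x (w y - w x - K (y - x)) = G x (w y - w x) - H' (y - x)"
      by (simp add: linear_diff[OF lin[OF x]] GK)
    also have "\<dots> = (H y - H' (y - x)) - (G y (w y - w x) - G x (w y - w x))"
      by (simp add: Gy)
    also have "norm \<dots> \<le> q y * n + \<delta> y * norm (w y - w x)"
      using norm_triangle_ineq4[of "H y - H' (y - x)" "G y (w y - w x) - G x (w y - w x)"]
        linear_diff_bound[OF lin[of y] lin[OF x], of "w y - w x"] elim nH
      by (simp add: \<delta>_def)
    also have "\<dots> \<le> q y * n + \<delta> y * (2 / m * (q y + B) * n)"
      using mult_left_mono[OF ww \<delta>0] by simp
    finally have "m * norm (w y - w x - K (y - x)) \<le> (q y + \<delta> y * (2 / m * (q y + B))) * n"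
      using m(2)[rule_format, of "w y - w x - K (y - x)"] by (simp add: algebra_simps)
    then show ?case
      using m(1) n by (simp add: n_def[symmetric] pos_divide_le_eq pos_le_divide_eq mult.commute)
  qed
  have "((\<lambda>y. norm ((w y - w x) - K (y - x)) / norm (y - x)) \<longlongrightarrow> 0) (at x)"
    by (rule Lim_null_comparison[OF ev' lim0])
  then have "(w has_derivative K) (at x)"
    unfolding has_derivative_iff_norm using bK by simp
  then show ?thesis by (simp add: K_def H'_def)
qed

text \<open>Differentiating \<open>G w = h\<close> gives \<open>G (Dw) = Dh - (DG) w\<close>, a system of the same kind for the
  derivative of \<open>w\<close>; the degree of smoothness climbs by induction.\<close>

lemma smooth_on_linear_solve:
  fixes G :: "'a::real_normed_vector \<Rightarrow> 'e::euclidean_space \<Rightarrow> 'e"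
  assumes "open S" and lin: "\<And>y. y \<in> S \<Longrightarrow> linear (G y)"
    and inj: "\<And>y. y \<in> S \<Longrightarrow> inj (G y)"
    and G: "\<And>u. smooth_on S (\<lambda>y. G y u)" and h: "smooth_on S h"
    and w: "\<And>y. y \<in> S \<Longrightarrow> G y (w y) = h y"
  shows "smooth_on S w"
proof -
  have Gc: "continuous_on S (\<lambda>y. G y u)" for u by (rule smooth_on_continuous[OF G])
  have "Ck_on k S w" if "Ck_on k S h" "\<And>y. y \<in> S \<Longrightarrow> G y (w y) = h y" for k h w
    using that
  proof (induction k arbitrary: h w)
    case 0
    then show ?case using linear_solve_continuous[OF assms(1) lin inj Gc] by simp
  next
    case (Suc k)
    define DG where "DG = (\<lambda>u x. frechet_derivative (\<lambda>y. G y u) (at x))"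
    define Dh where "Dh = (\<lambda>x. frechet_derivative h (at x))"
    have wk: "Ck_on k S w"
      by (rule Suc.IH[OF Ck_on_SucD[OF Suc.prems(1)] Suc.prems(2)])
    have DG: "((\<lambda>y. G y u) has_derivative DG u x) (at x)" if "x \<in> S" for x u
      unfolding DG_def by (rule smooth_on_has_derivative[OF G that])
    have DGw: "DG (w x) x v = (\<Sum>b\<in>Basis. (w x \<bullet> b) *\<^sub>R DG b x v)" if x: "x \<in> S" for x v
    proof -
      have "((\<lambda>y. \<Sum>b\<in>Basis. (w x \<bullet> b) *\<^sub>R G y b) has_derivative
          (\<lambda>v. \<Sum>b\<in>Basis. (w x \<bullet> b) *\<^sub>R DG b x v)) (at x)"
        by (intro has_derivative_sum has_derivative_scaleR_right DG[OF x])
      then have "((\<lambda>y. G y (w x)) has_derivative (\<lambda>v. \<Sum>b\<in>Basis. (w x \<bullet> b) *\<^sub>R DG b x v)) (at x)"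
        by (rule has_derivative_transform_within_open[OF _ assms(1) x])
          (rule linear_expand[OF lin, symmetric])
      then show ?thesis using has_derivative_unique[OF DG[OF x]] by metis
    qed
    show ?case
    proof (rule Ck_on_Suc_intro[OF assms(1)])
      show "(w has_derivative (\<lambda>v. inv (G x) (Dh x v - DG (w x) x v))) (at x)" if "x \<in> S" for x
        by (rule linear_solve_has_derivative[OF assms(1) that lin inj Gc Suc.prems(2) _ DG[OF that]])
          (use Ck_on_Suc_has_derivative[OF Suc.prems(1) that] in \<open>simp_all add: Dh_def\<close>)
    next
      fix v
      show "Ck_on k S (\<lambda>x. inv (G x) (Dh x v - DG (w x) x v))"
      proof (rule Suc.IH)
        show "G y (inv (G y) (Dh y v - DG (w y) y v)) = Dh y v - DG (w y) y v" if "y \<in> S" for y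
          using linear_injective_imp_surjective[OF lin[OF that] inj[OF that]]
          by (simp add: surj_f_inv_f)
        have wb: "Ck_on k S (\<lambda>x. w x \<bullet> b)" for b
          by (rule Ck_on_bounded_linear[OF bounded_linear_inner_left assms(1) wk])
        have DGb: "Ck_on k S (\<lambda>x. DG b x v)" for b
          using smooth_on_frechet_derivative[OF G] by (simp add: DG_def smooth_on_def)
        have "Ck_on k S (\<lambda>x. - (\<Sum>b\<in>Basis. (w x \<bullet> b) *\<^sub>R DG b x v))"
          by (intro Ck_on_bounded_linear[OF bounded_linear_minus[OF bounded_linear_ident]] assms(1)
              Ck_on_sum Ck_on_bilinear[OF bounded_bilinear_scaleR] wb DGb)
        moreover have "Ck_on k S (\<lambda>x. Dh x v)" using Suc.prems(1) by (simp add: Dh_def)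
        ultimately have "Ck_on k S (\<lambda>x. Dh x v + - (\<Sum>b\<in>Basis. (w x \<bullet> b) *\<^sub>R DG b x v))"
          by (intro Ck_on_add assms(1))
        then show "Ck_on k S (\<lambda>x. Dh x v - DG (w x) x v)"
          by (rule Ck_on_cong[OF assms(1), rotated]) (simp add: DGw)
      qed
    qed
  qed
  from this[OF _ w] show ?thesis using h by (simp add: smooth_on_def)
qed

section \<open>Charts and changes of coordinates\<close>

locale smooth_manifold =
  fixes A :: "('m::{t2_space, second_countable_topology}, 'e::euclidean_space) atlas"
  assumes atlas: "smooth_atlas A"
begin

lemma chart: "c \<in> A \<Longrightarrow> is_chart c"
  using atlas by (simp add: smooth_atlas_def)

lemma chart_at: "chart_at A p \<in> A" "p \<in> chart_dom (chart_at A p)"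
proof -
  have "\<exists>c. c \<in> A \<and> p \<in> chart_dom c"
    using atlas unfolding smooth_atlas_def by blast
  from someI_ex[OF this] show "chart_at A p \<in> A" "p \<in> chart_dom (chart_at A p)"
    by (auto simp: chart_at_def)
qed

lemma open_chart_dom: "c \<in> A \<Longrightarrow> open (chart_dom c)"
  and open_chart_range: "c \<in> A \<Longrightarrow> open (chart_range c)"
  and chart_inv_map: "c \<in> A \<Longrightarrow> p \<in> chart_dom c \<Longrightarrow> chart_inv c (chart_map c p) = p"
  and chart_map_inv: "c \<in> A \<Longrightarrow> x \<in> chart_range c \<Longrightarrow> chart_map c (chart_inv c x) = x"
  and chart_inv_in: "c \<in> A \<Longrightarrow> x \<in> chart_range c \<Longrightarrow> chart_inv c x \<in> chart_dom c"
  and continuous_on_chart_inv: "c \<in> A \<Longrightarrow> continuous_on (chart_range c) (chart_inv c)"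
  using chart[of c] by (auto simp: is_chart_def homeomorphism_def image_iff)

lemma open_chart_image:
  assumes "c \<in> A" "open U" "U \<subseteq> chart_dom c"
  shows "open (chart_map c ` U)"
proof -
  have "chart_map c ` U = chart_inv c -` U \<inter> chart_range c"
    using assms chart_inv_map[OF assms(1)] by (auto simp: image_iff)
  moreover have "open (chart_inv c -` U \<inter> chart_range c)"
    using continuous_on_chart_inv[OF assms(1)] open_chart_range[OF assms(1)] assms(2)
    by (metis continuous_on_open_vimage Int_commute)
  ultimately show ?thesis by simp
qed

lemma smooth_transition:
  assumes "c \<in> A" "d \<in> A" "U \<subseteq> chart_dom c \<inter> chart_dom d"
  shows "smooth_on (chart_map c ` U) (transition c d)"
proof (rule smooth_on_subset)
  show "smooth_on (chart_map c ` (chart_dom c \<inter> chart_dom d)) (transition c d)"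
    using atlas assms by (simp add: smooth_atlas_def)
qed (use assms in auto)

lemma transition_map:
  "c \<in> A \<Longrightarrow> p \<in> chart_dom c \<Longrightarrow> transition c d (chart_map c p) = chart_map d p"
  by (simp add: transition_def chart_inv_map)

text \<open>The Jacobian of an arbitrary change of charts. Both \<open>to_chart\<close> and \<open>from_chart\<close> are instances, and
  the composition law below lets the selected charts drop out of every computation.\<close>

definition jac :: "('m, 'e) chart \<Rightarrow> ('m, 'e) chart \<Rightarrow> 'm \<Rightarrow> 'e \<Rightarrow> 'e" where
  "jac c d p = frechet_derivative (transition c d) (at (chart_map c p))"

lemma to_chart_jac: "to_chart A c p = jac (chart_at A p) c p"
  and from_chart_jac: "from_chart A c p = jac c (chart_at A p) p"
  by (auto simp: to_chart_def from_chart_def jac_def fun_eq_iff)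

lemma transition_has_derivative:
  assumes "c \<in> A" "d \<in> A" "p \<in> chart_dom c" "p \<in> chart_dom d"
  shows "(transition c d has_derivative jac c d p) (at (chart_map c p))"
  unfolding jac_def
  by (rule smooth_on_has_derivative[OF smooth_transition[OF assms(1,2) order_refl]]) (use assms in auto)

lemma linear_jac:
  assumes "c \<in> A" "d \<in> A" "p \<in> chart_dom c" "p \<in> chart_dom d"
  shows "linear (jac c d p)"
  using has_derivative_linear[OF transition_has_derivative[OF assms]] .

text \<open>The chain rule through which coordinate expressions in different charts are compared.\<close>

lemma chart_change_has_derivative:
  assumes "c \<in> A" "d \<in> A" "p \<in> chart_dom c" "p \<in> chart_dom d"
    and f: "((f \<circ> chart_inv d) has_derivative f') (at (chart_map d p))"
  shows "((f \<circ> chart_inv c) has_derivative (\<lambda>v. f' (jac c d p v))) (at (chart_map c p))"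
proof -
  have "((\<lambda>x. (f \<circ> chart_inv d) (transition c d x)) has_derivative (\<lambda>v. f' (jac c d p v))) (at (chart_map c p))"
    by (rule has_derivative_compose[OF transition_has_derivative[OF assms(1-4)]])
      (use f assms(1,3) in \<open>simp only: transition_map\<close>)
  then show ?thesis
  proof (rule has_derivative_transform_within_open)
    show "open (chart_map c ` (chart_dom c \<inter> chart_dom d))"
      using assms(1) open_chart_dom[OF assms(1)] open_chart_dom[OF assms(2)]
      by (intro open_chart_image) auto
    show "(f \<circ> chart_inv d) (transition c d x) = (f \<circ> chart_inv c) x"
      if "x \<in> chart_map c ` (chart_dom c \<inter> chart_dom d)" for x
      using that assms by (auto simp: transition_map chart_inv_map)
  qed (use assms in auto)
qed

lemma jac_compose:
  assumes "c \<in> A" "d \<in> A" "e \<in> A" "p \<in> chart_dom c" "p \<in> chart_dom d" "p \<in> chart_dom e"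
  shows "jac d e p (jac c d p v) = jac c e p v"
proof -
  have "((chart_map e \<circ> chart_inv c) has_derivative (\<lambda>v. jac d e p (jac c d p v))) (at (chart_map c p))"
    by (rule chart_change_has_derivative[OF assms(1,2,4,5)])
      (use transition_has_derivative[OF assms(2,3,5,6)] in \<open>simp add: transition_def\<close>)
  then show ?thesis
    using has_derivative_unique[OF transition_has_derivative[OF assms(1,3,4,6)]]
    by (simp add: transition_def)
qed

lemma jac_self:
  assumes "c \<in> A" "p \<in> chart_dom c"
  shows "jac c c p v = v"
proof -
  have "((\<lambda>x. x) has_derivative (\<lambda>v. v)) (at (chart_map c p))" by simp
  then have "(transition c c has_derivative (\<lambda>v. v)) (at (chart_map c p))"
    by (rule has_derivative_transform_within_open[OF _ open_chart_range[OF assms(1)]])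
      (use assms in \<open>auto simp: transition_map\<close>)
  from has_derivative_unique[OF transition_has_derivative[OF assms(1,1,2,2)] this]
  show ?thesis by simp
qed

lemma to_from_chart: "c \<in> A \<Longrightarrow> p \<in> chart_dom c \<Longrightarrow> to_chart A c p (from_chart A c p v) = v"
  and from_to_chart: "c \<in> A \<Longrightarrow> p \<in> chart_dom c \<Longrightarrow> from_chart A c p (to_chart A c p v) = v"
  by (simp_all add: to_chart_jac from_chart_jac jac_compose jac_self chart_at)

lemma to_chart_at: "to_chart A (chart_at A p) p v = v"
  by (simp add: to_chart_jac jac_self chart_at)

lemma linear_to_chart: "c \<in> A \<Longrightarrow> p \<in> chart_dom c \<Longrightarrow> linear (to_chart A c p)"
  and linear_from_chart: "c \<in> A \<Longrightarrow> p \<in> chart_dom c \<Longrightarrow> linear (from_chart A c p)"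
  by (simp_all add: to_chart_jac from_chart_jac linear_jac chart_at)

section \<open>Smooth functions and vector fields are local notions\<close>

lemma smooth_rep_change:
  assumes "c \<in> A" "d \<in> A" "open U" "U \<subseteq> chart_dom c" "U \<subseteq> chart_dom d"
    and "smooth_on (chart_map c ` U) (f \<circ> chart_inv c)"
  shows "smooth_on (chart_map d ` U) (f \<circ> chart_inv d)"
proof (rule smooth_on_cong)
  show "smooth_on (chart_map d ` U) (\<lambda>x. (f \<circ> chart_inv c) (transition d c x))"
    by (rule smooth_on_compose[OF _ _ _ assms(6) smooth_transition])
      (use assms in \<open>auto intro!: open_chart_image simp: transition_map subset_iff\<close>)
qed (use assms in \<open>auto intro!: open_chart_image simp: transition_map chart_inv_map subset_iff\<close>)

lemma vf_rep_map: "c \<in> A \<Longrightarrow> p \<in> chart_dom c \<Longrightarrow> vf_rep A c X (chart_map c p) = to_chart A c p (X p)"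
  by (simp add: vf_rep_def chart_inv_map)

text \<open>The components in \<open>d\<close> are the Jacobian of the transition applied to the components in \<open>c\<close>, all
  evaluated at the transition from \<open>d\<close> to \<open>c\<close>.\<close>

lemma smooth_vf_rep_change:
  assumes "c \<in> A" "d \<in> A" "open U" "U \<subseteq> chart_dom c" "U \<subseteq> chart_dom d"
    and X: "smooth_on (chart_map c ` U) (vf_rep A c X)"
  shows "smooth_on (chart_map d ` U) (vf_rep A d X)"
proof (rule smooth_on_cong)
  have "smooth_on (chart_map c ` U) (\<lambda>x. frechet_derivative (transition c d) (at x) (vf_rep A c X x))"
    by (rule smooth_on_frechet_derivative_field[OF _ smooth_transition X])
      (use assms in \<open>auto intro!: open_chart_image\<close>)
  then show "smooth_on (chart_map d ` U)
      (\<lambda>x. frechet_derivative (transition c d) (at (transition d c x)) (vf_rep A c X (transition d c x)))"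
    by (rule smooth_on_compose[rotated 3, OF _ smooth_transition])
      (use assms in \<open>auto intro!: open_chart_image simp: transition_map subset_iff\<close>)
  fix x assume "x \<in> chart_map d ` U"
  then obtain p where p: "p \<in> chart_dom c" "p \<in> chart_dom d" "x = chart_map d p" using assms by auto
  have "frechet_derivative (transition c d) (at (transition d c x)) (vf_rep A c X (transition d c x))
      = jac c d p (to_chart A c p (X p))"
    using p assms by (simp add: transition_map vf_rep_map jac_def)
  also have "\<dots> = vf_rep A d X x"
    using p assms by (simp add: vf_rep_map to_chart_jac jac_compose chart_at)
  finally show "frechet_derivative (transition c d) (at (transition d c x)) (vf_rep A c X (transition d c x))
     = vf_rep A d X x" .
qed (use assms in \<open>auto intro!: open_chart_image\<close>)

lemma smooth_fun_localI:
  assumes "\<And>p. \<exists>c\<in>A. \<exists>U. open U \<and> p \<in> U \<and> U \<subseteq> chart_dom c \<and> smooth_on (chart_map c ` U) (f \<circ> chart_inv c)"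
  shows "smooth_fun A f"
  unfolding smooth_fun_def
proof (intro ballI smooth_on_local)
  fix d x assume d: "d \<in> A" and x: "x \<in> chart_range d"
  then obtain p where p: "p \<in> chart_dom d" "x = chart_map d p" by auto
  obtain c U where c: "c \<in> A" and U: "open U" "p \<in> U" "U \<subseteq> chart_dom c"
      "smooth_on (chart_map c ` U) (f \<circ> chart_inv c)"
    using assms by blast
  define V where "V = U \<inter> chart_dom d"
  have V: "open V" "V \<subseteq> chart_dom c" "V \<subseteq> chart_dom d" "V \<subseteq> U"
    using U open_chart_dom[OF d] by (auto simp: V_def)
  have "smooth_on (chart_map d ` V) (f \<circ> chart_inv d)"
    by (rule smooth_rep_change[OF c d V(1-3) smooth_on_subset[OF U(4)]]) (use V in auto)
  then show "\<exists>W. open W \<and> x \<in> W \<and> smooth_on W (f \<circ> chart_inv d)"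
    using open_chart_image[OF d V(1,3)] p U(2) by (auto simp: V_def)
qed

lemma smooth_vf_localI:
  assumes "\<And>p. \<exists>c\<in>A. \<exists>U. open U \<and> p \<in> U \<and> U \<subseteq> chart_dom c \<and> smooth_on (chart_map c ` U) (vf_rep A c X)"
  shows "smooth_vf A X"
  unfolding smooth_vf_def
proof (intro ballI smooth_on_local)
  fix d x assume d: "d \<in> A" and x: "x \<in> chart_range d"
  then obtain p where p: "p \<in> chart_dom d" "x = chart_map d p" by auto
  obtain c U where c: "c \<in> A" and U: "open U" "p \<in> U" "U \<subseteq> chart_dom c"
      "smooth_on (chart_map c ` U) (vf_rep A c X)"
    using assms by blast
  define V where "V = U \<inter> chart_dom d"
  have V: "open V" "V \<subseteq> chart_dom c" "V \<subseteq> chart_dom d" "V \<subseteq> U"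
    using U open_chart_dom[OF d] by (auto simp: V_def)
  have "smooth_on (chart_map d ` V) (vf_rep A d X)"
    by (rule smooth_vf_rep_change[OF c d V(1-3) smooth_on_subset[OF U(4)]]) (use V in auto)
  then show "\<exists>W. open W \<and> x \<in> W \<and> smooth_on W (vf_rep A d X)"
    using open_chart_image[OF d V(1,3)] p U(2) by (auto simp: V_def)
qed

lemma smooth_fun_rep: "smooth_fun A f \<Longrightarrow> c \<in> A \<Longrightarrow> U \<subseteq> chart_dom c \<Longrightarrow> smooth_on (chart_map c ` U) (f \<circ> chart_inv c)"
  unfolding smooth_fun_def by (meson image_mono smooth_on_subset)

lemma smooth_vf_rep: "smooth_vf A X \<Longrightarrow> c \<in> A \<Longrightarrow> U \<subseteq> chart_dom c \<Longrightarrow> smooth_on (chart_map c ` U) (vf_rep A c X)"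
  unfolding smooth_vf_def by (meson image_mono smooth_on_subset)

lemma smooth_fun_const: "smooth_fun A (\<lambda>_. k)"
  by (simp add: smooth_fun_def o_def smooth_on_const)

lemma smooth_fun_add: "smooth_fun A f \<Longrightarrow> smooth_fun A h \<Longrightarrow> smooth_fun A (\<lambda>p. f p + h p)"
  by (auto simp: smooth_fun_def o_def intro!: smooth_on_add open_chart_range)

lemma smooth_fun_mult: "smooth_fun A f \<Longrightarrow> smooth_fun A h \<Longrightarrow> smooth_fun A (\<lambda>p. f p * h p)"
  by (auto simp: smooth_fun_def o_def intro!: smooth_on_mult open_chart_range)

lemma smooth_fun_minus: "smooth_fun A f \<Longrightarrow> smooth_fun A (\<lambda>p. - f p)"
  by (auto simp: smooth_fun_def o_def intro!: smooth_on_minus open_chart_range)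

lemma smooth_fun_diff: "smooth_fun A f \<Longrightarrow> smooth_fun A h \<Longrightarrow> smooth_fun A (\<lambda>p. f p - h p)"
  by (auto simp: smooth_fun_def o_def intro!: smooth_on_diff open_chart_range)

lemma smooth_vf_zero: "smooth_vf A (\<lambda>_. 0)"
  unfolding smooth_vf_def
proof
  fix c assume c: "c \<in> A"
  show "smooth_on (chart_range c) (vf_rep A c (\<lambda>_. 0))"
    by (rule smooth_on_cong[OF open_chart_range[OF c] _ smooth_on_const[of _ 0]])
      (simp add: vf_rep_def linear_0[OF linear_to_chart[OF c chart_inv_in[OF c]]])
qed

lemma smooth_vf_add:
  assumes "smooth_vf A X" "smooth_vf A Y"
  shows "smooth_vf A (\<lambda>p. X p + Y p)"
  unfolding smooth_vf_def
proof
  fix c assume c: "c \<in> A"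
  show "smooth_on (chart_range c) (vf_rep A c (\<lambda>p. X p + Y p))"
    by (rule smooth_on_cong[OF open_chart_range[OF c] _ smooth_on_add[of _ "vf_rep A c X" "vf_rep A c Y"]])
      (use assms c open_chart_range in \<open>auto simp: vf_rep_def smooth_vf_def chart_inv_map
          linear_add[OF linear_to_chart[OF c chart_inv_in[OF c]]]\<close>)
qed

lemma smooth_vf_scale:
  assumes "smooth_fun A f" "smooth_vf A X"
  shows "smooth_vf A (\<lambda>p. f p *\<^sub>R X p)"
  unfolding smooth_vf_def
proof
  fix c assume c: "c \<in> A"
  show "smooth_on (chart_range c) (vf_rep A c (\<lambda>p. f p *\<^sub>R X p))"
    by (rule smooth_on_cong[OF open_chart_range[OF c] _ smooth_on_scaleR[of _ "f \<circ> chart_inv c" "vf_rep A c X"]])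
      (use assms c open_chart_range in \<open>auto simp: vf_rep_def smooth_vf_def smooth_fun_def chart_inv_map
          linear_scale[OF linear_to_chart[OF c chart_inv_in[OF c]]]\<close>)
qed

lemma smooth_vf_minus: "smooth_vf A X \<Longrightarrow> smooth_vf A (\<lambda>p. - X p)"
  using smooth_vf_scale[OF smooth_fun_const[of "-1"]] by simp

lemma smooth_vf_sum: "(\<And>i. i \<in> I \<Longrightarrow> smooth_vf A (X i)) \<Longrightarrow> smooth_vf A (\<lambda>p. \<Sum>i\<in>I. X i p)"
  by (induction I rule: infinite_finite_induct) (auto intro: smooth_vf_zero smooth_vf_add)

section \<open>Cutting off local data\<close>

text \<open>The function vanishes off a closed set inside \<open>W\<close>, not merely off \<open>W\<close>: a point outside \<open>W\<close> then has a
  neighbourhood on which it is zero, and products with data on \<open>W\<close> extend smoothly by zero.\<close>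

definition cutoff :: "'m set \<Rightarrow> 'm \<Rightarrow> 'm scalar_field \<Rightarrow> bool" where
  "cutoff W p \<psi> \<longleftrightarrow> smooth_fun A \<psi> \<and> (\<exists>V. open V \<and> p \<in> V \<and> (\<forall>q\<in>V. \<psi> q = 1)) \<and>
     (\<exists>K. closed K \<and> K \<subseteq> W \<and> (\<forall>q. q \<notin> K \<longrightarrow> \<psi> q = 0))"

lemma chart_off_closed:
  assumes "closed K" "q \<notin> K"
  obtains d U where "d \<in> A" "open U" "q \<in> U" "U \<subseteq> chart_dom d" "U \<inter> K = {}"
  by (rule that[of "chart_at A q" "chart_dom (chart_at A q) \<inter> - K"])
    (use assms open_chart_dom[OF chart_at(1)] chart_at in auto)

lemma cutoff_smooth_vf:
  assumes "cutoff W p \<psi>" "c \<in> A" "open W" "W \<subseteq> chart_dom c"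
    and X: "smooth_on (chart_map c ` W) (vf_rep A c X)"
  shows "smooth_vf A (\<lambda>q. \<psi> q *\<^sub>R X q)"
proof (rule smooth_vf_localI)
  fix q
  obtain K where K: "closed K" "K \<subseteq> W" "\<And>q. q \<notin> K \<Longrightarrow> \<psi> q = 0"
    using assms(1) by (auto simp: cutoff_def)
  show "\<exists>c\<in>A. \<exists>U. open U \<and> q \<in> U \<and> U \<subseteq> chart_dom c \<and> smooth_on (chart_map c ` U) (vf_rep A c (\<lambda>q. \<psi> q *\<^sub>R X q))"
  proof (cases "q \<in> W")
    case True
    have o: "open (chart_map c ` W)" by (rule open_chart_image[OF assms(2-4)])
    have "smooth_on (chart_map c ` W) (\<lambda>x. (\<psi> \<circ> chart_inv c) x *\<^sub>R vf_rep A c X x)"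
      using assms(1) by (intro smooth_on_scaleR o X smooth_fun_rep assms) (simp add: cutoff_def)
    then have "smooth_on (chart_map c ` W) (vf_rep A c (\<lambda>q. \<psi> q *\<^sub>R X q))"
      by (rule smooth_on_cong[OF o, rotated])
        (use assms(2,4) in \<open>auto simp: vf_rep_map chart_inv_map subset_iff linear_scale[OF linear_to_chart]\<close>)
    then show ?thesis using assms True by blast
  next
    case False
    obtain d U where d: "d \<in> A" and U: "open U" "q \<in> U" "U \<subseteq> chart_dom d" "U \<inter> K = {}"
      using chart_off_closed[OF K(1), of q] False K(2) by blast
    have "smooth_on (chart_map d ` U) (vf_rep A d (\<lambda>q. \<psi> q *\<^sub>R X q))"
      by (rule smooth_on_cong[OF open_chart_image[OF d U(1,3)] _ smooth_on_const[of _ 0]])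
        (use d U K in \<open>auto simp: vf_rep_map linear_0[OF linear_to_chart] disjoint_iff subset_iff\<close>)
    then show ?thesis using U d by blast
  qed
qed

lemma cutoff_smooth_fun:
  assumes "cutoff W p \<psi>" "c \<in> A" "open W" "W \<subseteq> chart_dom c"
    and f: "smooth_on (chart_map c ` W) (f \<circ> chart_inv c)"
  shows "smooth_fun A (\<lambda>q. \<psi> q * f q)"
proof (rule smooth_fun_localI)
  fix q
  obtain K where K: "closed K" "K \<subseteq> W" "\<And>q. q \<notin> K \<Longrightarrow> \<psi> q = 0"
    using assms(1) by (auto simp: cutoff_def)
  show "\<exists>c\<in>A. \<exists>U. open U \<and> q \<in> U \<and> U \<subseteq> chart_dom c \<and> smooth_on (chart_map c ` U) ((\<lambda>q. \<psi> q * f q) \<circ> chart_inv c)"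
  proof (cases "q \<in> W")
    case True
    have o: "open (chart_map c ` W)" by (rule open_chart_image[OF assms(2-4)])
    have "smooth_on (chart_map c ` W) (\<lambda>x. (\<psi> \<circ> chart_inv c) x * (f \<circ> chart_inv c) x)"
      using assms(1) by (intro smooth_on_mult o f smooth_fun_rep assms) (simp add: cutoff_def)
    then show ?thesis using assms True by (auto simp: o_def)
  next
    case False
    obtain d U where d: "d \<in> A" and U: "open U" "q \<in> U" "U \<subseteq> chart_dom d" "U \<inter> K = {}"
      using chart_off_closed[OF K(1), of q] False K(2) by blast
    have "smooth_on (chart_map d ` U) ((\<lambda>q. \<psi> q * f q) \<circ> chart_inv d)"
      by (rule smooth_on_cong[OF open_chart_image[OF d U(1,3)] _ smooth_on_const[of _ 0]])
        (use d U K in \<open>auto simp: chart_inv_map disjoint_iff subset_iff\<close>)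
    then show ?thesis using U d by blast
  qed
qed

text \<open>A bump function in a chart, extended by zero. It vanishes off the preimage of a closed ball, which
  is compact and therefore closed, the manifold being Hausdorff.\<close>

lemma exists_cutoff:
  assumes "open W" "p \<in> W"
  obtains \<psi> where "cutoff W p \<psi>"
proof -
  define c where "c = chart_at A p"
  have c: "c \<in> A" "p \<in> chart_dom c" by (simp_all add: c_def chart_at)
  define D where "D = W \<inter> chart_dom c"
  have D: "open D" "p \<in> D" "D \<subseteq> chart_dom c" "D \<subseteq> W" using assms c open_chart_dom[OF c(1)] by (auto simp: D_def)
  have oD: "open (chart_map c ` D)" by (rule open_chart_image[OF c(1) D(1,3)])
  obtain r where r: "r > 0" "cball (chart_map c p) r \<subseteq> chart_map c ` D"
    using oD D(2) open_contains_cball by (metis imageI)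
  obtain \<beta> :: "'e \<Rightarrow> real" where \<beta>: "smooth_on UNIV \<beta>" "\<And>y. dist y (chart_map c p) < r / 2 \<Longrightarrow> \<beta> y = 1"
    "\<And>y. dist y (chart_map c p) \<ge> r \<Longrightarrow> \<beta> y = 0"
    using exists_bump[OF r(1)] by metis
  define \<psi> where "\<psi> = (\<lambda>q. if q \<in> chart_dom c then \<beta> (chart_map c q) else 0)"
  define K where "K = chart_inv c ` cball (chart_map c p) r"
  have KD: "K \<subseteq> D"
  proof
    fix q assume "q \<in> K"
    then obtain x where x: "x \<in> cball (chart_map c p) r" "q = chart_inv c x" by (auto simp: K_def)
    then obtain q' where "q' \<in> D" "x = chart_map c q'" using r(2) by blast
    then show "q \<in> D" using x(2) D(3) chart_inv_map[OF c(1)] by auto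
  qed
  have "compact K" unfolding K_def
    by (intro compact_continuous_image continuous_on_subset[OF continuous_on_chart_inv[OF c(1)]])
      (use r D in auto)
  then have K: "closed K" by (rule compact_imp_closed)
  have K0: "\<psi> q = 0" if "q \<notin> K" for q
  proof (cases "q \<in> chart_dom c")
    case True
    have "chart_map c q \<notin> cball (chart_map c p) r"
      using that chart_inv_map[OF c(1) True] unfolding K_def by (metis imageI)
    then show ?thesis using \<beta>(3)[of "chart_map c q"] True by (simp add: \<psi>_def dist_commute)
  qed (simp add: \<psi>_def)
  have s: "smooth_fun A \<psi>"
  proof (rule smooth_fun_localI)
    fix q
    show "\<exists>c\<in>A. \<exists>U. open U \<and> q \<in> U \<and> U \<subseteq> chart_dom c \<and> smooth_on (chart_map c ` U) (\<psi> \<circ> chart_inv c)"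
    proof (cases "q \<in> chart_dom c")
      case True
      have "smooth_on (chart_range c) (\<psi> \<circ> chart_inv c)"
        by (rule smooth_on_cong[OF open_chart_range[OF c(1)] _ smooth_on_subset[OF \<beta>(1)]])
          (use c in \<open>auto simp: \<psi>_def chart_inv_map\<close>)
      then show ?thesis using c True open_chart_dom by blast
    next
      case False
      obtain d U where d: "d \<in> A" and U: "open U" "q \<in> U" "U \<subseteq> chart_dom d" "U \<inter> K = {}"
        using chart_off_closed[OF K, of q] False KD D(3) by blast
      have "smooth_on (chart_map d ` U) (\<psi> \<circ> chart_inv d)"
        by (rule smooth_on_cong[OF open_chart_image[OF d U(1,3)] _ smooth_on_const[of _ 0]])
          (use d U K0 in \<open>auto simp: chart_inv_map disjoint_iff subset_iff\<close>)
      then show ?thesis using U d by blast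
    qed
  qed
  define V where "V = chart_inv c ` (ball (chart_map c p) (r / 2))"
  have Veq: "V = chart_map c -` ball (chart_map c p) (r/2) \<inter> chart_dom c"
  proof -
    have "ball (chart_map c p) (r/2) \<subseteq> cball (chart_map c p) r" using r(1) by auto
    then have sub: "ball (chart_map c p) (r/2) \<subseteq> chart_range c"
      using r(2) D(3) by blast
    show ?thesis
    proof (intro equalityI subsetI)
      fix q assume "q \<in> V"
      then obtain x where x: "x \<in> ball (chart_map c p) (r/2)" "q = chart_inv c x" by (auto simp: V_def)
      moreover have "x \<in> chart_range c" using x sub by blast
      ultimately show "q \<in> chart_map c -` ball (chart_map c p) (r/2) \<inter> chart_dom c"
        using chart_map_inv[OF c(1)] chart_inv_in[OF c(1)] by simp
    next
      fix q assume "q \<in> chart_map c -` ball (chart_map c p) (r/2) \<inter> chart_dom c"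
      then show "q \<in> V" unfolding V_def using chart_inv_map[OF c(1), of q]
        by (metis IntE imageI vimageE)
    qed
  qed
  have "continuous_on (chart_dom c) (chart_map c)"
    using chart[OF c(1)] by (simp add: is_chart_def homeomorphism_def)
  then have oV: "open V"
    unfolding Veq using open_chart_dom[OF c(1)] by (simp add: continuous_on_open_vimage)
  have pV: "p \<in> V" using Veq r(1) c by simp
  have V1: "\<psi> q = 1" if "q \<in> V" for q
    using that Veq \<beta>(2) by (auto simp: \<psi>_def dist_commute)
  have "cutoff W p \<psi>" unfolding cutoff_def
    using s oV pV V1 K KD D(4) K0 by blast
  then show ?thesis by (rule that)
qed

lemma cutoff_at: "cutoff W p \<psi> \<Longrightarrow> \<psi> p = 1"
  by (auto simp: cutoff_def)

lemma extend_vf: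
  assumes "c \<in> A" "p \<in> chart_dom c" "smooth_on (chart_range c) (vf_rep A c X)"
  obtains Y V where "smooth_vf A Y" "open V" "p \<in> V" "V \<subseteq> chart_dom c" "\<And>q. q \<in> V \<Longrightarrow> Y q = X q"
proof -
  obtain \<psi> where \<psi>: "cutoff (chart_dom c) p \<psi>"
    using exists_cutoff[OF open_chart_dom[OF assms(1)] assms(2)] by blast
  then obtain V where V: "open V" "p \<in> V" "\<And>q. q \<in> V \<Longrightarrow> \<psi> q = 1" by (auto simp: cutoff_def)
  show ?thesis
  proof (rule that[of "\<lambda>q. \<psi> q *\<^sub>R X q" "V \<inter> chart_dom c"])
    show "smooth_vf A (\<lambda>q. \<psi> q *\<^sub>R X q)"
      by (rule cutoff_smooth_vf[OF \<psi> assms(1) open_chart_dom[OF assms(1)] order_refl assms(3)])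
  qed (use V assms open_chart_dom[OF assms(1)] in auto)
qed

lemma extend_fun:
  assumes "c \<in> A" "p \<in> chart_dom c" "smooth_on (chart_range c) (f \<circ> chart_inv c)"
  obtains h V where "smooth_fun A h" "open V" "p \<in> V" "V \<subseteq> chart_dom c" "\<And>q. q \<in> V \<Longrightarrow> h q = f q"
proof -
  obtain \<psi> where \<psi>: "cutoff (chart_dom c) p \<psi>"
    using exists_cutoff[OF open_chart_dom[OF assms(1)] assms(2)] by blast
  then obtain V where V: "open V" "p \<in> V" "\<And>q. q \<in> V \<Longrightarrow> \<psi> q = 1" by (auto simp: cutoff_def)
  show ?thesis
  proof (rule that[of "\<lambda>q. \<psi> q * f q" "V \<inter> chart_dom c"])
    show "smooth_fun A (\<lambda>q. \<psi> q * f q)"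
      by (rule cutoff_smooth_fun[OF \<psi> assms(1) open_chart_dom[OF assms(1)] order_refl assms(3)])
  qed (use V assms open_chart_dom[OF assms(1)] in auto)
qed

section \<open>Vector fields as derivations\<close>

lemma fun_rep_has_derivative:
  assumes "smooth_fun A f" "c \<in> A" "p \<in> chart_dom c"
  shows "((f \<circ> chart_inv c) has_derivative frechet_derivative (f \<circ> chart_inv c) (at (chart_map c p))) (at (chart_map c p))"
  by (rule smooth_on_has_derivative[of "chart_range c"]) (use assms in \<open>auto simp: smooth_fun_def\<close>)

lemma dir_deriv_chart:
  assumes "smooth_fun A f" "c \<in> A" "p \<in> chart_dom c"
  shows "dir_deriv A X f p = frechet_derivative (f \<circ> chart_inv c) (at (chart_map c p)) (to_chart A c p (X p))"
proof -
  have "((f \<circ> chart_inv (chart_at A p)) has_derivative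
     (\<lambda>v. frechet_derivative (f \<circ> chart_inv c) (at (chart_map c p)) (jac (chart_at A p) c p v)))
     (at (chart_map (chart_at A p) p))"
    by (rule chart_change_has_derivative[OF chart_at(1) assms(2) chart_at(2) assms(3) fun_rep_has_derivative[OF assms]])
  from fun_cong[OF frechet_derivative_at[OF this], of "X p"] show ?thesis
    unfolding dir_deriv_def Let_def to_chart_jac by simp
qed

lemma dir_deriv_rep:
  assumes "smooth_fun A f" "c \<in> A" "x \<in> chart_range c"
  shows "dir_deriv A X f (chart_inv c x) = frechet_derivative (f \<circ> chart_inv c) (at x) (vf_rep A c X x)"
  using dir_deriv_chart[OF assms(1,2) chart_inv_in[OF assms(2,3)]]
  by (simp add: chart_map_inv[OF assms(2,3)] vf_rep_def)

lemma smooth_dir_deriv: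
  assumes "smooth_vf A X" "smooth_fun A f"
  shows "smooth_fun A (dir_deriv A X f)"
  unfolding smooth_fun_def
proof
  fix c assume c: "c \<in> A"
  show "smooth_on (chart_range c) (dir_deriv A X f \<circ> chart_inv c)"
    by (rule smooth_on_cong[OF open_chart_range[OF c] _
        smooth_on_frechet_derivative_field[OF open_chart_range[OF c], of "f \<circ> chart_inv c" "vf_rep A c X"]])
      (use assms c in \<open>auto simp: dir_deriv_rep smooth_fun_def smooth_vf_def\<close>)
qed

lemma dir_deriv_at:
  assumes "smooth_fun A f"
    and "((f \<circ> chart_inv (chart_at A p)) has_derivative f') (at (chart_map (chart_at A p) p))"
  shows "dir_deriv A X f p = f' (X p)"
  using frechet_derivative_at[OF assms(2)] by (simp add: dir_deriv_def Let_def)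

lemmas fun_rep_has_derivative_at = fun_rep_has_derivative[OF _ chart_at]

lemma dir_deriv_const [simp]: "dir_deriv A X (\<lambda>_. k) p = 0"
  by (rule dir_deriv_at[OF smooth_fun_const]) (simp add: o_def)

lemma dir_deriv_add:
  assumes "smooth_fun A f" "smooth_fun A h"
  shows "dir_deriv A X (\<lambda>p. f p + h p) p = dir_deriv A X f p + dir_deriv A X h p"
  using has_derivative_add[OF fun_rep_has_derivative_at[OF assms(1), of p] fun_rep_has_derivative_at[OF assms(2), of p]]
  by (subst dir_deriv_at[OF smooth_fun_add[OF assms]]) (auto simp: o_def dir_deriv_def Let_def)

lemma dir_deriv_mult:
  assumes "smooth_fun A f" "smooth_fun A h"
  shows "dir_deriv A X (\<lambda>p. f p * h p) p = f p * dir_deriv A X h p + dir_deriv A X f p * h p"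
  using has_derivative_mult[OF fun_rep_has_derivative_at[OF assms(1), of p] fun_rep_has_derivative_at[OF assms(2), of p]]
  by (subst dir_deriv_at[OF smooth_fun_mult[OF assms]])
    (auto simp: o_def dir_deriv_def Let_def chart_inv_map chart_at)

lemma dir_deriv_minus:
  assumes "smooth_fun A f"
  shows "dir_deriv A X (\<lambda>p. - f p) p = - dir_deriv A X f p"
  using dir_deriv_mult[OF smooth_fun_const[of "-1"] assms, of X p] by simp

lemma linear_dir_deriv:
  assumes "smooth_fun A f"
  obtains L where "linear L" "\<And>X. dir_deriv A X f p = L (X p)"
  using that[OF has_derivative_linear[OF fun_rep_has_derivative_at[OF assms, of p]]]
  by (simp add: dir_deriv_def Let_def)

lemma dir_deriv_vf_add: "smooth_fun A f \<Longrightarrow> dir_deriv A (\<lambda>p. X p + Y p) f p = dir_deriv A X f p + dir_deriv A Y f p"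
  and dir_deriv_vf_scale: "smooth_fun A f \<Longrightarrow> dir_deriv A (\<lambda>p. k p *\<^sub>R X p) f p = k p * dir_deriv A X f p"
  by (rule linear_dir_deriv[of f p], assumption, simp add: linear_add linear_scale)+

lemma coordinate_function:
  assumes "c \<in> A" "p \<in> chart_dom c"
  obtains h V where "smooth_fun A h" "open V" "p \<in> V" "V \<subseteq> chart_dom c"
    "\<And>q X. q \<in> V \<Longrightarrow> dir_deriv A X h q = to_chart A c q (X q) \<bullet> b"
proof -
  have "smooth_on (chart_range c) (\<lambda>x. x \<bullet> b)"
    by (intro smooth_on_inner smooth_on_ident smooth_on_const open_chart_range assms)
  then have "smooth_on (chart_range c) ((\<lambda>q. chart_map c q \<bullet> b) \<circ> chart_inv c)"
    by (rule smooth_on_cong[OF open_chart_range[OF assms(1)], rotated])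
      (use assms in \<open>auto simp: chart_inv_map\<close>)
  then obtain h V where h: "smooth_fun A h" and V: "open V" "p \<in> V" "V \<subseteq> chart_dom c"
    and hq: "\<And>q. q \<in> V \<Longrightarrow> h q = chart_map c q \<bullet> b"
    by (rule extend_fun[OF assms]) blast
  show ?thesis
  proof (rule that[OF h V])
    fix q X assume q: "q \<in> V"
    have "((\<lambda>x. x \<bullet> b) has_derivative (\<lambda>u. u \<bullet> b)) (at (chart_map c q))"
      by (auto intro!: derivative_eq_intros)
    then have "((h \<circ> chart_inv c) has_derivative (\<lambda>u. u \<bullet> b)) (at (chart_map c q))"
      by (rule has_derivative_transform_within_open[OF _ open_chart_image[OF assms(1) V(1,3)]])
        (use q V assms hq in \<open>auto simp: chart_inv_map subset_iff\<close>)
    from fun_cong[OF frechet_derivative_at[OF this], of "to_chart A c q (X q)"]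
    show "dir_deriv A X h q = to_chart A c q (X q) \<bullet> b"
      using dir_deriv_chart[OF h assms(1), of q X] q V by auto
  qed
qed

text \<open>Coordinate functions, extended globally by a cutoff, single out the components of a vector
  field near a point. They decide equality of tangent vectors and, in the lemma after this one,
  smoothness of fields.\<close>

lemma tangent_eqI:
  assumes "\<And>f. smooth_fun A f \<Longrightarrow> dir_deriv A X f p = dir_deriv A Y f p"
  shows "X p = Y p"
proof (rule euclidean_eqI)
  fix b :: 'e
  obtain h V where "smooth_fun A h" "p \<in> V"
    "\<And>q X. q \<in> V \<Longrightarrow> dir_deriv A X h q = to_chart A (chart_at A p) q (X q) \<bullet> b"
    by (rule coordinate_function[OF chart_at, of p b]) blast
  then show "X p \<bullet> b = Y p \<bullet> b"
    using assms[of h] by (metis to_chart_at)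
qed

lemma smooth_vfI:
  assumes "\<And>f. smooth_fun A f \<Longrightarrow> smooth_fun A (dir_deriv A X f)"
  shows "smooth_vf A X"
proof (rule smooth_vf_localI)
  fix p
  define c where "c = chart_at A p"
  have c: "c \<in> A" "p \<in> chart_dom c" by (simp_all add: c_def chart_at)
  have "\<exists>h V. smooth_fun A h \<and> open V \<and> p \<in> V \<and> V \<subseteq> chart_dom c \<and>
      (\<forall>q\<in>V. dir_deriv A X h q = to_chart A c q (X q) \<bullet> b)" for b
    by (rule coordinate_function[OF c, of b]) blast
  then obtain h V where h: "\<And>b. smooth_fun A (h b)" and V: "\<And>b. open (V b)" "\<And>b. p \<in> V b" "\<And>b. V b \<subseteq> chart_dom c"
    and Xh: "\<And>b q. q \<in> V b \<Longrightarrow> dir_deriv A X (h b) q = to_chart A c q (X q) \<bullet> b"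
    by metis
  define U where "U = chart_dom c \<inter> (\<Inter>b\<in>Basis. V b)"
  have U: "open U" "p \<in> U" "U \<subseteq> chart_dom c"
    using V c open_chart_dom[OF c(1)] by (auto simp: U_def intro!: open_Int open_INT)
  have oU: "open (chart_map c ` U)" by (rule open_chart_image[OF c(1) U(1,3)])
  have "smooth_on (chart_map c ` U) (\<lambda>x. \<Sum>b\<in>Basis. (dir_deriv A X (h b) \<circ> chart_inv c) x *\<^sub>R b)"
    by (intro smooth_on_sum smooth_on_scaleR oU smooth_on_const smooth_fun_rep assms h c U)
  then have "smooth_on (chart_map c ` U) (vf_rep A c X)"
  proof (rule smooth_on_cong[OF oU, rotated])
    fix x assume "x \<in> chart_map c ` U"
    then obtain q where q: "q \<in> U" "x = chart_map c q" by auto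
    have "vf_rep A c X x = (\<Sum>b\<in>Basis. (to_chart A c q (X q) \<bullet> b) *\<^sub>R b)"
      using q U c by (simp add: vf_rep_map euclidean_representation subset_iff)
    also have "\<dots> = (\<Sum>b\<in>Basis. (dir_deriv A X (h b) \<circ> chart_inv c) x *\<^sub>R b)"
      using q U c Xh by (intro sum.cong) (auto simp: chart_inv_map subset_iff U_def)
    finally show "(\<Sum>b\<in>Basis. (dir_deriv A X (h b) \<circ> chart_inv c) x *\<^sub>R b) = vf_rep A c X x" by simp
  qed
  then show "\<exists>c\<in>A. \<exists>U. open U \<and> p \<in> U \<and> U \<subseteq> chart_dom c \<and> smooth_on (chart_map c ` U) (vf_rep A c X)"
    using c U by blast
qed

section \<open>The Lie bracket\<close>

text \<open>The right-hand side does not refer to coordinates. All rules for the bracket, and its smoothness,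
  are deduced from this description, since derivations determine vector fields.\<close>

lemma dir_deriv_lie_bracket:
  assumes X: "smooth_vf A X" and Y: "smooth_vf A Y" and f: "smooth_fun A f"
  shows "dir_deriv A (lie_bracket A X Y) f p = dir_deriv A X (dir_deriv A Y f) p - dir_deriv A Y (dir_deriv A X f) p"
proof -
  define c where "c = chart_at A p"
  have c: "c \<in> A" "p \<in> chart_dom c" by (simp_all add: c_def chart_at)
  define F where "F = f \<circ> chart_inv c"
  define x where "x = chart_map c p"
  have x: "x \<in> chart_range c" using c by (simp add: x_def)
  have F: "smooth_on (chart_range c) F" using f c by (simp add: F_def smooth_fun_def)
  have *: "dir_deriv A U (dir_deriv A Z f) p
      = frechet_derivative (\<lambda>y. frechet_derivative F (at y) (vf_rep A c Z y)) (at x) (vf_rep A c U x)"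
    if Z: "smooth_vf A Z" for U Z
  proof -
    have s: "smooth_on (chart_range c) (\<lambda>y. frechet_derivative F (at y) (vf_rep A c Z y))"
      by (rule smooth_on_frechet_derivative_field)
        (use Z F c open_chart_range in \<open>auto simp: smooth_vf_def\<close>)
    have "((\<lambda>y. frechet_derivative F (at y) (vf_rep A c Z y)) has_derivative
        frechet_derivative (\<lambda>y. frechet_derivative F (at y) (vf_rep A c Z y)) (at x)) (at x)"
      by (rule smooth_on_has_derivative[OF s x])
    then have "((dir_deriv A Z f \<circ> chart_inv c) has_derivative
        frechet_derivative (\<lambda>y. frechet_derivative F (at y) (vf_rep A c Z y)) (at x)) (at x)"
      by (rule has_derivative_transform_within_open[OF _ open_chart_range[OF c(1)] x])
        (use dir_deriv_rep[OF f c(1)] in \<open>simp add: F_def\<close>)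
    from frechet_derivative_at[OF this] show ?thesis
      using dir_deriv_chart[OF smooth_dir_deriv[OF Z f] c, of U] vf_rep_map[OF c, of U]
      by (simp add: x_def)
  qed
  have r: "vf_rep A c U x = U p" for U
    using vf_rep_map[OF c, of U] to_chart_at by (simp add: x_def c_def)
  have "frechet_derivative (\<lambda>y. frechet_derivative F (at y) (vf_rep A c Y y)) (at x) (vf_rep A c X x)
       - frechet_derivative (\<lambda>y. frechet_derivative F (at y) (vf_rep A c X y)) (at x) (vf_rep A c Y x)
      = frechet_derivative F (at x) (frechet_derivative (vf_rep A c Y) (at x) (vf_rep A c X x)
         - frechet_derivative (vf_rep A c X) (at x) (vf_rep A c Y x))"
    by (rule commutator_of_derivatives[OF open_chart_range[OF c(1)] x])
      (use X Y F c in \<open>auto simp: smooth_vf_def\<close>)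
  then have "dir_deriv A X (dir_deriv A Y f) p - dir_deriv A Y (dir_deriv A X f) p
      = frechet_derivative F (at x) (frechet_derivative (vf_rep A c Y) (at x) (X p)
         - frechet_derivative (vf_rep A c X) (at x) (Y p))"
    by (simp only: *[OF X] *[OF Y] r)
  also have "\<dots> = dir_deriv A (lie_bracket A X Y) f p"
    by (simp add: dir_deriv_def lie_bracket_def Let_def F_def x_def c_def)
  finally show ?thesis by simp
qed

lemma smooth_lie_bracket:
  assumes "smooth_vf A X" "smooth_vf A Y"
  shows "smooth_vf A (lie_bracket A X Y)"
proof (rule smooth_vfI)
  fix f assume f: "smooth_fun A f"
  have "dir_deriv A (lie_bracket A X Y) f = (\<lambda>p. dir_deriv A X (dir_deriv A Y f) p - dir_deriv A Y (dir_deriv A X f) p)"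
    using dir_deriv_lie_bracket[OF assms f] by auto
  then show "smooth_fun A (dir_deriv A (lie_bracket A X Y) f)"
    by (simp add: smooth_fun_diff smooth_dir_deriv assms f)
qed

lemma lie_bracket_skew: "lie_bracket A Y X p = - lie_bracket A X Y p"
  by (simp add: lie_bracket_def Let_def)

lemma lie_bracket_add_right:
  assumes X: "smooth_vf A X" and Y: "smooth_vf A Y" and Z: "smooth_vf A Z"
  shows "lie_bracket A X (\<lambda>p. Y p + Z p) p = lie_bracket A X Y p + lie_bracket A X Z p"
proof (rule tangent_eqI[where Y = "\<lambda>p. lie_bracket A X Y p + lie_bracket A X Z p"])
  fix f assume f: "smooth_fun A f"
  have e: "dir_deriv A (\<lambda>p. Y p + Z p) f = (\<lambda>p. dir_deriv A Y f p + dir_deriv A Z f p)"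
    using dir_deriv_vf_add[OF f] by auto
  show "dir_deriv A (lie_bracket A X (\<lambda>p. Y p + Z p)) f p =
      dir_deriv A (\<lambda>p. lie_bracket A X Y p + lie_bracket A X Z p) f p"
    by (simp add: dir_deriv_lie_bracket dir_deriv_vf_add smooth_vf_add X Y Z f e dir_deriv_add smooth_dir_deriv)
qed

lemma lie_bracket_scale_right:
  assumes X: "smooth_vf A X" and Y: "smooth_vf A Y" and k: "smooth_fun A k"
  shows "lie_bracket A X (\<lambda>p. k p *\<^sub>R Y p) p = k p *\<^sub>R lie_bracket A X Y p + dir_deriv A X k p *\<^sub>R Y p"
proof (rule tangent_eqI[where Y = "\<lambda>p. k p *\<^sub>R lie_bracket A X Y p + dir_deriv A X k p *\<^sub>R Y p"])
  fix f assume f: "smooth_fun A f"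
  have e: "dir_deriv A (\<lambda>p. k p *\<^sub>R Y p) f = (\<lambda>p. k p * dir_deriv A Y f p)"
    using dir_deriv_vf_scale[OF f] by auto
  show "dir_deriv A (lie_bracket A X (\<lambda>p. k p *\<^sub>R Y p)) f p =
      dir_deriv A (\<lambda>p. k p *\<^sub>R lie_bracket A X Y p + dir_deriv A X k p *\<^sub>R Y p) f p"
    by (simp add: dir_deriv_lie_bracket dir_deriv_vf_add dir_deriv_vf_scale smooth_vf_scale X Y k f e
       dir_deriv_mult smooth_dir_deriv algebra_simps)
qed

lemma lie_bracket_add_left:
  assumes "smooth_vf A X" "smooth_vf A Y" "smooth_vf A Z"
  shows "lie_bracket A (\<lambda>p. X p + Y p) Z p = lie_bracket A X Z p + lie_bracket A Y Z p"
  unfolding lie_bracket_skew[of _ Z] lie_bracket_add_right[OF assms(3,1,2)] by simp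

lemma lie_bracket_scale_left:
  assumes "smooth_vf A X" "smooth_vf A Y" "smooth_fun A k"
  shows "lie_bracket A (\<lambda>p. k p *\<^sub>R X p) Y p = k p *\<^sub>R lie_bracket A X Y p - dir_deriv A Y k p *\<^sub>R X p"
  unfolding lie_bracket_skew[of _ Y] lie_bracket_scale_right[OF assms(2,1,3)] by simp

lemma lie_bracket_fun_simps:
  "smooth_vf A X \<Longrightarrow> smooth_vf A Y \<Longrightarrow> smooth_vf A Z \<Longrightarrow>
    lie_bracket A X (\<lambda>p. Y p + Z p) = (\<lambda>p. lie_bracket A X Y p + lie_bracket A X Z p)"
  "smooth_vf A X \<Longrightarrow> smooth_vf A Y \<Longrightarrow> smooth_vf A Z \<Longrightarrow>
    lie_bracket A (\<lambda>p. X p + Y p) Z = (\<lambda>p. lie_bracket A X Z p + lie_bracket A Y Z p)"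
  "smooth_vf A X \<Longrightarrow> smooth_vf A Y \<Longrightarrow> smooth_fun A f \<Longrightarrow>
    lie_bracket A X (\<lambda>p. f p *\<^sub>R Y p) = (\<lambda>p. f p *\<^sub>R lie_bracket A X Y p + dir_deriv A X f p *\<^sub>R Y p)"
  "smooth_vf A X \<Longrightarrow> smooth_vf A Y \<Longrightarrow> smooth_fun A f \<Longrightarrow>
    lie_bracket A (\<lambda>p. f p *\<^sub>R X p) Y = (\<lambda>p. f p *\<^sub>R lie_bracket A X Y p - dir_deriv A Y f p *\<^sub>R X p)"
  by (auto simp: lie_bracket_add_left lie_bracket_add_right lie_bracket_scale_left lie_bracket_scale_right)

section \<open>Tensor fields\<close>

lemma vf_from_rep:
  "c \<in> A \<Longrightarrow> x \<in> chart_range c \<Longrightarrow> X (chart_inv c x) = from_chart A c (chart_inv c x) (vf_rep A c X x)"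
  by (simp add: vf_rep_def from_to_chart chart_inv_in)

lemma linear_from_chart_inv: "c \<in> A \<Longrightarrow> x \<in> chart_range c \<Longrightarrow> linear (from_chart A c (chart_inv c x))"
  by (rule linear_from_chart[OF _ chart_inv_in])

lemma smooth_form_app:
  assumes "smooth_one_form A \<alpha>" "smooth_vf A X"
  shows "smooth_fun A (form_app \<alpha> X)"
  unfolding smooth_fun_def
proof
  fix c assume c: "c \<in> A"
  have "smooth_on (chart_range c) (\<lambda>x. \<alpha> (chart_inv c x) (from_chart A c (chart_inv c x) (vf_rep A c X x)))"
  proof (rule smooth_on_linear_combination[OF open_chart_range[OF c],
        where L = "\<lambda>x u. \<alpha> (chart_inv c x) (from_chart A c (chart_inv c x) u)" and v = "vf_rep A c X"])
    show "linear (\<lambda>u. \<alpha> (chart_inv c x) (from_chart A c (chart_inv c x) u))" if "x \<in> chart_range c" for x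
      using assms(1) linear_compose[OF linear_from_chart_inv[OF c that], of "\<alpha> (chart_inv c x)"]
      by (simp add: smooth_one_form_def o_def)
  qed (use assms c in \<open>auto simp: smooth_one_form_def smooth_vf_def Let_def\<close>)
  then show "smooth_on (chart_range c) (form_app \<alpha> X \<circ> chart_inv c)"
    by (rule smooth_on_cong[OF open_chart_range[OF c], rotated])
      (simp only: form_app_def o_def vf_from_rep[OF c, symmetric])
qed

lemma smooth_endo_app:
  assumes "smooth_endo A \<phi>" "smooth_vf A X"
  shows "smooth_vf A (endo_app \<phi> X)"
  unfolding smooth_vf_def
proof
  fix c assume c: "c \<in> A"
  have "smooth_on (chart_range c) (\<lambda>x. to_chart A c (chart_inv c x)
      (\<phi> (chart_inv c x) (from_chart A c (chart_inv c x) (vf_rep A c X x))))"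
  proof (rule smooth_on_linear_combination[OF open_chart_range[OF c], where v = "vf_rep A c X" and
        L = "\<lambda>x u. to_chart A c (chart_inv c x) (\<phi> (chart_inv c x) (from_chart A c (chart_inv c x) u))"])
    fix x assume x: "x \<in> chart_range c"
    have "linear (to_chart A c (chart_inv c x) \<circ> (\<phi> (chart_inv c x) \<circ> from_chart A c (chart_inv c x)))"
      using assms(1) linear_from_chart_inv[OF c x] linear_to_chart[OF c chart_inv_in[OF c x]]
      by (intro linear_compose) (auto simp: smooth_endo_def)
    then show "linear (\<lambda>u. to_chart A c (chart_inv c x) (\<phi> (chart_inv c x) (from_chart A c (chart_inv c x) u)))"
      by (simp add: o_def)
  qed (use assms c in \<open>auto simp: smooth_endo_def smooth_vf_def Let_def\<close>)
  then show "smooth_on (chart_range c) (vf_rep A c (endo_app \<phi> X))"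
  proof (rule smooth_on_cong[OF open_chart_range[OF c], rotated])
    fix x assume x: "x \<in> chart_range c"
    show "to_chart A c (chart_inv c x) (\<phi> (chart_inv c x) (from_chart A c (chart_inv c x) (vf_rep A c X x)))
      = vf_rep A c (endo_app \<phi> X) x"
      unfolding vf_from_rep[OF c x, of X, symmetric] by (simp add: vf_rep_def endo_app_def)
  qed
qed

lemma smooth_bil_app:
  assumes "riemannian_metric A g" "smooth_vf A X" "smooth_vf A Y"
  shows "smooth_fun A (bil_app g X Y)"
  unfolding smooth_fun_def
proof
  fix c assume c: "c \<in> A"
  have l1: "linear (\<lambda>u. g p (from_chart A c p u) v)" and l2: "linear (\<lambda>v. g p u (from_chart A c p v))"
    if "p \<in> chart_dom c" for u v p
    using assms(1) linear_compose[OF linear_from_chart[OF c that], of "\<lambda>u. g p u v"]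
      linear_compose[OF linear_from_chart[OF c that], of "g p u"]
    by (simp_all add: riemannian_metric_def bilinear_def o_def)
  have "smooth_on (chart_range c) (\<lambda>x. g (chart_inv c x) (from_chart A c (chart_inv c x) (vf_rep A c X x))
      (from_chart A c (chart_inv c x) (vf_rep A c Y x)))"
  proof (rule smooth_on_linear_combination[OF open_chart_range[OF c], where v = "vf_rep A c X" and
        L = "\<lambda>x u. g (chart_inv c x) (from_chart A c (chart_inv c x) u) (from_chart A c (chart_inv c x) (vf_rep A c Y x))"])
    show "smooth_on (chart_range c) (\<lambda>x. g (chart_inv c x) (from_chart A c (chart_inv c x) b)
      (from_chart A c (chart_inv c x) (vf_rep A c Y x)))" for b
      by (rule smooth_on_linear_combination[OF open_chart_range[OF c], where v = "vf_rep A c Y" and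
            L = "\<lambda>x u. g (chart_inv c x) (from_chart A c (chart_inv c x) b) (from_chart A c (chart_inv c x) u)",
            OF l2[OF chart_inv_in[OF c]]])
        (use assms c in \<open>auto simp: riemannian_metric_def smooth_vf_def Let_def\<close>)
  qed (use assms c l1[OF chart_inv_in[OF c]] in \<open>auto simp: smooth_vf_def\<close>)
  then show "smooth_on (chart_range c) (bil_app g X Y \<circ> chart_inv c)"
    by (rule smooth_on_cong[OF open_chart_range[OF c], rotated])
      (simp only: bil_app_def o_def vf_from_rep[OF c, symmetric])
qed

text \<open>The coordinate frame of a chart coincides near \<open>p\<close> with globally defined smooth fields, so that
  statements about global fields can be used in coordinates.\<close>

lemma local_frame:
  assumes c: "c \<in> A" "p \<in> chart_dom c"
  obtains E V where "\<And>b. smooth_vf A (E b)" "open V" "p \<in> V" "V \<subseteq> chart_dom c"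
    "\<And>b q. b \<in> Basis \<Longrightarrow> q \<in> V \<Longrightarrow> E b q = from_chart A c q b"
proof -
  have "\<exists>Y V. smooth_vf A Y \<and> open V \<and> p \<in> V \<and> V \<subseteq> chart_dom c \<and> (\<forall>q\<in>V. Y q = from_chart A c q b)" for b
  proof -
    have "smooth_on (chart_range c) (vf_rep A c (\<lambda>q. from_chart A c q b))"
      by (rule smooth_on_cong[OF open_chart_range[OF c(1)] _ smooth_on_const[of _ b]])
        (use c in \<open>auto simp: vf_rep_map to_from_chart\<close>)
    then show ?thesis by (rule extend_vf[OF c]) blast
  qed
  then obtain E V where E: "\<And>b. smooth_vf A (E b)" and V: "\<And>b. open (V b)" "\<And>b. p \<in> V b" "\<And>b. V b \<subseteq> chart_dom c"
    and EV: "\<And>b q. q \<in> V b \<Longrightarrow> E b q = from_chart A c q b"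
    by metis
  show ?thesis
    by (rule that[of E "chart_dom c \<inter> (\<Inter>b\<in>Basis. V b)"])
      (use E V EV c open_chart_dom[OF c(1)] in \<open>auto intro!: open_Int open_INT\<close>)
qed

lemma exists_vf_through:
  obtains X where "smooth_vf A X" "X p = v"
proof -
  define c where "c = chart_at A p"
  have c: "c \<in> A" "p \<in> chart_dom c" by (simp_all add: c_def chart_at)
  have "smooth_on (chart_range c) (vf_rep A c (\<lambda>q. from_chart A c q v))"
    by (rule smooth_on_cong[OF open_chart_range[OF c(1)] _ smooth_on_const[of _ v]])
      (use c in \<open>auto simp: vf_rep_map to_from_chart\<close>)
  then obtain Y where "smooth_vf A Y" "Y p = from_chart A c p v"
    by (rule extend_vf[OF c]) blast
  moreover have "from_chart A c p v = v"
    using from_to_chart[OF c, of v] to_chart_at[of p v] by (simp add: c_def)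
  ultimately show ?thesis using that by simp
qed

text \<open>A smooth 1-form seen only through its action on global fields. The Koszul expression is given in
  this way.\<close>

definition covector_field :: "(('m, 'e) vector_field \<Rightarrow> 'm scalar_field) \<Rightarrow> bool" where
  "covector_field K \<longleftrightarrow>
     (\<forall>Z. smooth_vf A Z \<longrightarrow> smooth_fun A (K Z)) \<and>
     (\<forall>Z Z' p. smooth_vf A Z \<and> smooth_vf A Z' \<longrightarrow> K (\<lambda>p. Z p + Z' p) p = K Z p + K Z' p) \<and>
     (\<forall>f Z p. smooth_fun A f \<and> smooth_vf A Z \<longrightarrow> K (\<lambda>p. f p *\<^sub>R Z p) p = f p * K Z p)"

lemma covector_field_sum:
  assumes "covector_field K" "finite I" "\<And>i. i \<in> I \<Longrightarrow> smooth_vf A (Z i)"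
  shows "K (\<lambda>p. \<Sum>i\<in>I. Z i p) p = (\<Sum>i\<in>I. K (Z i) p)"
  using assms(2,3)
proof (induction I rule: finite_induct)
  case empty
  have "K (\<lambda>p. (\<lambda>_. 0) p *\<^sub>R (\<lambda>_. 0) p) p = 0"
    using assms(1) smooth_fun_const[of 0] smooth_vf_zero by (simp only: covector_field_def mult_zero_left)
  then show ?case by simp
next
  case (insert i I)
  then show ?case
    using assms(1) smooth_vf_sum[of I Z] by (simp add: covector_field_def)
qed

text \<open>Near \<open>p\<close> the field is a combination of frame fields whose coefficients vanish at \<open>p\<close>; after
  multiplication with a cutoff function this holds globally, and linearity over the functions applies.\<close>

lemma covector_field_zero_at:
  assumes K: "covector_field K" and Z: "smooth_vf A Z" "Z p = 0"
  shows "K Z p = 0"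
proof -
  define c where "c = chart_at A p"
  have c: "c \<in> A" "p \<in> chart_dom c" by (simp_all add: c_def chart_at)
  obtain E V where E: "\<And>b. smooth_vf A (E b)" and V: "open V" "p \<in> V" "V \<subseteq> chart_dom c"
    and EV: "\<And>b q. b \<in> Basis \<Longrightarrow> q \<in> V \<Longrightarrow> E b q = from_chart A c q b"
    by (rule local_frame[OF c]) blast
  obtain \<psi> where \<psi>: "cutoff V p \<psi>" using exists_cutoff[OF V(1,2)] by blast
  have \<psi>s: "smooth_fun A \<psi>" and \<psi>0: "\<And>q. q \<notin> V \<Longrightarrow> \<psi> q = 0"
    using \<psi> by (auto simp: cutoff_def)
  define z where "z = (\<lambda>b q. \<psi> q * (to_chart A c q (Z q) \<bullet> b))"
  have z: "smooth_fun A (z b)" for b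
    unfolding z_def
  proof (rule cutoff_smooth_fun[OF \<psi> c(1) V(1,3)])
    have "smooth_on (chart_map c ` V) (\<lambda>x. vf_rep A c Z x \<bullet> b)"
      by (intro smooth_on_inner smooth_on_const smooth_vf_rep open_chart_image Z c V)
    then show "smooth_on (chart_map c ` V) ((\<lambda>q. to_chart A c q (Z q) \<bullet> b) \<circ> chart_inv c)"
      by (simp add: vf_rep_def o_def)
  qed
  have "(\<lambda>q. \<psi> q *\<^sub>R Z q) = (\<lambda>q. \<Sum>b\<in>Basis. z b q *\<^sub>R E b q)"
  proof
    fix q
    show "\<psi> q *\<^sub>R Z q = (\<Sum>b\<in>Basis. z b q *\<^sub>R E b q)"
    proof (cases "q \<in> V")
      case True
      then have "q \<in> chart_dom c" using V by auto
      have "\<psi> q *\<^sub>R Z q = \<psi> q *\<^sub>R from_chart A c q (to_chart A c q (Z q))"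
        by (simp add: from_to_chart[OF c(1) \<open>q \<in> chart_dom c\<close>])
      also have "\<dots> = \<psi> q *\<^sub>R (\<Sum>b\<in>Basis. (to_chart A c q (Z q) \<bullet> b) *\<^sub>R from_chart A c q b)"
        by (intro arg_cong2[where f = scaleR] refl linear_expand linear_from_chart[OF c(1)] \<open>q \<in> chart_dom c\<close>)
      also have "\<dots> = (\<Sum>b\<in>Basis. z b q *\<^sub>R E b q)"
        unfolding scaleR_sum_right by (intro sum.cong refl) (simp add: z_def EV[OF _ True])
      finally show ?thesis .
    qed (simp add: z_def \<psi>0)
  qed
  then have "K (\<lambda>q. \<psi> q *\<^sub>R Z q) p = (\<Sum>b\<in>Basis. K (\<lambda>q. z b q *\<^sub>R E b q) p)"
    by (simp add: covector_field_sum[OF K finite_Basis] smooth_vf_scale z E)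
  also have "\<dots> = (\<Sum>b\<in>Basis. z b p * K (E b) p)"
    using K z E by (simp add: covector_field_def)
  also have "\<dots> = 0"
    by (simp add: z_def Z linear_0[OF linear_to_chart[OF c]])
  finally show ?thesis
    using K \<psi>s Z cutoff_at[OF \<psi>] by (simp add: covector_field_def)
qed

lemma covector_field_at:
  assumes K: "covector_field K" and Z: "smooth_vf A Z" "smooth_vf A Z'" "Z p = Z' p"
  shows "K Z p = K Z' p"
proof -
  have "K (\<lambda>p. Z p + (-1) *\<^sub>R Z' p) p = K Z p + (-1) * K Z' p"
  proof -
    have "K (\<lambda>p. Z p + (-1) *\<^sub>R Z' p) p = K Z p + K (\<lambda>p. (-1) *\<^sub>R Z' p) p"
      using K Z(1) smooth_vf_scale[OF smooth_fun_const Z(2)] unfolding covector_field_def by blast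
    also have "K (\<lambda>p. (-1) *\<^sub>R Z' p) p = (-1) * K Z' p"
      using K Z(2) smooth_fun_const unfolding covector_field_def by blast
    finally show ?thesis .
  qed
  moreover have "K (\<lambda>p. Z p + (-1) *\<^sub>R Z' p) p = 0"
    by (rule covector_field_zero_at[OF K smooth_vf_add[OF Z(1) smooth_vf_scale[OF smooth_fun_const Z(2)]]])
      (simp add: Z)
  ultimately show ?thesis by simp
qed

section \<open>Differential forms\<close>

lemma three_form_smooth: "is_three_form A T \<Longrightarrow> smooth_vf A X \<Longrightarrow> smooth_vf A Y \<Longrightarrow> smooth_vf A Z \<Longrightarrow>
    smooth_fun A (T X Y Z)"
  unfolding is_three_form_def by blast

lemma three_form_swap12: "is_three_form A T \<Longrightarrow> smooth_vf A X \<Longrightarrow> smooth_vf A Y \<Longrightarrow> smooth_vf A Z \<Longrightarrow>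
    T Y X Z p = - T X Y Z p"
  by (rule fun_cong[of "T Y X Z"]) (unfold is_three_form_def, blast)

lemma three_form_swap23: "is_three_form A T \<Longrightarrow> smooth_vf A X \<Longrightarrow> smooth_vf A Y \<Longrightarrow> smooth_vf A Z \<Longrightarrow>
    T X Z Y p = - T X Y Z p"
  by (rule fun_cong[of "T X Z Y"]) (unfold is_three_form_def, blast)

lemma three_form_add1: "is_three_form A T \<Longrightarrow> smooth_vf A X \<Longrightarrow> smooth_vf A X' \<Longrightarrow> smooth_vf A Y \<Longrightarrow> smooth_vf A Z \<Longrightarrow>
    T (\<lambda>p. X p + X' p) Y Z p = T X Y Z p + T X' Y Z p"
  by (rule fun_cong[of "T (\<lambda>p. X p + X' p) Y Z"]) (unfold is_three_form_def, blast)

lemma three_form_scale1: "is_three_form A T \<Longrightarrow> smooth_fun A f \<Longrightarrow> smooth_vf A X \<Longrightarrow> smooth_vf A Y \<Longrightarrow> smooth_vf A Z \<Longrightarrow>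
    T (\<lambda>p. f p *\<^sub>R X p) Y Z p = f p * T X Y Z p"
  by (rule fun_cong[of "T (\<lambda>p. f p *\<^sub>R X p) Y Z"]) (unfold is_three_form_def, blast)

lemma three_form_cycle: "is_three_form A T \<Longrightarrow> smooth_vf A X \<Longrightarrow> smooth_vf A Y \<Longrightarrow> smooth_vf A Z \<Longrightarrow>
    T Y Z X p = T X Y Z p"
  using three_form_swap23[of T Y X Z p] three_form_swap12[of T X Y Z p] by simp

lemma three_form_add2:
  assumes "is_three_form A T" "smooth_vf A X" "smooth_vf A Y" "smooth_vf A Y'" "smooth_vf A Z"
  shows "T X (\<lambda>p. Y p + Y' p) Z p = T X Y Z p + T X Y' Z p"
  using three_form_swap12[OF assms(1) smooth_vf_add[OF assms(3,4)] assms(2,5), of p]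
    three_form_add1[OF assms(1,3,4,2,5), of p]
    three_form_swap12[OF assms(1,2,3,5), of p] three_form_swap12[OF assms(1,2,4,5), of p]
  by linarith

lemma three_form_add3:
  assumes "is_three_form A T" "smooth_vf A X" "smooth_vf A Y" "smooth_vf A Z" "smooth_vf A Z'"
  shows "T X Y (\<lambda>p. Z p + Z' p) p = T X Y Z p + T X Y Z' p"
  using three_form_swap23[OF assms(1,2) smooth_vf_add[OF assms(4,5)] assms(3), of p]
    three_form_add2[OF assms(1,2,4,5,3), of p]
    three_form_swap23[OF assms(1,2,3,4), of p] three_form_swap23[OF assms(1,2,3,5), of p]
  by linarith

lemma three_form_scale2:
  assumes "is_three_form A T" "smooth_fun A f" "smooth_vf A X" "smooth_vf A Y" "smooth_vf A Z"
  shows "T X (\<lambda>p. f p *\<^sub>R Y p) Z p = f p * T X Y Z p"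
  using three_form_swap12[OF assms(1) smooth_vf_scale[OF assms(2,4)] assms(3,5), of p]
    three_form_scale1[OF assms(1,2,4,3,5), of p] three_form_swap12[OF assms(1,3,4,5), of p]
  by simp

lemma three_form_scale3:
  assumes "is_three_form A T" "smooth_fun A f" "smooth_vf A X" "smooth_vf A Y" "smooth_vf A Z"
  shows "T X Y (\<lambda>p. f p *\<^sub>R Z p) p = f p * T X Y Z p"
  using three_form_swap23[OF assms(1,3) smooth_vf_scale[OF assms(2,5)] assms(4), of p]
    three_form_scale2[OF assms(1,2,3,5,4), of p] three_form_swap23[OF assms(1,3,4,5), of p]
  by simp

lemmas three_form_simps = three_form_add1 three_form_add2 three_form_add3
  three_form_scale1 three_form_scale2 three_form_scale3

lemma is_three_form_zero: "is_three_form A (\<lambda>X Y Z p. 0)"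
  by (simp add: is_three_form_def smooth_fun_const)

definition is_two_form :: "('m, 'e) two_form \<Rightarrow> bool" where
  "is_two_form \<omega> \<longleftrightarrow> (\<forall>X Y. smooth_vf A X \<and> smooth_vf A Y \<longrightarrow>
     smooth_fun A (\<omega> X Y) \<and>
     (\<forall>X'. smooth_vf A X' \<longrightarrow> \<omega> (\<lambda>p. X p + X' p) Y = (\<lambda>p. \<omega> X Y p + \<omega> X' Y p)) \<and>
     (\<forall>f. smooth_fun A f \<longrightarrow> \<omega> (\<lambda>p. f p *\<^sub>R X p) Y = (\<lambda>p. f p * \<omega> X Y p)) \<and>
     \<omega> Y X = (\<lambda>p. - \<omega> X Y p))"

lemma two_form_smooth: "is_two_form \<omega> \<Longrightarrow> smooth_vf A X \<Longrightarrow> smooth_vf A Y \<Longrightarrow> smooth_fun A (\<omega> X Y)"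
  and two_form_swap: "is_two_form \<omega> \<Longrightarrow> smooth_vf A X \<Longrightarrow> smooth_vf A Y \<Longrightarrow> \<omega> Y X = (\<lambda>p. - \<omega> X Y p)"
  and two_form_add1: "is_two_form \<omega> \<Longrightarrow> smooth_vf A X \<Longrightarrow> smooth_vf A X' \<Longrightarrow> smooth_vf A Y \<Longrightarrow>
    \<omega> (\<lambda>p. X p + X' p) Y = (\<lambda>p. \<omega> X Y p + \<omega> X' Y p)"
  and two_form_scale1: "is_two_form \<omega> \<Longrightarrow> smooth_fun A f \<Longrightarrow> smooth_vf A X \<Longrightarrow> smooth_vf A Y \<Longrightarrow>
    \<omega> (\<lambda>p. f p *\<^sub>R X p) Y = (\<lambda>p. f p * \<omega> X Y p)"
  unfolding is_two_form_def by blast+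

lemma two_form_minus1:
  assumes "is_two_form \<omega>" "smooth_vf A X" "smooth_vf A Y"
  shows "\<omega> (\<lambda>p. - X p) Y = (\<lambda>p. - \<omega> X Y p)"
  using two_form_scale1[OF assms(1) smooth_fun_const[of "-1"] assms(2,3)] by simp

lemma two_form_bracket_swap:
  assumes "is_two_form \<omega>" "smooth_vf A X" "smooth_vf A Y" "smooth_vf A Z"
  shows "\<omega> (lie_bracket A Y X) Z p = - \<omega> (lie_bracket A X Y) Z p"
proof -
  have "lie_bracket A Y X = (\<lambda>p. - lie_bracket A X Y p)" by (rule ext) (rule lie_bracket_skew)
  then show ?thesis
    using two_form_minus1[OF assms(1) smooth_lie_bracket[OF assms(2,3)] assms(4)] by simp
qed

lemma is_three_formI:
  assumes "\<And>X Y Z. smooth_vf A X \<Longrightarrow> smooth_vf A Y \<Longrightarrow> smooth_vf A Z \<Longrightarrow> smooth_fun A (B X Y Z)"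
    and "\<And>X X' Y Z p. smooth_vf A X \<Longrightarrow> smooth_vf A X' \<Longrightarrow> smooth_vf A Y \<Longrightarrow> smooth_vf A Z \<Longrightarrow>
      B (\<lambda>p. X p + X' p) Y Z p = B X Y Z p + B X' Y Z p"
    and "\<And>X f Y Z p. smooth_vf A X \<Longrightarrow> smooth_fun A f \<Longrightarrow> smooth_vf A Y \<Longrightarrow> smooth_vf A Z \<Longrightarrow>
      B (\<lambda>p. f p *\<^sub>R X p) Y Z p = f p * B X Y Z p"
    and "\<And>X Y Z p. smooth_vf A X \<Longrightarrow> smooth_vf A Y \<Longrightarrow> smooth_vf A Z \<Longrightarrow> B Y X Z p = - B X Y Z p"
    and "\<And>X Y Z p. smooth_vf A X \<Longrightarrow> smooth_vf A Y \<Longrightarrow> smooth_vf A Z \<Longrightarrow> B X Z Y p = - B X Y Z p"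
  shows "is_three_form A B"
  unfolding is_three_form_def
  by (intro allI impI conjI ext; (elim conjE)?) (rule assms; assumption)+

lemma is_three_form_diff:
  assumes B: "is_three_form A B" and C: "is_three_form A C"
  shows "is_three_form A (\<lambda>X Y Z p. B X Y Z p - C X Y Z p)"
proof (rule is_three_formI)
  fix X Y Z p assume v: "smooth_vf A X" "smooth_vf A Y" "smooth_vf A Z"
  show "smooth_fun A (\<lambda>p. B X Y Z p - C X Y Z p)"
    by (intro smooth_fun_diff three_form_smooth[OF B] three_form_smooth[OF C] v)
  show "B Y X Z p - C Y X Z p = - (B X Y Z p - C X Y Z p)"
    using three_form_swap12[OF B v, of p] three_form_swap12[OF C v, of p] by simp
  show "B X Z Y p - C X Z Y p = - (B X Y Z p - C X Y Z p)"
    using three_form_swap23[OF B v, of p] three_form_swap23[OF C v, of p] by simp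
qed (simp_all add: three_form_simps[OF B] three_form_simps[OF C] algebra_simps)

lemma is_three_form_add:
  "is_three_form A B \<Longrightarrow> is_three_form A C \<Longrightarrow> is_three_form A (\<lambda>X Y Z p. B X Y Z p + C X Y Z p)"
  using is_three_form_diff[of B, OF _ is_three_form_diff[OF is_three_form_zero, of C]] by simp

lemma is_three_form_sum: "(\<And>i. i \<in> I \<Longrightarrow> is_three_form A (B i)) \<Longrightarrow>
    is_three_form A (\<lambda>X Y Z p. \<Sum>i\<in>I. B i X Y Z p)"
  by (induction I rule: infinite_finite_induct) (auto simp: is_three_form_zero intro!: is_three_form_add)

lemma form_app_simps:
  assumes "smooth_one_form A \<alpha>"
  shows "form_app \<alpha> (\<lambda>p. X p + Y p) = (\<lambda>p. form_app \<alpha> X p + form_app \<alpha> Y p)"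
    and "form_app \<alpha> (\<lambda>p. X p - Y p) = (\<lambda>p. form_app \<alpha> X p - form_app \<alpha> Y p)"
    and "form_app \<alpha> (\<lambda>p. f p *\<^sub>R X p) = (\<lambda>p. f p * form_app \<alpha> X p)"
    and "form_app \<alpha> (\<lambda>p. - X p) = (\<lambda>p. - form_app \<alpha> X p)"
  using assms by (auto simp: form_app_def smooth_one_form_def linear_add linear_diff linear_scale linear_neg)

lemma is_three_form_wedge12:
  assumes \<alpha>: "smooth_one_form A \<alpha>" and \<omega>: "is_two_form \<omega>"
  shows "is_three_form A (wedge12 \<alpha> \<omega>)"
proof (rule is_three_formI)
  fix X Y Z assume v: "smooth_vf A X" "smooth_vf A Y" "smooth_vf A Z"
  show "smooth_fun A (wedge12 \<alpha> \<omega> X Y Z)"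
    unfolding wedge12_def
    by (intro smooth_fun_add smooth_fun_diff smooth_fun_mult smooth_form_app[OF \<alpha>] two_form_smooth[OF \<omega>] v)
  show "wedge12 \<alpha> \<omega> Y X Z p = - wedge12 \<alpha> \<omega> X Y Z p" for p
    by (simp add: wedge12_def two_form_swap[OF \<omega> v(1,2)])
  show "wedge12 \<alpha> \<omega> X Z Y p = - wedge12 \<alpha> \<omega> X Y Z p" for p
    by (simp add: wedge12_def two_form_swap[OF \<omega> v(2,3)])
next
  fix X X' Y Z p assume "smooth_vf A X" "smooth_vf A X'" "smooth_vf A Y" "smooth_vf A Z"
  then show "wedge12 \<alpha> \<omega> (\<lambda>p. X p + X' p) Y Z p = wedge12 \<alpha> \<omega> X Y Z p + wedge12 \<alpha> \<omega> X' Y Z p"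
    by (simp add: wedge12_def form_app_simps[OF \<alpha>] two_form_add1[OF \<omega>] algebra_simps)
next
  fix X f Y Z p assume "smooth_vf A X" "smooth_fun A f" "smooth_vf A Y" "smooth_vf A Z"
  then show "wedge12 \<alpha> \<omega> (\<lambda>p. f p *\<^sub>R X p) Y Z p = f p * wedge12 \<alpha> \<omega> X Y Z p"
    by (simp add: wedge12_def form_app_simps[OF \<alpha>] two_form_scale1[OF \<omega>] algebra_simps)
qed

lemma is_two_form_ext_deriv1:
  assumes \<alpha>: "smooth_one_form A \<alpha>"
  shows "is_two_form (ext_deriv1 A \<alpha>)"
  unfolding is_two_form_def
proof (intro allI impI conjI ext; (elim conjE)?)
  fix X Y assume v: "smooth_vf A X" "smooth_vf A Y"
  note s = v smooth_form_app[OF \<alpha>] smooth_dir_deriv smooth_lie_bracket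
  show "smooth_fun A (ext_deriv1 A \<alpha> X Y)"
    unfolding ext_deriv1_def by (intro smooth_fun_diff s)
  show "ext_deriv1 A \<alpha> Y X p = - ext_deriv1 A \<alpha> X Y p" for p
  proof -
    have "form_app \<alpha> (lie_bracket A Y X) p = - form_app \<alpha> (lie_bracket A X Y) p"
      using \<alpha> lie_bracket_skew[of Y X p]
      by (simp add: form_app_def smooth_one_form_def linear_neg)
    then show ?thesis by (simp add: ext_deriv1_def)
  qed
  show "ext_deriv1 A \<alpha> (\<lambda>p. X p + X' p) Y p = ext_deriv1 A \<alpha> X Y p + ext_deriv1 A \<alpha> X' Y p"
    if "smooth_vf A X'" for X' p
    using that by (simp add: ext_deriv1_def s form_app_simps[OF \<alpha>] lie_bracket_fun_simps dir_deriv_vf_add dir_deriv_add)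
  show "ext_deriv1 A \<alpha> (\<lambda>p. f p *\<^sub>R X p) Y p = f p * ext_deriv1 A \<alpha> X Y p"
    if "smooth_fun A f" for f p
    using that by (simp add: ext_deriv1_def s form_app_simps[OF \<alpha>] lie_bracket_fun_simps dir_deriv_vf_scale dir_deriv_mult
       algebra_simps)
qed

lemma is_two_form_contract3:
  assumes B: "is_three_form A B" and X: "smooth_vf A X"
  shows "is_two_form (contract3 X B)"
  unfolding is_two_form_def contract3_def
proof (intro allI impI conjI ext; (elim conjE)?)
  show "B X Z Y p = - B X Y Z p" if "smooth_vf A Y" "smooth_vf A Z" for Y Z p
    by (rule three_form_swap23[OF B X that])
qed (simp_all add: three_form_smooth[OF B] X three_form_add2[OF B] three_form_scale2[OF B])

text \<open>In the linearity over functions, the derivatives of \<open>f\<close> coming from the second and third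
  directional derivative cancel against those produced by the brackets with \<open>f X\<close>.\<close>

lemma is_three_form_ext_deriv2:
  assumes \<omega>: "is_two_form \<omega>"
  shows "is_three_form A (ext_deriv2 A \<omega>)"
proof (rule is_three_formI)
  fix X Y Z assume v: "smooth_vf A X" "smooth_vf A Y" "smooth_vf A Z"
  note s = v two_form_smooth[OF \<omega>] smooth_dir_deriv smooth_lie_bracket
  show "smooth_fun A (ext_deriv2 A \<omega> X Y Z)"
    unfolding ext_deriv2_def by (intro smooth_fun_diff smooth_fun_add s)
  show "ext_deriv2 A \<omega> Y X Z p = - ext_deriv2 A \<omega> X Y Z p" for p
    by (simp add: ext_deriv2_def two_form_swap[OF \<omega> v(1,2)] two_form_bracket_swap[OF \<omega> v] dir_deriv_minus s)
  show "ext_deriv2 A \<omega> X Z Y p = - ext_deriv2 A \<omega> X Y Z p" for p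
    by (simp add: ext_deriv2_def two_form_swap[OF \<omega> v(2,3)] two_form_bracket_swap[OF \<omega> v(2,3,1)] dir_deriv_minus s)
next
  fix X X' Y Z p assume v: "smooth_vf A X" "smooth_vf A X'" "smooth_vf A Y" "smooth_vf A Z"
  note s = v two_form_smooth[OF \<omega>] smooth_dir_deriv smooth_lie_bracket smooth_vf_add
  have "\<omega> (lie_bracket A Y Z) (\<lambda>p. X p + X' p) p = \<omega> (lie_bracket A Y Z) X p + \<omega> (lie_bracket A Y Z) X' p"
    using two_form_swap[OF \<omega> _ smooth_lie_bracket[OF v(3,4)]] two_form_add1[OF \<omega> v(1,2) smooth_lie_bracket[OF v(3,4)]]
    by (simp add: s)
  then show "ext_deriv2 A \<omega> (\<lambda>p. X p + X' p) Y Z p = ext_deriv2 A \<omega> X Y Z p + ext_deriv2 A \<omega> X' Y Z p"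
    by (simp add: ext_deriv2_def s lie_bracket_fun_simps dir_deriv_vf_add two_form_add1[OF \<omega>] dir_deriv_add)
next
  fix X f Y Z p assume v: "smooth_vf A X" "smooth_fun A f" "smooth_vf A Y" "smooth_vf A Z"
  note s = v two_form_smooth[OF \<omega>] smooth_dir_deriv smooth_lie_bracket smooth_vf_add smooth_vf_scale
  have 1: "\<omega> (lie_bracket A Y Z) (\<lambda>p. f p *\<^sub>R X p) p = f p * \<omega> (lie_bracket A Y Z) X p"
    using two_form_swap[OF \<omega> _ smooth_lie_bracket[OF v(3,4)]] two_form_scale1[OF \<omega> v(2,1) smooth_lie_bracket[OF v(3,4)]]
    by (simp add: s)
  have 2: "\<omega> (lie_bracket A (\<lambda>p. f p *\<^sub>R X p) U) V p = f p * \<omega> (lie_bracket A X U) V p - dir_deriv A U f p * \<omega> X V p"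
    if U: "smooth_vf A U" "smooth_vf A V" for U V
  proof -
    define h where "h = (\<lambda>p. - dir_deriv A U f p)"
    have h: "smooth_fun A h" unfolding h_def by (intro smooth_fun_minus smooth_dir_deriv U v)
    have "lie_bracket A (\<lambda>p. f p *\<^sub>R X p) U = (\<lambda>p. f p *\<^sub>R lie_bracket A X U p + h p *\<^sub>R X p)"
      using U v by (simp add: lie_bracket_fun_simps h_def)
    then have "\<omega> (lie_bracket A (\<lambda>p. f p *\<^sub>R X p) U) V p = f p * \<omega> (lie_bracket A X U) V p + h p * \<omega> X V p"
      by (simp add: two_form_add1[OF \<omega>] two_form_scale1[OF \<omega>] s U h)
    then show ?thesis by (simp add: h_def)
  qed
  have 3: "\<omega> Z X = (\<lambda>p. - \<omega> X Z p)" "\<omega> Y X = (\<lambda>p. - \<omega> X Y p)" by (intro two_form_swap[OF \<omega>] v)+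
  show "ext_deriv2 A \<omega> (\<lambda>p. f p *\<^sub>R X p) Y Z p = f p * ext_deriv2 A \<omega> X Y Z p"
    by (simp add: ext_deriv2_def s 1 2 3 dir_deriv_vf_scale two_form_scale1[OF \<omega>] dir_deriv_mult algebra_simps)
qed

end

section \<open>Riemannian metrics\<close>

locale riemannian_manifold = smooth_manifold A
  for A :: "('m::{t2_space, second_countable_topology}, 'e::euclidean_space) atlas" +
  fixes g :: "('m, 'e) bilinear_field"
  assumes metric: "riemannian_metric A g"
begin

lemma linear_g_left: "linear (\<lambda>u. g p u v)" and linear_g_right: "linear (g p u)"
  and g_sym: "g p u v = g p v u" and g_pos: "u \<noteq> 0 \<Longrightarrow> g p u u > 0"
  using metric by (auto simp: riemannian_metric_def bilinear_def)

lemmas g_simps = linear_add[OF linear_g_left] linear_add[OF linear_g_right]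
  linear_diff[OF linear_g_left] linear_diff[OF linear_g_right]
  linear_scale[OF linear_g_left] linear_scale[OF linear_g_right]
  linear_neg[OF linear_g_left] linear_neg[OF linear_g_right]
  linear_0[OF linear_g_left] linear_0[OF linear_g_right]
  linear_sum[OF linear_g_left] linear_sum[OF linear_g_right]

lemma g_nondegenerate:
  assumes "\<And>v. g p u v = g p u' v"
  shows "u = u'"
proof (rule ccontr)
  assume "u \<noteq> u'"
  then have "g p (u - u') (u - u') > 0" by (intro g_pos) simp
  moreover have "g p (u - u') (u - u') = 0" using assms[of "u - u'"] by (simp only: g_simps)
  ultimately show False by simp
qed

lemma vf_eqI_metric:
  assumes "\<And>Z. smooth_vf A Z \<Longrightarrow> g p u (Z p) = g p u' (Z p)"
  shows "u = u'"
proof (rule g_nondegenerate)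
  fix v
  obtain Z where "smooth_vf A Z" "Z p = v" by (rule exists_vf_through)
  then show "g p u v = g p u' v" using assms by blast
qed

text \<open>The representing field exists pointwise by nondegeneracy. In a local frame its components
  solve a linear system with smooth coefficients (the Gram matrix) and smooth right-hand side.\<close>

lemma covector_field_representation:
  assumes K: "covector_field K"
  obtains W where "smooth_vf A W" "\<And>Z p. smooth_vf A Z \<Longrightarrow> g p (W p) (Z p) = K Z p"
proof -
  have ex: "\<exists>w. \<forall>Z. smooth_vf A Z \<longrightarrow> g p w (Z p) = K Z p" for p
  proof -
    have "\<forall>v. \<exists>Z. smooth_vf A Z \<and> Z p = v" using exists_vf_through by metis
    then obtain ext where ext: "\<And>v. smooth_vf A (ext v)" "\<And>v. ext v p = v" by metis
    \<comment> \<open>the Gram operator: it turns \<open>g p\<close> into the inner product of the model space\<close>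
    define G where "G = (\<lambda>u. \<Sum>b\<in>Basis. g p u b *\<^sub>R (b::'e))"
    have Gb: "G u \<bullet> v = g p u v" for u v
    proof -
      have "G u \<bullet> v = (\<Sum>b\<in>Basis. (v \<bullet> b) *\<^sub>R g p u b)"
        unfolding G_def inner_sum_left by (intro sum.cong refl) (simp add: inner_commute)
      also have "\<dots> = g p u v" by (rule linear_expand[OF linear_g_right, symmetric])
      finally show ?thesis .
    qed
    have lin: "linear G"
      by (rule linearI) (simp_all add: G_def g_simps scaleR_add_left sum.distrib scaleR_sum_right)
    have "inj G"
    proof (rule injI)
      fix u u' assume "G u = G u'"
      then show "u = u'" by (intro g_nondegenerate[of p]) (metis Gb)
    qed
    then have "surj G" using linear_injective_imp_surjective[OF lin] by simp
    then obtain w where w: "G w = (\<Sum>b\<in>Basis. K (ext b) p *\<^sub>R b)" by (metis surjD)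
    have "g p w (Z p) = K Z p" if Z: "smooth_vf A Z" for Z
    proof -
      have s: "smooth_vf A (\<lambda>q. (Z p \<bullet> b) *\<^sub>R ext b q)" for b
        using smooth_vf_scale[OF smooth_fun_const ext(1)] .
      have "K Z p = K (\<lambda>q. \<Sum>b\<in>Basis. (Z p \<bullet> b) *\<^sub>R ext b q) p"
        by (rule covector_field_at[OF K Z smooth_vf_sum[OF s]])
          (simp add: ext euclidean_representation)
      also have "\<dots> = (\<Sum>b\<in>Basis. K (\<lambda>q. (Z p \<bullet> b) *\<^sub>R ext b q) p)"
        by (rule covector_field_sum[OF K finite_Basis s])
      also have "\<dots> = (\<Sum>b\<in>Basis. (Z p \<bullet> b) * K (ext b) p)"
        using K ext smooth_fun_const by (simp add: covector_field_def)
      also have "\<dots> = G w \<bullet> Z p"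
        unfolding w inner_sum_left by (intro sum.cong refl) (simp add: inner_commute)
      finally show ?thesis by (simp add: Gb)
    qed
    then show ?thesis by blast
  qed
  then obtain W where W: "\<And>Z p. smooth_vf A Z \<Longrightarrow> g p (W p) (Z p) = K Z p"
    by metis
  have "smooth_vf A W"
  proof (rule smooth_vf_localI)
    fix p
    define c where "c = chart_at A p"
    have c: "c \<in> A" "p \<in> chart_dom c" by (simp_all add: c_def chart_at)
    obtain E V where E: "\<And>b. smooth_vf A (E b)" and V: "open V" "p \<in> V" "V \<subseteq> chart_dom c"
      and EV: "\<And>b q. b \<in> Basis \<Longrightarrow> q \<in> V \<Longrightarrow> E b q = from_chart A c q b"
      by (rule local_frame[OF c]) blast
    define S where "S = chart_map c ` V"
    have S: "open S" "S \<subseteq> chart_range c" unfolding S_def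
      using V c open_chart_image by auto
    define gh where "gh = (\<lambda>x u v. g (chart_inv c x) (from_chart A c (chart_inv c x) u) (from_chart A c (chart_inv c x) v))"
    define G where "G = (\<lambda>x u. \<Sum>b\<in>Basis. gh x u b *\<^sub>R (b::'e))"
    have lin: "linear (from_chart A c (chart_inv c x))" if "x \<in> S" for x
      using that S linear_from_chart_inv[OF c(1)] by auto
    have ghl: "linear (\<lambda>u. gh x u v)" and ghr: "linear (gh x u)" if "x \<in> S" for x u v
      unfolding gh_def
      using linear_compose[OF lin[OF that] linear_g_left] linear_compose[OF lin[OF that] linear_g_right]
      by (simp_all add: o_def)
    have Gb: "G x u \<bullet> v = gh x u v" if "x \<in> S" for x u v
    proof -
      have "G x u \<bullet> v = (\<Sum>b\<in>Basis. (v \<bullet> b) *\<^sub>R gh x u b)"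
        unfolding G_def inner_sum_left by (intro sum.cong refl) (simp add: inner_commute)
      also have "\<dots> = gh x u v" by (rule linear_expand[OF ghr[OF that], symmetric])
      finally show ?thesis .
    qed
    have "smooth_on S (vf_rep A c W)"
    proof (rule smooth_on_linear_solve[OF S(1), where G = G])
      show "linear (G x)" if "x \<in> S" for x
        by (rule linearI) (simp_all add: G_def linear_add[OF ghl[OF that]] linear_scale[OF ghl[OF that]]
             scaleR_add_left sum.distrib scaleR_sum_right)
      show "inj (G x)" if x: "x \<in> S" for x
      proof (rule injI)
        fix u u' assume "G x u = G x u'"
        then have "gh x (u - u') (u - u') = 0"
          using Gb[OF x, of u "u - u'"] Gb[OF x, of u' "u - u'"] linear_diff[OF ghl[OF x]] by simp
        then have "from_chart A c (chart_inv c x) (u - u') = 0"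
          using g_pos unfolding gh_def by (metis less_irrefl)
        then have "to_chart A c (chart_inv c x) (from_chart A c (chart_inv c x) (u - u')) = 0"
          using linear_0[OF linear_to_chart[OF c(1) chart_inv_in[OF c(1)]]] x S by auto
        then show "u = u'"
          using to_from_chart[OF c(1) chart_inv_in[OF c(1)]] x S by auto
      qed
      have gs: "smooth_on S (\<lambda>x. gh x u v)" for u v
        by (rule smooth_on_subset[OF _ S(2)])
          (use metric c in \<open>auto simp: riemannian_metric_def gh_def Let_def\<close>)
      show "smooth_on S (\<lambda>x. G x u)" for u
        unfolding G_def by (intro smooth_on_sum smooth_on_scaleR gs smooth_on_const S)
      show "smooth_on S (\<lambda>x. \<Sum>b\<in>Basis. (K (E b) \<circ> chart_inv c) x *\<^sub>R b)"
        unfolding S_def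
        by (intro smooth_on_sum smooth_on_scaleR smooth_on_const smooth_fun_rep V c S(1)[unfolded S_def])
          (use K E in \<open>auto simp: covector_field_def\<close>)
      show "G x (vf_rep A c W x) = (\<Sum>b\<in>Basis. (K (E b) \<circ> chart_inv c) x *\<^sub>R b)" if x: "x \<in> S" for x
        unfolding G_def
      proof (rule sum.cong[OF refl])
        fix b :: 'e assume b: "b \<in> Basis"
        obtain q where q: "q \<in> V" "x = chart_map c q" using x by (auto simp: S_def)
        have "gh x (vf_rep A c W x) b = g q (W q) (E b q)"
          using q V c b EV by (simp add: gh_def vf_rep_map from_to_chart chart_inv_map subset_iff)
        also have "\<dots> = K (E b) q" by (rule W[OF E])
        finally show "gh x (vf_rep A c W x) b *\<^sub>R b = (K (E b) \<circ> chart_inv c) x *\<^sub>R b"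
          using q V c by (simp add: chart_inv_map subset_iff)
      qed
    qed
    then show "\<exists>c\<in>A. \<exists>U. open U \<and> p \<in> U \<and> U \<subseteq> chart_dom c \<and> smooth_on (chart_map c ` U) (vf_rep A c W)"
      using c V by (auto simp: S_def)
  qed
  with W show ?thesis using that by blast
qed

section \<open>Metric connections with prescribed skew torsion\<close>

lemma bil_app_sym: "bil_app g Y X = bil_app g X Y"
  by (simp add: bil_app_def g_sym)

lemma smooth_g: "smooth_vf A X \<Longrightarrow> smooth_vf A Y \<Longrightarrow> smooth_fun A (bil_app g X Y)"
  by (rule smooth_bil_app[OF metric])

lemma bil_app_simps:
  "bil_app g (\<lambda>p. X p + Y p) Z = (\<lambda>p. bil_app g X Z p + bil_app g Y Z p)"
  "bil_app g Z (\<lambda>p. X p + Y p) = (\<lambda>p. bil_app g Z X p + bil_app g Z Y p)"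
  "bil_app g (\<lambda>p. X p - Y p) Z = (\<lambda>p. bil_app g X Z p - bil_app g Y Z p)"
  "bil_app g Z (\<lambda>p. X p - Y p) = (\<lambda>p. bil_app g Z X p - bil_app g Z Y p)"
  "bil_app g (\<lambda>p. f p *\<^sub>R X p) Z = (\<lambda>p. f p * bil_app g X Z p)"
  "bil_app g Z (\<lambda>p. f p *\<^sub>R X p) = (\<lambda>p. f p * bil_app g Z X p)"
  by (auto simp: bil_app_def g_simps)

text \<open>The Koszul expression, corrected by half of a prescribed torsion 3-form.\<close>

definition koszul :: "('m, 'e) three_form \<Rightarrow> ('m, 'e) three_form" where
  "koszul T X Y Z = (\<lambda>p. (dir_deriv A X (bil_app g Y Z) p + dir_deriv A Y (bil_app g X Z) p
      - dir_deriv A Z (bil_app g X Y) p + bil_app g (lie_bracket A X Y) Z p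
      - bil_app g (lie_bracket A X Z) Y p - bil_app g (lie_bracket A Y Z) X p + T X Y Z p) / 2)"

lemmas koszul_simps = koszul_def bil_app_simps lie_bracket_fun_simps dir_deriv_vf_add dir_deriv_vf_scale
  dir_deriv_add dir_deriv_mult smooth_g smooth_lie_bracket smooth_vf_add smooth_vf_scale
  smooth_fun_add smooth_fun_mult smooth_dir_deriv

text \<open>Replacing \<open>Z\<close> by \<open>f Z\<close> produces derivatives of \<open>f\<close> along \<open>X\<close> and \<open>Y\<close>, which cancel in pairs by the
  symmetry of \<open>g\<close>.\<close>

lemma covector_field_koszul:
  assumes T: "is_three_form A T" and X: "smooth_vf A X" and Y: "smooth_vf A Y"
  shows "covector_field (koszul T X Y)"
proof -
  have "smooth_fun A (koszul T X Y Z)" if Z: "smooth_vf A Z" for Z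
    unfolding koszul_def divide_inverse
    by (intro smooth_fun_mult smooth_fun_const smooth_fun_add smooth_fun_diff smooth_dir_deriv smooth_g
        smooth_lie_bracket three_form_smooth[OF T] X Y Z)
  moreover have "koszul T X Y (\<lambda>p. Z p + Z' p) p = koszul T X Y Z p + koszul T X Y Z' p"
    if "smooth_vf A Z" "smooth_vf A Z'" for Z Z' p
    using that X Y by (simp add: koszul_simps three_form_simps[OF T] field_simps)
  moreover have "koszul T X Y (\<lambda>p. f p *\<^sub>R Z p) p = f p * koszul T X Y Z p"
    if "smooth_fun A f" "smooth_vf A Z" for f Z p
    using that X Y by (simp add: koszul_simps three_form_simps[OF T] bil_app_sym[of Z Y] bil_app_sym[of Z X] field_simps)
  ultimately show ?thesis by (simp add: covector_field_def)
qed

text \<open>The usual Koszul computation. Compatibility with \<open>g\<close> is used for three cyclically permuted triples;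
  the antisymmetric parts of the connection are replaced by brackets and torsion, and skew-symmetry
  collapses the three torsion terms to a single one.\<close>

lemma metric_connection_koszul:
  assumes D: "metric_connection A g D" and T: "\<And>X Y Z. smooth_vf A X \<Longrightarrow> smooth_vf A Y \<Longrightarrow> smooth_vf A Z
      \<Longrightarrow> torsion3 A g D X Y Z = T X Y Z" and skew: "is_three_form A T"
    and XYZ: "smooth_vf A X" "smooth_vf A Y" "smooth_vf A Z"
  shows "bil_app g (D X Y) Z p = koszul T X Y Z p"
proof -
  have m: "dir_deriv A X (bil_app g Y Z) p = bil_app g (D X Y) Z p + bil_app g (D X Z) Y p"
    if "smooth_vf A X" "smooth_vf A Y" "smooth_vf A Z" for X Y Z
  proof -
    have "nabla_metric A D g X Y Z p = 0"
      using D that unfolding metric_connection_def by metis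
    then show ?thesis by (simp add: nabla_metric_def bil_app_sym[of "D X Z" Y])
  qed
  have t: "bil_app g (D X Y) Z p - bil_app g (D Y X) Z p - bil_app g (lie_bracket A X Y) Z p = T X Y Z p"
    if "smooth_vf A X" "smooth_vf A Y" "smooth_vf A Z" for X Y Z
    using T[OF that] by (simp add: torsion3_def torsion_def bil_app_simps fun_eq_iff)
  show ?thesis
    using m[OF XYZ(1,2,3)] m[OF XYZ(2,1,3)] m[OF XYZ(3,1,2)]
      t[OF XYZ(1,2,3)] t[OF XYZ(1,3,2)] t[OF XYZ(2,3,1)]
      three_form_swap23[OF skew XYZ, of p] three_form_cycle[OF skew XYZ, of p]
    by (simp add: koszul_def)
qed

text \<open>The connection represented by the Koszul expression. The value outside smooth fields is
  the one that \<open>affine_connection\<close> requires.\<close>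

definition skew_connection :: "('m, 'e) three_form \<Rightarrow> ('m, 'e) connection" where
  "skew_connection T X Y = (if smooth_vf A X \<and> smooth_vf A Y
     then (SOME W. smooth_vf A W \<and> (\<forall>Z p. smooth_vf A Z \<longrightarrow> g p (W p) (Z p) = koszul T X Y Z p))
     else (\<lambda>_. 0))"

lemma skew_connection:
  assumes T: "is_three_form A T" and X: "smooth_vf A X" and Y: "smooth_vf A Y"
  shows "smooth_vf A (skew_connection T X Y)"
    and "smooth_vf A Z \<Longrightarrow> bil_app g (skew_connection T X Y) Z = koszul T X Y Z"
    and "smooth_vf A Z \<Longrightarrow> g p (skew_connection T X Y p) (Z p) = koszul T X Y Z p"
proof -
  have "\<exists>W. smooth_vf A W \<and> (\<forall>Z p. smooth_vf A Z \<longrightarrow> g p (W p) (Z p) = koszul T X Y Z p)"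
    by (rule covector_field_representation[OF covector_field_koszul[OF assms]]) blast
  from someI_ex[OF this]
  have *: "smooth_vf A (skew_connection T X Y) \<and>
     (\<forall>Z p. smooth_vf A Z \<longrightarrow> g p (skew_connection T X Y p) (Z p) = koszul T X Y Z p)"
    using X Y by (simp add: skew_connection_def)
  then show "smooth_vf A (skew_connection T X Y)" by blast
  show "smooth_vf A Z \<Longrightarrow> bil_app g (skew_connection T X Y) Z = koszul T X Y Z"
    and "smooth_vf A Z \<Longrightarrow> g p (skew_connection T X Y p) (Z p) = koszul T X Y Z p"
    using * by (auto simp: bil_app_def)
qed

text \<open>Each axiom is tested by pairing with smooth fields, where it becomes an identity for the Koszul
  expression.\<close>

lemma metric_connection_skew_connection:
  assumes T: "is_three_form A T"
  shows "metric_connection A g (skew_connection T)"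
  unfolding metric_connection_def affine_connection_def
proof (intro conjI allI impI; (elim conjE)?)
  fix X X' Y assume v: "smooth_vf A X" "smooth_vf A X'" "smooth_vf A Y"
  show "skew_connection T (\<lambda>p. X p + X' p) Y = (\<lambda>p. skew_connection T X Y p + skew_connection T X' Y p)"
  proof (intro ext vf_eqI_metric)
    fix p Z assume Z: "smooth_vf A Z"
    show "g p (skew_connection T (\<lambda>p. X p + X' p) Y p) (Z p)
        = g p (skew_connection T X Y p + skew_connection T X' Y p) (Z p)"
      using v Z by (simp add: skew_connection(3)[OF T] g_simps smooth_vf_add)
        (simp add: koszul_simps three_form_simps[OF T] field_simps)
  qed
next
  fix X Y Y' assume v: "smooth_vf A X" "smooth_vf A Y" "smooth_vf A Y'"
  show "skew_connection T X (\<lambda>p. Y p + Y' p) = (\<lambda>p. skew_connection T X Y p + skew_connection T X Y' p)"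
  proof (intro ext vf_eqI_metric)
    fix p Z assume Z: "smooth_vf A Z"
    show "g p (skew_connection T X (\<lambda>p. Y p + Y' p) p) (Z p)
        = g p (skew_connection T X Y p + skew_connection T X Y' p) (Z p)"
      using v Z by (simp add: skew_connection(3)[OF T] g_simps smooth_vf_add)
        (simp add: koszul_simps three_form_simps[OF T] field_simps)
  qed
next
  fix f X Y assume v: "smooth_fun A f" "smooth_vf A X" "smooth_vf A Y"
  show "skew_connection T (\<lambda>p. f p *\<^sub>R X p) Y = (\<lambda>p. f p *\<^sub>R skew_connection T X Y p)"
  proof (intro ext vf_eqI_metric)
    fix p Z assume Z: "smooth_vf A Z"
    show "g p (skew_connection T (\<lambda>p. f p *\<^sub>R X p) Y p) (Z p) = g p (f p *\<^sub>R skew_connection T X Y p) (Z p)"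
      using v Z by (simp add: skew_connection(3)[OF T] g_simps smooth_vf_scale)
        (simp add: koszul_simps three_form_simps[OF T] bil_app_sym[of Y X] bil_app_sym[of Z X] field_simps)
  qed
next
  fix f X Y assume v: "smooth_fun A f" "smooth_vf A X" "smooth_vf A Y"
  show "skew_connection T X (\<lambda>p. f p *\<^sub>R Y p) = (\<lambda>p. f p *\<^sub>R skew_connection T X Y p + dir_deriv A X f p *\<^sub>R Y p)"
  proof (intro ext vf_eqI_metric)
    fix p Z assume Z: "smooth_vf A Z"
    show "g p (skew_connection T X (\<lambda>p. f p *\<^sub>R Y p) p) (Z p)
       = g p (f p *\<^sub>R skew_connection T X Y p + dir_deriv A X f p *\<^sub>R Y p) (Z p)"
      using v Z by (simp add: skew_connection(3)[OF T] g_simps smooth_vf_scale)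
        (simp add: koszul_simps three_form_simps[OF T] bil_app_sym[of Y X] fun_cong[OF bil_app_def[of g Y Z], symmetric]
          field_simps)
  qed
next
  fix X Y Z assume v: "smooth_vf A X" "smooth_vf A Y" "smooth_vf A Z"
  show "nabla_metric A (skew_connection T) g X Y Z = (\<lambda>_. 0)"
  proof
    fix p
    have "nabla_metric A (skew_connection T) g X Y Z p
        = dir_deriv A X (bil_app g Y Z) p - koszul T X Y Z p - koszul T X Z Y p"
      using v by (simp add: nabla_metric_def bil_app_sym[of Y "skew_connection T X Z"] skew_connection(2)[OF T])
    also have "\<dots> = 0"
      using three_form_swap23[OF T v, of p] lie_bracket_skew[of Y Z p]
      by (simp add: koszul_def bil_app_sym[of Z Y] bil_app_sym[of Z X] bil_app_sym[of Y X]
          bil_app_def[of g "lie_bracket A Z Y"] bil_app_def[of g "lie_bracket A Y Z"] g_simps field_simps)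
    finally show "nabla_metric A (skew_connection T) g X Y Z p = 0" .
  qed
next
  fix X Y assume "\<not> (smooth_vf A X \<and> smooth_vf A Y)"
  then show "skew_connection T X Y = (\<lambda>_. 0)" by (auto simp: skew_connection_def)
qed (rule skew_connection(1)[OF T])

lemma torsion3_skew_connection:
  assumes T: "is_three_form A T" and v: "smooth_vf A X" "smooth_vf A Y" "smooth_vf A Z"
  shows "torsion3 A g (skew_connection T) X Y Z = T X Y Z"
proof
  fix p
  have "bil_app g (lie_bracket A Y X) Z p = - bil_app g (lie_bracket A X Y) Z p"
    by (simp add: bil_app_def lie_bracket_skew[of Y X] g_simps)
  then show "torsion3 A g (skew_connection T) X Y Z p = T X Y Z p"
    using v three_form_swap12[OF T v, of p]
    by (simp add: torsion3_def torsion_def bil_app_simps skew_connection(2)[OF T])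
      (simp add: koszul_def bil_app_sym field_simps)
qed

lemma metric_connection_eqI:
  assumes D: "metric_connection A g D" "metric_connection A g D'" and T: "is_three_form A T"
    and t: "\<And>X Y Z. smooth_vf A X \<Longrightarrow> smooth_vf A Y \<Longrightarrow> smooth_vf A Z \<Longrightarrow> torsion3 A g D X Y Z = T X Y Z"
    and t': "\<And>X Y Z. smooth_vf A X \<Longrightarrow> smooth_vf A Y \<Longrightarrow> smooth_vf A Z \<Longrightarrow> torsion3 A g D' X Y Z = T X Y Z"
  shows "D = D'"
proof (intro ext)
  fix X Y p
  show "D X Y p = D' X Y p"
  proof (cases "smooth_vf A X \<and> smooth_vf A Y")
    case True
    show ?thesis
    proof (rule vf_eqI_metric)
      fix Z assume "smooth_vf A Z"
      then show "g p (D X Y p) (Z p) = g p (D' X Y p) (Z p)"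
        using metric_connection_koszul[OF D(1) t T, of X Y Z p] metric_connection_koszul[OF D(2) t' T, of X Y Z p] True
        by (simp add: bil_app_def)
    qed
  next
    case False
    then show ?thesis
      using D unfolding metric_connection_def affine_connection_def by metis
  qed
qed

lemma levi_civita_eq: "levi_civita A g = skew_connection (\<lambda>X Y Z p. 0)"
  unfolding levi_civita_def
proof (rule the_equality)
  have *: "torsion A D X Y = (\<lambda>_. 0) \<longleftrightarrow> (\<forall>Z. smooth_vf A Z \<longrightarrow> torsion3 A g D X Y Z = (\<lambda>p. 0))" for D X Y
  proof
    assume "\<forall>Z. smooth_vf A Z \<longrightarrow> torsion3 A g D X Y Z = (\<lambda>p. 0)"
    then have "torsion A D X Y p = 0" for p
      by (intro vf_eqI_metric[of p]) (simp add: torsion3_def bil_app_def g_simps fun_eq_iff)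
    then show "torsion A D X Y = (\<lambda>_. 0)" by auto
  qed (simp add: torsion3_def bil_app_def g_simps)
  show "metric_connection A g (skew_connection (\<lambda>X Y Z p. 0)) \<and>
    (\<forall>X Y. smooth_vf A X \<and> smooth_vf A Y \<longrightarrow> torsion A (skew_connection (\<lambda>X Y Z p. 0)) X Y = (\<lambda>_. 0))"
    using metric_connection_skew_connection[OF is_three_form_zero] torsion3_skew_connection[OF is_three_form_zero]
    by (simp add: *)
  show "D = skew_connection (\<lambda>X Y Z p. 0)" if "metric_connection A g D \<and>
    (\<forall>X Y. smooth_vf A X \<and> smooth_vf A Y \<longrightarrow> torsion A D X Y = (\<lambda>_. 0))" for D
    by (rule metric_connection_eqI[OF _ _ is_three_form_zero])
      (use that metric_connection_skew_connection[OF is_three_form_zero]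
        torsion3_skew_connection[OF is_three_form_zero] in \<open>auto simp: *\<close>)
qed

end

section \<open>Metric f-structures\<close>

text \<open>The index set \<open>{1..s}\<close> is kept by the simplifier in the form in which the definitions have it.\<close>

declare One_nat_def [simp del] atLeastAtMost_iff [simp del]

locale metric_f_structure =
  fixes A :: "('m::{t2_space, second_countable_topology}, 'e::euclidean_space) atlas"
    and n s :: nat
    and \<phi> :: "('m, 'e) endo_field"
    and \<xi> :: "nat \<Rightarrow> ('m, 'e) vector_field"
    and \<eta> :: "nat \<Rightarrow> ('m, 'e) one_form"
    and g :: "('m, 'e) bilinear_field"
  assumes f_manifold: "metric_f_manifold A n s \<phi> \<xi> \<eta> g"

sublocale metric_f_structure \<subseteq> riemannian_manifold A g
  using f_manifold
  by unfold_locales (simp_all add: metric_f_manifold_def smooth_connected_manifold_def)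

context metric_f_structure
begin

abbreviation \<Phi> :: "('m, 'e) vector_field \<Rightarrow> ('m, 'e) vector_field" where
  "\<Phi> \<equiv> endo_app \<phi>"

abbreviation N3 :: "('m, 'e) three_form" where
  "N3 \<equiv> nijenhuis1_form A s \<phi> \<xi> \<eta> g"

lemma \<Phi>_at: "\<Phi> X p = \<phi> p (X p)"
  by (simp add: endo_app_def)

lemma smooth_endo_\<phi>: "smooth_endo A \<phi>"
  and smooth_vf_\<xi>: "i \<in> {1..s} \<Longrightarrow> smooth_vf A (\<xi> i)"
  and smooth_one_form_\<eta>: "i \<in> {1..s} \<Longrightarrow> smooth_one_form A (\<eta> i)"
  and \<eta>_\<xi>: "i \<in> {1..s} \<Longrightarrow> j \<in> {1..s} \<Longrightarrow> \<eta> i p (\<xi> j p) = (if i = j then 1 else 0)"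
  and \<eta>_\<phi>: "i \<in> {1..s} \<Longrightarrow> \<eta> i p (\<phi> p v) = 0"
  and \<phi>_\<phi>: "\<phi> p (\<phi> p v) = - v + (\<Sum>i=1..s. \<eta> i p v *\<^sub>R \<xi> i p)"
  and g_\<phi>_\<phi>: "g p (\<phi> p u) (\<phi> p v) = g p u v - (\<Sum>i=1..s. \<eta> i p u * \<eta> i p v)"
  using f_manifold unfolding metric_f_manifold_def by auto

lemma \<phi>_\<xi>: "i \<in> {1..s} \<Longrightarrow> \<phi> p (\<xi> i p) = 0"
proof -
  assume "i \<in> {1..s}"
  then have "\<xi> i p \<in> span ((\<lambda>i. \<xi> i p) ` {1..s})" by (intro span_base) auto
  then show ?thesis using f_manifold unfolding metric_f_manifold_def by blast
qed

lemma linear_\<phi>: "linear (\<phi> p)"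
  using smooth_endo_\<phi> by (simp add: smooth_endo_def)

lemma linear_\<eta>: "i \<in> {1..s} \<Longrightarrow> linear (\<eta> i p)"
  using smooth_one_form_\<eta>[of i] by (simp add: smooth_one_form_def)

lemmas \<phi>_simps = linear_add[OF linear_\<phi>] linear_diff[OF linear_\<phi>] linear_scale[OF linear_\<phi>]
  linear_neg[OF linear_\<phi>] linear_0[OF linear_\<phi>] linear_sum[OF linear_\<phi>]

text \<open>The metric identifies \<open>\<eta> i\<close> with \<open>\<xi> i\<close>, as one sees by inserting \<open>\<xi> i\<close> into the compatibility
  condition; the same condition makes \<open>\<phi>\<close> skew-adjoint.\<close>

lemma \<eta>_eq_g:
  assumes i: "i \<in> {1..s}"
  shows "\<eta> i p u = g p u (\<xi> i p)"
proof -
  have "0 = g p (\<phi> p u) (\<phi> p (\<xi> i p))" by (simp add: \<phi>_\<xi>[OF i] g_simps)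
  also have "\<dots> = g p u (\<xi> i p) - (\<Sum>j=1..s. \<eta> j p u * \<eta> j p (\<xi> i p))" by (rule g_\<phi>_\<phi>)
  also have "(\<Sum>j=1..s. \<eta> j p u * \<eta> j p (\<xi> i p)) = (\<Sum>j=1..s. if j = i then \<eta> j p u else 0)"
    using i by (intro sum.cong) (auto simp: \<eta>_\<xi>)
  also have "\<dots> = \<eta> i p u" using i by (simp add: sum.delta)
  finally show ?thesis by simp
qed

lemma g_\<phi>_skew: "g p (\<phi> p u) v = - g p u (\<phi> p v)"
proof -
  have "g p u (\<phi> p v) = g p (\<phi> p u) (\<phi> p (\<phi> p v)) + (\<Sum>i=1..s. \<eta> i p u * \<eta> i p (\<phi> p v))"
    using g_\<phi>_\<phi>[of p u "\<phi> p v"] by simp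
  also have "(\<Sum>i=1..s. \<eta> i p u * \<eta> i p (\<phi> p v)) = 0" by (simp add: \<eta>_\<phi>)
  also have "g p (\<phi> p u) (\<phi> p (\<phi> p v)) = - g p (\<phi> p u) v + (\<Sum>i=1..s. \<eta> i p v * g p (\<phi> p u) (\<xi> i p))"
    by (simp add: \<phi>_\<phi> g_simps)
  also have "(\<Sum>i=1..s. \<eta> i p v * g p (\<phi> p u) (\<xi> i p)) = 0"
    by (simp add: \<eta>_eq_g[symmetric] \<eta>_\<phi>)
  finally show ?thesis by simp
qed

lemma smooth_\<Phi>: "smooth_vf A X \<Longrightarrow> smooth_vf A (\<Phi> X)"
  by (rule smooth_endo_app[OF smooth_endo_\<phi>])

lemma smooth_\<eta>: "i \<in> {1..s} \<Longrightarrow> smooth_vf A X \<Longrightarrow> smooth_fun A (form_app (\<eta> i) X)"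
  by (rule smooth_form_app[OF smooth_one_form_\<eta>])

lemma form_app_\<eta>: "i \<in> {1..s} \<Longrightarrow> form_app (\<eta> i) X = bil_app g X (\<xi> i)"
  by (simp add: form_app_def bil_app_def \<eta>_eq_g)

lemma form_app_\<eta>_\<Phi>: "i \<in> {1..s} \<Longrightarrow> form_app (\<eta> i) (\<Phi> X) = (\<lambda>_. 0)"
  by (simp add: form_app_def endo_app_def \<eta>_\<phi>)

lemma form_app_\<eta>_\<xi>: "i \<in> {1..s} \<Longrightarrow> j \<in> {1..s} \<Longrightarrow> form_app (\<eta> i) (\<xi> j) = (\<lambda>_. if i = j then 1 else 0)"
  by (simp add: form_app_def \<eta>_\<xi>)

lemma \<Phi>_\<xi>: "i \<in> {1..s} \<Longrightarrow> \<Phi> (\<xi> i) = (\<lambda>_. 0)"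
  by (simp add: endo_app_def \<phi>_\<xi>)

lemma \<Phi>_\<Phi>_\<Phi>: "\<Phi> (\<Phi> (\<Phi> X)) = (\<lambda>p. - \<Phi> X p)"
  by (simp add: endo_app_def \<phi>_\<phi>[of _ "\<phi> _ _"] \<eta>_\<phi>)

lemma is_two_form_fundamental_form: "is_two_form (fundamental_form \<phi> g)"
  unfolding is_two_form_def fundamental_form_def
proof (intro allI impI conjI ext; (elim conjE)?)
  fix X Y assume v: "smooth_vf A X" "smooth_vf A Y"
  show "smooth_fun A (bil_app g X (\<Phi> Y))" by (intro smooth_g smooth_\<Phi> v)
  show "bil_app g Y (\<Phi> X) p = - bil_app g X (\<Phi> Y) p" for p
    using g_\<phi>_skew[of p "X p" "Y p"] by (simp add: bil_app_def endo_app_def g_sym[of p "Y p"])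
qed (simp_all add: bil_app_simps)

text \<open>The right-hand side of the torsion formula, prescribed below as the torsion of a connection.\<close>

definition char_torsion :: "('m, 'e) three_form" where
  "char_torsion X Y Z p = (\<Sum>i=1..s. wedge12 (\<eta> i) (ext_deriv1 A (\<eta> i)) X Y Z p)
     + d_phi_F A \<phi> g X Y Z p + N3 X Y Z p
     - (\<Sum>i=1..s. wedge12 (\<eta> i) (contract3 (\<xi> i) N3) X Y Z p)"

lemma is_three_form_d_phi_F: "is_three_form A (d_phi_F A \<phi> g)"
proof -
  note B = is_three_form_ext_deriv2[OF is_two_form_fundamental_form]
  have \<Phi>_add: "\<Phi> (\<lambda>p. X p + Y p) = (\<lambda>p. \<Phi> X p + \<Phi> Y p)"
    and \<Phi>_scale: "\<Phi> (\<lambda>p. f p *\<^sub>R X p) = (\<lambda>p. f p *\<^sub>R \<Phi> X p)" for X Y f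
    by (simp_all add: endo_app_def \<phi>_simps)
  show ?thesis
  proof (rule is_three_formI)
    fix X Y Z assume v: "smooth_vf A X" "smooth_vf A Y" "smooth_vf A Z"
    show "smooth_fun A (d_phi_F A \<phi> g X Y Z)"
      unfolding d_phi_F_def by (intro smooth_fun_minus three_form_smooth[OF B] smooth_\<Phi> v)
    show "d_phi_F A \<phi> g Y X Z p = - d_phi_F A \<phi> g X Y Z p" for p
      unfolding d_phi_F_def using three_form_swap12[OF B smooth_\<Phi>[OF v(1)] smooth_\<Phi>[OF v(2)] smooth_\<Phi>[OF v(3)], of p]
      by simp
    show "d_phi_F A \<phi> g X Z Y p = - d_phi_F A \<phi> g X Y Z p" for p
      unfolding d_phi_F_def using three_form_swap23[OF B smooth_\<Phi>[OF v(1)] smooth_\<Phi>[OF v(2)] smooth_\<Phi>[OF v(3)], of p]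
      by simp
  qed (simp_all add: d_phi_F_def \<Phi>_add \<Phi>_scale three_form_add1[OF B] three_form_scale1[OF B] smooth_\<Phi>)
qed

lemma is_three_form_char_torsion:
  assumes N: "is_three_form A N3"
  shows "is_three_form A char_torsion"
proof -
  have "is_three_form A (\<lambda>X Y Z p. (\<Sum>i=1..s. wedge12 (\<eta> i) (ext_deriv1 A (\<eta> i)) X Y Z p)
     + d_phi_F A \<phi> g X Y Z p + N3 X Y Z p
     - (\<Sum>i=1..s. wedge12 (\<eta> i) (contract3 (\<xi> i) N3) X Y Z p))"
    by (intro is_three_form_diff is_three_form_add is_three_form_sum is_three_form_wedge12
        is_two_form_ext_deriv1 is_two_form_contract3 is_three_form_d_phi_F N smooth_one_form_\<eta> smooth_vf_\<xi>)
  then show ?thesis by (simp add: char_torsion_def[abs_def])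
qed

lemma lie_bracket_zero: "lie_bracket A X (\<lambda>_. 0) p = 0" "lie_bracket A (\<lambda>_. 0) X p = 0"
  if "smooth_vf A X" for X p
  using lie_bracket_scale_right[OF that smooth_vf_zero smooth_fun_const[of 0], of p]
    lie_bracket_scale_left[OF smooth_vf_zero that smooth_fun_const[of 0], of p] by simp_all

end

section \<open>Connections for which the characteristic vector fields are parallel\<close>

text \<open>Such connections comprise the structure-preserving ones and also the connection that is constructed
  from the prescribed torsion, for which the parallelism of \<open>\<phi>\<close> is only to be derived. The tensor
  \<open>\<nu>\<close>, or \<open>S3\<close> with lowered index, is the derivative of \<open>\<phi>\<close>.\<close>

locale xi_parallel_connection = metric_f_structure A n s \<phi> \<xi> \<eta> g
  for A :: "('m::{t2_space, second_countable_topology}, 'e::euclidean_space) atlas" and n s \<phi> \<xi> \<eta> g +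
  fixes D :: "('m, 'e) connection"
  assumes D: "metric_connection A g D" and skew: "skew_torsion A g D"
    and D_\<xi>: "\<And>i X. i \<in> {1..s} \<Longrightarrow> smooth_vf A X \<Longrightarrow> D X (\<xi> i) = (\<lambda>_. 0)"
begin

lemma D_add1: "smooth_vf A X \<Longrightarrow> smooth_vf A X' \<Longrightarrow> smooth_vf A Y \<Longrightarrow>
    D (\<lambda>p. X p + X' p) Y = (\<lambda>p. D X Y p + D X' Y p)"
  and D_add2: "smooth_vf A X \<Longrightarrow> smooth_vf A Y \<Longrightarrow> smooth_vf A Y' \<Longrightarrow>
    D X (\<lambda>p. Y p + Y' p) = (\<lambda>p. D X Y p + D X Y' p)"
  and D_scale1: "smooth_fun A f \<Longrightarrow> smooth_vf A X \<Longrightarrow> smooth_vf A Y \<Longrightarrow>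
    D (\<lambda>p. f p *\<^sub>R X p) Y = (\<lambda>p. f p *\<^sub>R D X Y p)"
  and D_scale2: "smooth_fun A f \<Longrightarrow> smooth_vf A X \<Longrightarrow> smooth_vf A Y \<Longrightarrow>
    D X (\<lambda>p. f p *\<^sub>R Y p) = (\<lambda>p. f p *\<^sub>R D X Y p + dir_deriv A X f p *\<^sub>R Y p)"
  using D unfolding metric_connection_def affine_connection_def by blast+

lemma D_zero2: "smooth_vf A X \<Longrightarrow> D X (\<lambda>_. 0) = (\<lambda>_. 0)"
  using D_scale2[OF smooth_fun_const[of 0] _ smooth_vf_zero] by simp

lemma D_zero1: "smooth_vf A Y \<Longrightarrow> D (\<lambda>_. 0) Y = (\<lambda>_. 0)"
  using D_scale1[OF smooth_fun_const[of 0] smooth_vf_zero] by simp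

lemma D_minus2: "smooth_vf A X \<Longrightarrow> smooth_vf A Y \<Longrightarrow> D X (\<lambda>p. - Y p) = (\<lambda>p. - D X Y p)"
  using D_scale2[OF smooth_fun_const[of "-1"], of X Y] by simp

lemma D_minus1: "smooth_vf A X \<Longrightarrow> smooth_vf A Y \<Longrightarrow> D (\<lambda>p. - X p) Y = (\<lambda>p. - D X Y p)"
  using D_scale1[OF smooth_fun_const[of "-1"], of X Y] by simp

lemma D_sum2:
  assumes "smooth_vf A X" "\<And>i. i \<in> I \<Longrightarrow> smooth_vf A (Y i)"
  shows "D X (\<lambda>p. \<Sum>i\<in>I. Y i p) = (\<lambda>p. \<Sum>i\<in>I. D X (Y i) p)"
  using assms(2)
  by (induction I rule: infinite_finite_induct) (simp_all add: D_zero2 D_add2 smooth_vf_sum assms(1))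

lemma D_sum1:
  assumes "smooth_vf A Y" "\<And>i. i \<in> I \<Longrightarrow> smooth_vf A (X i)"
  shows "D (\<lambda>p. \<Sum>i\<in>I. X i p) Y = (\<lambda>p. \<Sum>i\<in>I. D (X i) Y p)"
  using assms(2)
  by (induction I rule: infinite_finite_induct) (simp_all add: D_zero1 D_add1 smooth_vf_sum assms(1))

lemma D_metric:
  assumes "smooth_vf A X" "smooth_vf A Y" "smooth_vf A Z"
  shows "dir_deriv A X (bil_app g Y Z) p = g p (D X Y p) (Z p) + g p (Y p) (D X Z p)"
proof -
  have "nabla_metric A D g X Y Z p = 0"
    using D assms unfolding metric_connection_def by metis
  then show ?thesis by (simp add: nabla_metric_def bil_app_def)
qed

abbreviation \<tau> :: "('m, 'e) vector_field \<Rightarrow> ('m, 'e) vector_field \<Rightarrow> ('m, 'e) vector_field" where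
  "\<tau> \<equiv> torsion A D"

abbreviation T3 :: "('m, 'e) three_form" where
  "T3 \<equiv> torsion3 A g D"

abbreviation \<nu> :: "('m, 'e) vector_field \<Rightarrow> ('m, 'e) vector_field \<Rightarrow> ('m, 'e) vector_field" where
  "\<nu> \<equiv> nabla_endo D \<phi>"

lemma T3_eq: "T3 X Y Z p = g p (\<tau> X Y p) (Z p)"
  by (simp add: torsion3_def bil_app_def)

lemma T3: "is_three_form A T3"
  using skew by (simp add: skew_torsion_def)

lemma bracket_D: "lie_bracket A X Y p = D X Y p - D Y X p - \<tau> X Y p"
  by (simp add: torsion_def)

lemma D_\<Phi>: "D X (\<Phi> Y) p = \<phi> p (D X Y p) + \<nu> X Y p"
  by (simp add: nabla_endo_def endo_app_def)

lemma D_form_app_\<eta>: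
  assumes "i \<in> {1..s}" "smooth_vf A X" "smooth_vf A Y"
  shows "dir_deriv A X (form_app (\<eta> i) Y) p = \<eta> i p (D X Y p)"
  using assms
  by (simp add: form_app_\<eta> D_metric smooth_vf_\<xi> D_\<xi> \<eta>_eq_g g_simps)

lemma nabla_form_\<eta>: "i \<in> {1..s} \<Longrightarrow> smooth_vf A X \<Longrightarrow> smooth_vf A Y \<Longrightarrow> nabla_form A D (\<eta> i) X Y = (\<lambda>_. 0)"
  by (auto simp: nabla_form_def D_form_app_\<eta>) (simp add: form_app_def)

text \<open>As \<open>\<eta> i\<close> is parallel, in \<open>d\<eta>\<close> only the torsion part of the bracket survives.\<close>

lemma ext_deriv1_\<eta>:
  assumes "i \<in> {1..s}" "smooth_vf A X" "smooth_vf A Y"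
  shows "ext_deriv1 A (\<eta> i) X Y p = \<eta> i p (\<tau> X Y p)"
  using assms
  by (simp add: ext_deriv1_def D_form_app_\<eta>)
    (simp add: form_app_def bracket_D linear_diff[OF linear_\<eta>])

lemma T3_\<xi>:
  assumes "i \<in> {1..s}" "smooth_vf A X" "smooth_vf A Y"
  shows "T3 X Y (\<xi> i) p = ext_deriv1 A (\<eta> i) X Y p" "T3 (\<xi> i) X Y p = ext_deriv1 A (\<eta> i) X Y p"
proof -
  show 1: "T3 X Y (\<xi> i) p = ext_deriv1 A (\<eta> i) X Y p"
    using assms by (simp add: T3_eq ext_deriv1_\<eta> \<eta>_eq_g)
  show "T3 (\<xi> i) X Y p = ext_deriv1 A (\<eta> i) X Y p"
    using three_form_cycle[OF T3 smooth_vf_\<xi>[OF assms(1)] assms(2,3), of p] 1 by simp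
qed

definition S3 :: "('m, 'e) three_form" where
  "S3 X Y Z p = g p (\<nu> X Y p) (Z p)"

text \<open>A metric connection differentiates the skew-adjoint field \<open>\<phi>\<close> to a skew-adjoint one.\<close>

lemma S3_skew:
  assumes v: "smooth_vf A X" "smooth_vf A Y" "smooth_vf A Z"
  shows "S3 X Y Z p = - S3 X Z Y p"
proof -
  have 1: "bil_app g (\<Phi> Z) Y = (\<lambda>p. - bil_app g (\<Phi> Y) Z p)"
  proof
    fix p
    show "bil_app g (\<Phi> Z) Y p = - bil_app g (\<Phi> Y) Z p"
      using g_\<phi>_skew[of p "Z p" "Y p"] g_sym[of p "Z p" "\<phi> p (Y p)"]
      by (simp add: bil_app_def endo_app_def)
  qed
  have "dir_deriv A X (bil_app g (\<Phi> Z) Y) p = - dir_deriv A X (bil_app g (\<Phi> Y) Z) p"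
    unfolding 1 by (intro dir_deriv_minus smooth_g smooth_\<Phi> v)
  then show ?thesis
    using v g_\<phi>_skew[of p "D X Y p" "Z p"] g_\<phi>_skew[of p "D X Z p" "Y p"]
      g_sym[of p "\<phi> p (Y p)" "D X Z p"] g_sym[of p "\<phi> p (Z p)" "D X Y p"]
    by (simp add: D_metric smooth_\<Phi> D_\<Phi> S3_def g_simps \<Phi>_at)
qed

lemma \<nu>_\<xi>: "i \<in> {1..s} \<Longrightarrow> smooth_vf A X \<Longrightarrow> \<nu> X (\<xi> i) p = 0"
  by (simp add: nabla_endo_def \<Phi>_\<xi> D_\<xi> D_zero2 \<Phi>_at \<phi>_simps)

lemma S3_\<xi>:
  assumes "i \<in> {1..s}" "smooth_vf A X" "smooth_vf A Y"
  shows "S3 X (\<xi> i) Y p = 0" "S3 X Y (\<xi> i) p = 0"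
proof -
  show 1: "S3 X (\<xi> i) Y p = 0" using assms by (simp add: S3_def \<nu>_\<xi> g_simps)
  show "S3 X Y (\<xi> i) p = 0"
    using S3_skew[OF assms(2,3) smooth_vf_\<xi>[OF assms(1)], of p] 1 by simp
qed

text \<open>Differentiating \<open>\<phi>\<^sup>2 = - Id + \<Sum> \<eta> \<otimes> \<xi>\<close>, whose right-hand side is parallel, shows that the derivative
  of \<open>\<phi>\<close> anticommutes with \<open>\<phi>\<close>.\<close>

lemma \<nu>_\<Phi>:
  assumes v: "smooth_vf A X" "smooth_vf A Y"
  shows "\<nu> X (\<Phi> Y) p = - \<phi> p (\<nu> X Y p)"
proof -
  have "\<Phi> (\<Phi> Y) = (\<lambda>p. - Y p + (\<Sum>i=1..s. form_app (\<eta> i) Y p *\<^sub>R \<xi> i p))"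
    by (simp add: endo_app_def \<phi>_\<phi> form_app_def)
  then have "D X (\<Phi> (\<Phi> Y)) p = - D X Y p + (\<Sum>i=1..s. \<eta> i p (D X Y p) *\<^sub>R \<xi> i p)"
    using v by (simp add: D_add2 smooth_vf_minus smooth_vf_sum smooth_vf_scale smooth_\<eta> smooth_vf_\<xi> D_minus2
        D_sum2 D_scale2 D_\<xi> D_form_app_\<eta> del: uminus_add_conv_diff)
  then have "D X (\<Phi> (\<Phi> Y)) p = \<phi> p (\<phi> p (D X Y p))" by (simp add: \<phi>_\<phi>)
  then show ?thesis by (simp add: nabla_endo_def[of D \<phi> X "\<Phi> Y"]) (simp add: \<Phi>_at D_\<Phi> \<phi>_simps)
qed

lemma S3_\<Phi>: "smooth_vf A X \<Longrightarrow> smooth_vf A Y \<Longrightarrow> S3 X (\<Phi> Y) Z p = S3 X Y (\<Phi> Z) p"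
  by (simp add: S3_def \<nu>_\<Phi> g_simps g_\<phi>_skew) (simp add: endo_app_def)

text \<open>For this and the next two lemmas every derivative and every bracket is expanded by the connection
  and its torsion. The derivatives of the fields cancel, and what remains is tensorial.\<close>

lemma ext_deriv2_F:
  assumes v: "smooth_vf A X" "smooth_vf A Y" "smooth_vf A Z"
  shows "ext_deriv2 A (fundamental_form \<phi> g) X Y Z p
     = T3 X Y (\<Phi> Z) p - T3 X Z (\<Phi> Y) p + T3 Y Z (\<Phi> X) p - (S3 X Y Z p + S3 Y Z X p + S3 Z X Y p)"
proof -
  have gf: "g p (U p) (\<phi> p w) = - g p w (\<phi> p (U p))" for U w
    using g_\<phi>_skew[of p "U p" w] by (simp add: g_sym)
  have s: "g p (Y p) (\<nu> X Z p) = - S3 X Y Z p" "g p (X p) (\<nu> Y Z p) = S3 Y Z X p" "g p (X p) (\<nu> Z Y p) = - S3 Z X Y p"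
    using S3_skew[OF v(1,3,2), of p] S3_skew[OF v(3,2,1), of p]
    by (simp_all add: S3_def g_sym[of p "Y p"] g_sym[of p "X p"])
  show ?thesis
    using v by (simp add: ext_deriv2_def fundamental_form_def D_metric smooth_\<Phi> D_\<Phi> g_simps s)
      (simp add: bil_app_def bracket_D T3_eq endo_app_def g_simps gf[of X] gf[of Y] gf[of Z])
qed

lemma nijenhuis_phi_torsion:
  assumes v: "smooth_vf A X" "smooth_vf A Y"
  shows "nijenhuis_phi A \<phi> X Y p
    = \<nu> (\<Phi> X) Y p - \<nu> (\<Phi> Y) X p - \<phi> p (\<nu> X Y p) + \<phi> p (\<nu> Y X p)
      - \<tau> (\<Phi> X) (\<Phi> Y) p - \<phi> p (\<phi> p (\<tau> X Y p)) + \<phi> p (\<tau> X (\<Phi> Y) p) + \<phi> p (\<tau> (\<Phi> X) Y p)"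
proof -
  have "\<Phi> (lie_bracket A U V) p = \<phi> p (D U V p - D V U p - \<tau> U V p)" for U V
    by (simp add: endo_app_def bracket_D)
  moreover have "\<Phi> (\<Phi> (lie_bracket A X Y)) p = \<phi> p (\<phi> p (D X Y p - D Y X p - \<tau> X Y p))"
    by (simp add: endo_app_def bracket_D)
  ultimately show ?thesis
    by (simp add: nijenhuis_phi_def bracket_D D_\<Phi> \<phi>_simps)
qed

text \<open>The \<open>\<xi>\<close>-part of \<open>\<phi>\<^sup>2\<close> applied to the torsion is exactly cancelled by the summands \<open>d\<eta> \<otimes> \<xi>\<close> of the
  Nijenhuis tensor.\<close>

lemma N3_torsion:
  assumes v: "smooth_vf A X" "smooth_vf A Y"
  shows "N3 X Y Z p = T3 X Y Z p - T3 (\<Phi> X) (\<Phi> Y) Z p - T3 X (\<Phi> Y) (\<Phi> Z) p - T3 (\<Phi> X) Y (\<Phi> Z) p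
     + S3 (\<Phi> X) Y Z p - S3 (\<Phi> Y) X Z p + S3 X Y (\<Phi> Z) p - S3 Y X (\<Phi> Z) p"
proof -
  have "nijenhuis1 A s \<phi> \<xi> \<eta> X Y p = nijenhuis_phi A \<phi> X Y p + (\<Sum>i=1..s. \<eta> i p (\<tau> X Y p) *\<^sub>R \<xi> i p)"
    using v by (simp add: nijenhuis1_def ext_deriv1_\<eta>)
  also have "\<dots> = \<nu> (\<Phi> X) Y p - \<nu> (\<Phi> Y) X p - \<phi> p (\<nu> X Y p) + \<phi> p (\<nu> Y X p)
      - \<tau> (\<Phi> X) (\<Phi> Y) p + \<tau> X Y p + \<phi> p (\<tau> X (\<Phi> Y) p) + \<phi> p (\<tau> (\<Phi> X) Y p)"
    by (simp add: nijenhuis_phi_torsion[OF v] \<phi>_\<phi>[of p "\<tau> X Y p"])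
  finally show ?thesis
    by (simp add: nijenhuis1_form_def bil_app_def T3_eq S3_def g_simps g_\<phi>_skew)
      (simp add: endo_app_def)
qed

lemma T3_\<Phi>\<Phi>:
  assumes "smooth_vf A X" "smooth_vf A Y"
  shows "T3 X Y (\<Phi> (\<Phi> Z)) p = - T3 X Y Z p + (\<Sum>i=1..s. form_app (\<eta> i) Z p * ext_deriv1 A (\<eta> i) X Y p)"
  using assms by (simp add: T3_eq \<Phi>_at \<phi>_\<phi> g_simps ext_deriv1_\<eta> form_app_def \<eta>_eq_g)

text \<open>Inserting \<open>\<phi>X, \<phi>Y, \<phi>Z\<close> into \<open>dF\<close> produces \<open>\<phi>\<^sup>2\<close> in one slot of the torsion; its \<open>\<xi>\<close>-part is responsible
  for the wedge products.\<close>

lemma d_phi_F_torsion: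
  assumes v: "smooth_vf A X" "smooth_vf A Y" "smooth_vf A Z"
  shows "d_phi_F A \<phi> g X Y Z p
    = T3 (\<Phi> X) (\<Phi> Y) Z p - T3 (\<Phi> X) (\<Phi> Z) Y p + T3 (\<Phi> Y) (\<Phi> Z) X p
      - (\<Sum>i=1..s. wedge12 (\<eta> i) (\<lambda>U V. ext_deriv1 A (\<eta> i) (\<Phi> U) (\<Phi> V)) X Y Z p)
      + (S3 (\<Phi> X) (\<Phi> Y) (\<Phi> Z) p + S3 (\<Phi> Y) (\<Phi> Z) (\<Phi> X) p + S3 (\<Phi> Z) (\<Phi> X) (\<Phi> Y) p)"
  using v by (simp add: d_phi_F_def ext_deriv2_F T3_\<Phi>\<Phi> smooth_\<Phi> wedge12_def sum.distrib sum_subtractf)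

lemma N3_\<xi>:
  assumes i: "i \<in> {1..s}" and v: "smooth_vf A Y" "smooth_vf A Z"
  shows "N3 (\<xi> i) Y Z p = ext_deriv1 A (\<eta> i) Y Z p - ext_deriv1 A (\<eta> i) (\<Phi> Y) (\<Phi> Z) p + S3 (\<xi> i) Y (\<Phi> Z) p"
    and "N3 Y Z (\<xi> i) p = ext_deriv1 A (\<eta> i) Y Z p - ext_deriv1 A (\<eta> i) (\<Phi> Y) (\<Phi> Z) p"
proof -
  have z: "T3 (\<lambda>_. 0) U V p = 0" "T3 U V (\<lambda>_. 0) p = 0" "S3 U V (\<lambda>_. 0) p = 0" "S3 (\<lambda>_. 0) U V p = 0"
    if "smooth_vf A U" "smooth_vf A V" for U V
    using three_form_scale1[OF T3 smooth_fun_const[of 0] smooth_vf_zero that, of p] that smooth_\<Phi>[of U]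
    by (simp_all add: T3_eq S3_def nabla_endo_def D_zero1 \<Phi>_at \<phi>_simps g_simps)
  show "N3 (\<xi> i) Y Z p = ext_deriv1 A (\<eta> i) Y Z p - ext_deriv1 A (\<eta> i) (\<Phi> Y) (\<Phi> Z) p + S3 (\<xi> i) Y (\<Phi> Z) p"
    using v by (simp add: N3_torsion smooth_vf_\<xi>[OF i] \<Phi>_\<xi>[OF i] z T3_\<xi>[OF i] S3_\<xi>[OF i] smooth_\<Phi>)
  show "N3 Y Z (\<xi> i) p = ext_deriv1 A (\<eta> i) Y Z p - ext_deriv1 A (\<eta> i) (\<Phi> Y) (\<Phi> Z) p"
    using v by (simp add: N3_torsion \<Phi>_\<xi>[OF i] z T3_\<xi>[OF i] S3_\<xi>[OF i] smooth_\<Phi>)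
qed

text \<open>With \<open>\<phi>\<close> parallel, \<open>d\<^sup>\<phi>F + N = T - \<Sum> \<eta>\<^sub>i \<and> (d\<eta>\<^sub>i \<circ> \<phi>)\<close> and \<open>\<xi>\<^sub>i \<lrcorner> N = d\<eta>\<^sub>i - d\<eta>\<^sub>i \<circ> \<phi>\<close>, so the two
  families of wedge products with \<open>d\<eta>\<^sub>i \<circ> \<phi>\<close> cancel.\<close>

lemma torsion_eq_char_torsion:
  assumes parallel: "\<And>X Y p. smooth_vf A X \<Longrightarrow> smooth_vf A Y \<Longrightarrow> \<nu> X Y p = 0"
    and v: "smooth_vf A X" "smooth_vf A Y" "smooth_vf A Z"
  shows "T3 X Y Z p = char_torsion X Y Z p"
proof -
  have S: "S3 U V W p = 0" if "smooth_vf A U" "smooth_vf A V" for U V W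
    using parallel[OF that] by (simp add: S3_def g_simps)
  have "(\<Sum>i=1..s. wedge12 (\<eta> i) (contract3 (\<xi> i) N3) X Y Z p)
      = (\<Sum>i=1..s. wedge12 (\<eta> i) (ext_deriv1 A (\<eta> i)) X Y Z p
          - wedge12 (\<eta> i) (\<lambda>U V. ext_deriv1 A (\<eta> i) (\<Phi> U) (\<Phi> V)) X Y Z p)"
  proof (rule sum.cong[OF refl])
    fix i assume i: "i \<in> {1..s}"
    show "wedge12 (\<eta> i) (contract3 (\<xi> i) N3) X Y Z p = wedge12 (\<eta> i) (ext_deriv1 A (\<eta> i)) X Y Z p
          - wedge12 (\<eta> i) (\<lambda>U V. ext_deriv1 A (\<eta> i) (\<Phi> U) (\<Phi> V)) X Y Z p"
      using v by (simp add: wedge12_def contract3_def N3_\<xi>(1)[OF i] S smooth_vf_\<xi>[OF i] smooth_\<Phi> algebra_simps)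
  qed
  then have w: "(\<Sum>i=1..s. wedge12 (\<eta> i) (contract3 (\<xi> i) N3) X Y Z p)
      = (\<Sum>i=1..s. wedge12 (\<eta> i) (ext_deriv1 A (\<eta> i)) X Y Z p)
        - (\<Sum>i=1..s. wedge12 (\<eta> i) (\<lambda>U V. ext_deriv1 A (\<eta> i) (\<Phi> U) (\<Phi> V)) X Y Z p)"
    by (simp only: sum_subtractf)
  have "char_torsion X Y Z p = T3 X Y Z p
      - T3 (\<Phi> X) (\<Phi> Z) Y p + T3 (\<Phi> Y) (\<Phi> Z) X p - T3 X (\<Phi> Y) (\<Phi> Z) p - T3 (\<Phi> X) Y (\<Phi> Z) p"
    using v by (simp add: char_torsion_def w d_phi_F_torsion N3_torsion S smooth_\<Phi>)
  also have "\<dots> = T3 X Y Z p"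
    using three_form_swap23[OF T3 smooth_\<Phi>[OF v(1)] v(2) smooth_\<Phi>[OF v(3)], of p]
      three_form_cycle[OF T3 v(1) smooth_\<Phi>[OF v(2)] smooth_\<Phi>[OF v(3)], of p] by simp
  finally show ?thesis by simp
qed

lemma S3_minus3: "S3 X Y (\<lambda>p. - Z p) p = - S3 X Y Z p"
  by (simp add: S3_def g_simps)

lemma \<nu>_linear1:
  assumes Y: "smooth_vf A Y"
  shows "smooth_vf A X \<Longrightarrow> smooth_vf A X' \<Longrightarrow> \<nu> (\<lambda>p. X p + X' p) Y p = \<nu> X Y p + \<nu> X' Y p"
    and "smooth_fun A f \<Longrightarrow> smooth_vf A X \<Longrightarrow> \<nu> (\<lambda>p. f p *\<^sub>R X p) Y p = f p *\<^sub>R \<nu> X Y p"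
    and "smooth_vf A X \<Longrightarrow> \<nu> (\<lambda>p. - X p) Y p = - \<nu> X Y p"
    and "(\<And>i. i \<in> I \<Longrightarrow> smooth_vf A (Z i)) \<Longrightarrow> \<nu> (\<lambda>p. \<Sum>i\<in>I. Z i p) Y p = (\<Sum>i\<in>I. \<nu> (Z i) Y p)"
  using Y
  by (simp_all add: nabla_endo_def D_add1 D_scale1 D_minus1 D_sum1 smooth_\<Phi> \<Phi>_at \<phi>_simps
      scaleR_diff_right sum_subtractf)

lemma S3_minus1: "smooth_vf A X \<Longrightarrow> smooth_vf A Y \<Longrightarrow> S3 (\<lambda>p. - X p) Y Z p = - S3 X Y Z p"
  by (simp add: S3_def \<nu>_linear1 g_simps)

lemma S3_\<Phi>\<Phi>:
  assumes "smooth_vf A X" "smooth_vf A Y"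
  shows "S3 X Y (\<Phi> (\<Phi> Z)) p = - S3 X Y Z p"
proof -
  have "S3 X Y (\<Phi> (\<Phi> Z)) p = - S3 X Y Z p + (\<Sum>i=1..s. \<eta> i p (Z p) * S3 X Y (\<xi> i) p)"
    by (simp add: S3_def \<Phi>_at \<phi>_\<phi> g_simps)
  also have "(\<Sum>i=1..s. \<eta> i p (Z p) * S3 X Y (\<xi> i) p) = 0"
    using assms by (intro sum.neutral ballI) (simp add: S3_\<xi>)
  finally show ?thesis by simp
qed

text \<open>On fields annihilated by all \<open>\<eta> i\<close>, such as \<open>\<phi>X\<close>, the prescribed torsion is \<open>d\<^sup>\<phi>F + N\<close>. When both
  summands are expressed by the torsion and \<open>S3\<close>, the torsion terms cancel and
  \<open>S3 X Y Z + S3 Y Z X = S3 Z X Y\<close> remains. The sum of two cyclic permutations of this identity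
  says that twice a value of \<open>S3\<close> is zero.\<close>

lemma S3_horizontal_eq_0:
  assumes T: "\<And>X Y Z p. smooth_vf A X \<Longrightarrow> smooth_vf A Y \<Longrightarrow> smooth_vf A Z \<Longrightarrow> T3 X Y Z p = char_torsion X Y Z p"
    and v: "smooth_vf A X" "smooth_vf A Y" "smooth_vf A Z"
  shows "S3 (\<Phi> X) (\<Phi> Y) (\<Phi> Z) p = 0"
proof -
  have 1: "S3 (\<Phi> X) (\<Phi> Y) (\<Phi> (\<Phi> Z)) p - S3 (\<Phi> Y) (\<Phi> X) (\<Phi> (\<Phi> Z)) p = S3 (\<Phi> (\<Phi> Z)) (\<Phi> X) (\<Phi> Y) p"
    if v: "smooth_vf A X" "smooth_vf A Y" "smooth_vf A Z" for X Y Z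
  proof -
    define x y z where xyz: "x = \<Phi> X" "y = \<Phi> Y" "z = \<Phi> Z"
    have s: "smooth_vf A x" "smooth_vf A y" "smooth_vf A z" using v by (simp_all add: xyz smooth_\<Phi>)
    \<comment> \<open>all wedge products with some \<open>\<eta> i\<close> vanish on the image of \<open>\<phi>\<close>\<close>
    have w: "(\<Sum>i=1..s. wedge12 (\<eta> i) (\<omega> i) x y z p) = 0" for \<omega>
      by (intro sum.neutral ballI) (simp add: wedge12_def xyz form_app_\<eta>_\<Phi>)
    have S: "S3 U (\<Phi> a) (\<Phi> b) p = - S3 U a b p" if "smooth_vf A U" "smooth_vf A a" for U a b
      using that by (simp add: S3_\<Phi> S3_\<Phi>\<Phi>)
    have "T3 x y z p = d_phi_F A \<phi> g x y z p + N3 x y z p"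
      unfolding T[OF s] by (simp add: char_torsion_def w)
    then show ?thesis
      using s three_form_swap23[OF T3 smooth_\<Phi>[OF s(1)] s(2) smooth_\<Phi>[OF s(3)], of p]
        three_form_cycle[OF T3 s(1) smooth_\<Phi>[OF s(2)] smooth_\<Phi>[OF s(3)], of p]
        S3_skew[OF smooth_\<Phi>[OF s(2)] s(1,3), of p]
      by (simp add: d_phi_F_torsion N3_torsion w S smooth_\<Phi> xyz[symmetric])
  qed
  \<comment> \<open>insert \<open>\<phi>Z\<close> for \<open>Z\<close> and use \<open>\<phi>\<^sup>3 = - \<phi>\<close>\<close>
  have 2: "S3 (\<Phi> X) (\<Phi> Y) (\<Phi> Z) p + S3 (\<Phi> Y) (\<Phi> Z) (\<Phi> X) p = S3 (\<Phi> Z) (\<Phi> X) (\<Phi> Y) p"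
    if v: "smooth_vf A X" "smooth_vf A Y" "smooth_vf A Z" for X Y Z
    using 1[OF v(1,2) smooth_\<Phi>[OF v(3)]] v
      S3_skew[OF smooth_\<Phi>[OF v(2)] smooth_\<Phi>[OF v(1)] smooth_\<Phi>[OF v(3)], of p]
    by (simp add: \<Phi>_\<Phi>_\<Phi> S3_minus3 S3_minus1 smooth_\<Phi>)
  show ?thesis
    using 2[OF v] 2[OF v(2,3,1)] 2[OF v(3,1,2)] by linarith
qed

text \<open>By \<open>\<phi>\<^sup>2 = - Id + \<Sum> \<eta> \<otimes> \<xi>\<close> it is enough to treat \<open>X\<close> in the image of \<open>\<phi>\<close> and \<open>X = \<xi> i\<close>. In the second case
  \<open>S3\<close> enters \<open>N(\<xi>,Y,Z)\<close> but not \<open>N(Y,Z,\<xi>)\<close>, and these are equal because \<open>N\<close> is totally skew-symmetric.\<close>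

lemma \<phi>_parallel:
  assumes T: "\<And>X Y Z p. smooth_vf A X \<Longrightarrow> smooth_vf A Y \<Longrightarrow> smooth_vf A Z \<Longrightarrow> T3 X Y Z p = char_torsion X Y Z p"
    and N: "is_three_form A N3"
    and v: "smooth_vf A X" "smooth_vf A Y"
  shows "\<nu> X Y p = 0"
proof (rule vf_eqI_metric[of p])
  fix Z assume Z: "smooth_vf A Z"
  have "S3 (\<Phi> (\<Phi> X)) (\<Phi> Y) (\<Phi> Z) p = 0"
    by (rule S3_horizontal_eq_0[OF T _ v(2) Z]) (simp_all add: smooth_\<Phi> v)
  then have h: "S3 (\<Phi> (\<Phi> X)) Y Z p = 0"
    using v by (simp add: S3_\<Phi> S3_\<Phi>\<Phi> smooth_\<Phi>)
  have \<xi>0: "S3 (\<xi> i) Y Z p = 0" if i: "i \<in> {1..s}" for i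
  proof -
    have "N3 Y (\<Phi> Z) (\<xi> i) p = N3 (\<xi> i) Y (\<Phi> Z) p"
      by (rule three_form_cycle[OF N smooth_vf_\<xi>[OF i] v(2) smooth_\<Phi>[OF Z]])
    then have "S3 (\<xi> i) Y (\<Phi> (\<Phi> Z)) p = 0"
      by (simp add: N3_\<xi>[OF i v(2) smooth_\<Phi>[OF Z]])
    then show ?thesis using S3_\<Phi>\<Phi>[OF smooth_vf_\<xi>[OF i] v(2), of Z p] by simp
  qed
  have "X = (\<lambda>p. - \<Phi> (\<Phi> X) p + (\<Sum>i=1..s. form_app (\<eta> i) X p *\<^sub>R \<xi> i p))"
    by (simp add: \<Phi>_at \<phi>_\<phi> form_app_def)
  then have "\<nu> X Y p = \<nu> (\<lambda>p. - \<Phi> (\<Phi> X) p + (\<Sum>i=1..s. form_app (\<eta> i) X p *\<^sub>R \<xi> i p)) Y p" by simp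
  also have "\<dots> = - \<nu> (\<Phi> (\<Phi> X)) Y p + (\<Sum>i=1..s. form_app (\<eta> i) X p *\<^sub>R \<nu> (\<xi> i) Y p)"
    using v by (simp add: \<nu>_linear1 smooth_\<Phi> smooth_vf_minus smooth_vf_sum smooth_vf_scale smooth_\<eta> smooth_vf_\<xi>
        del: uminus_add_conv_diff)
  finally have "\<nu> X Y p = - \<nu> (\<Phi> (\<Phi> X)) Y p + (\<Sum>i=1..s. form_app (\<eta> i) X p *\<^sub>R \<nu> (\<xi> i) Y p)" .
  then have "g p (\<nu> X Y p) (Z p) = - S3 (\<Phi> (\<Phi> X)) Y Z p + (\<Sum>i=1..s. form_app (\<eta> i) X p * S3 (\<xi> i) Y Z p)"
    by (simp add: S3_def g_simps)
  also have "\<dots> = 0" by (simp add: h \<xi>0)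
  finally show "g p (\<nu> X Y p) (Z p) = g p 0 (Z p)" by (simp add: g_simps)
qed

end

section \<open>Commuting Killing characteristic vector fields\<close>

locale killing_f_structure = metric_f_structure +
  assumes commute: "\<And>i j. i \<in> {1..s} \<Longrightarrow> j \<in> {1..s} \<Longrightarrow> lie_bracket A (\<xi> i) (\<xi> j) = (\<lambda>_. 0)"
    and killing: "\<And>i. i \<in> {1..s} \<Longrightarrow> killing A g (\<xi> i)"
begin

lemma killing_eq:
  assumes "i \<in> {1..s}" "smooth_vf A X" "smooth_vf A Y"
  shows "dir_deriv A (\<xi> i) (bil_app g X Y) p
    = bil_app g (lie_bracket A (\<xi> i) X) Y p + bil_app g X (lie_bracket A (\<xi> i) Y) p"
proof -
  have "(\<lambda>p. dir_deriv A (\<xi> i) (bil_app g X Y) p - bil_app g (lie_bracket A (\<xi> i) X) Y p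
      - bil_app g X (lie_bracket A (\<xi> i) Y) p) = (\<lambda>_. 0)"
    using killing[OF assms(1)] assms(2,3) unfolding killing_def by blast
  from fun_cong[OF this, of p] show ?thesis by simp
qed

text \<open>Since \<open>\<eta> i\<close> is dual to \<open>\<xi> i\<close>, the Killing equation for \<open>\<xi> j\<close> on the pair \<open>X, \<xi> i\<close> expresses this
  through \<open>g(X, [\<xi> j, \<xi> i])\<close>, which vanishes.\<close>

lemma ext_deriv1_\<xi>:
  assumes i: "i \<in> {1..s}" and j: "j \<in> {1..s}" and X: "smooth_vf A X"
  shows "ext_deriv1 A (\<eta> i) (\<xi> j) X p = 0"
  using killing_eq[OF j X smooth_vf_\<xi>[OF i], of p]
  by (simp add: ext_deriv1_def form_app_\<eta>_\<xi> i j form_app_\<eta>[OF i, of X] form_app_\<eta>[OF i, of "lie_bracket A (\<xi> j) X"]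
      commute[OF j i])
    (simp add: bil_app_def g_simps)

lemma N3_\<xi>_\<xi>:
  assumes i: "i \<in> {1..s}" and j: "j \<in> {1..s}"
  shows "N3 (\<xi> i) (\<xi> j) Z p = 0"
  by (simp add: nijenhuis1_form_def nijenhuis1_def nijenhuis_phi_def bil_app_def \<Phi>_\<xi> i j commute lie_bracket_zero
      smooth_vf_\<xi> smooth_vf_zero \<Phi>_at \<phi>_simps ext_deriv1_\<xi> g_simps)

text \<open>The 3-form \<open>d\<^sup>\<phi>F\<close> dies because \<open>\<phi> \<xi> = 0\<close>. In the wedge products only the term with
  \<open>\<eta>\<^sub>j(\<xi>\<^sub>j) = 1\<close> survives, and the one with \<open>N\<close> cancels the summand \<open>N\<close>.\<close>

lemma char_torsion_\<xi>:
  assumes j: "j \<in> {1..s}" and v: "smooth_vf A Y" "smooth_vf A Z"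
  shows "char_torsion (\<xi> j) Y Z p = ext_deriv1 A (\<eta> j) Y Z p"
proof -
  have 1: "d_phi_F A \<phi> g (\<xi> j) Y Z p = 0"
    using three_form_scale1[OF is_three_form_ext_deriv2[OF is_two_form_fundamental_form] smooth_fun_const[of 0]
        smooth_vf_zero smooth_\<Phi>[OF v(1)] smooth_\<Phi>[OF v(2)], of p]
    by (simp add: d_phi_F_def \<Phi>_\<xi>[OF j])
  have 2: "(\<Sum>i=1..s. wedge12 (\<eta> i) (\<omega> i) (\<xi> j) Y Z p) = \<omega> j Y Z p"
    if "\<And>i U. i \<in> {1..s} \<Longrightarrow> smooth_vf A U \<Longrightarrow> \<omega> i (\<xi> j) U p = 0" for \<omega> :: "nat \<Rightarrow> ('a, 'b) two_form"
  proof -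
    have "(\<Sum>i=1..s. wedge12 (\<eta> i) (\<omega> i) (\<xi> j) Y Z p) = (\<Sum>i=1..s. if i = j then \<omega> i Y Z p else 0)"
      using that v j by (intro sum.cong) (auto simp: wedge12_def form_app_\<eta>_\<xi>)
    then show ?thesis using j by (simp add: sum.delta)
  qed
  show ?thesis
    by (simp add: char_torsion_def 1 2 ext_deriv1_\<xi> j contract3_def N3_\<xi>_\<xi>)
qed

text \<open>The Killing equation removes the derivative along \<open>\<xi> j\<close> and two brackets; the other terms are
  \<open>d\<eta>\<close>. With \<open>T = 0\<close> this computes \<open>\<nabla>\<^sup>g\<xi>\<close>, and with \<open>\<xi> \<lrcorner> T = d\<eta>\<close> the two summands cancel.\<close>

lemma koszul_\<xi>:
  assumes j: "j \<in> {1..s}" and v: "smooth_vf A X" "smooth_vf A Y"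
  shows "koszul T X (\<xi> j) Y p = (ext_deriv1 A (\<eta> j) X Y p + T X (\<xi> j) Y p) / 2"
proof -
  have "bil_app g (lie_bracket A X (\<xi> j)) Y p = - bil_app g (lie_bracket A (\<xi> j) X) Y p"
    by (simp add: bil_app_def lie_bracket_skew[of X "\<xi> j"] g_simps)
  then show ?thesis
    using killing_eq[OF j v, of p]
    by (simp add: koszul_def ext_deriv1_def form_app_\<eta>[OF j] bil_app_sym[of "\<xi> j" Y]
        bil_app_sym[of "lie_bracket A (\<xi> j) Y" X])
qed

lemma nabla_form_levi_civita:
  assumes j: "j \<in> {1..s}" and v: "smooth_vf A X" "smooth_vf A Y"
  shows "ext_deriv1 A (\<eta> j) X Y p = 2 * nabla_form A (levi_civita A g) (\<eta> j) X Y p"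
proof -
  define L where "L = levi_civita A g"
  note z = is_three_form_zero
  have "nabla_metric A L g X Y (\<xi> j) = (\<lambda>_. 0)"
    using metric_connection_skew_connection[OF z] v smooth_vf_\<xi>[OF j]
    unfolding metric_connection_def L_def levi_civita_eq by blast
  then have "dir_deriv A X (form_app (\<eta> j) Y) p = form_app (\<eta> j) (L X Y) p + bil_app g (L X (\<xi> j)) Y p"
    by (simp add: nabla_metric_def fun_eq_iff form_app_\<eta>[OF j] bil_app_sym[of Y] algebra_simps)
  moreover have "bil_app g (L X (\<xi> j)) Y p = ext_deriv1 A (\<eta> j) X Y p / 2"
    using skew_connection(2)[OF z v(1) smooth_vf_\<xi>[OF j] v(2)] koszul_\<xi>[OF j v]
    by (simp add: L_def levi_civita_eq)
  ultimately show ?thesis by (simp add: nabla_form_def L_def)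
qed

text \<open>Only the parallelism of \<open>\<xi> i\<close> needs an argument: by \<open>koszul_\<xi>\<close> the covariant derivative is half of
  \<open>d\<eta>(X,Z) - T(\<xi>,X,Z)\<close>, and \<open>char_torsion_\<xi>\<close> identifies the two terms.\<close>

lemma char_connection:
  assumes N: "is_three_form A N3"
  shows "xi_parallel_connection A n s \<phi> \<xi> \<eta> g (skew_connection char_torsion)"
proof
  note T = is_three_form_char_torsion[OF N]
  show "metric_connection A g (skew_connection char_torsion)"
    by (rule metric_connection_skew_connection[OF T])
  show "skew_torsion A g (skew_connection char_torsion)"
    unfolding skew_torsion_def
  proof (rule is_three_formI)
    note t = torsion3_skew_connection[OF T]
    fix X Y Z assume v: "smooth_vf A X" "smooth_vf A Y" "smooth_vf A Z"
    show "smooth_fun A (torsion3 A g (skew_connection char_torsion) X Y Z)"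
      using three_form_smooth[OF T v] by (simp add: t v)
    show "torsion3 A g (skew_connection char_torsion) Y X Z p = - torsion3 A g (skew_connection char_torsion) X Y Z p" for p
      using three_form_swap12[OF T v, of p] by (simp add: t v)
    show "torsion3 A g (skew_connection char_torsion) X Z Y p = - torsion3 A g (skew_connection char_torsion) X Y Z p" for p
      using three_form_swap23[OF T v, of p] by (simp add: t v)
  qed (simp_all add: torsion3_skew_connection[OF T] smooth_vf_add smooth_vf_scale three_form_simps[OF T])
  show "skew_connection char_torsion X (\<xi> i) = (\<lambda>_. 0)" if i: "i \<in> {1..s}" and X: "smooth_vf A X" for i X
  proof (rule ext, rule vf_eqI_metric)
    fix p Z assume Z: "smooth_vf A Z"
    show "g p (skew_connection char_torsion X (\<xi> i) p) (Z p) = g p 0 (Z p)"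
      using three_form_swap12[OF T X smooth_vf_\<xi>[OF i] Z, of p] char_torsion_\<xi>[OF i X Z, of p]
      by (simp add: skew_connection(3)[OF T X smooth_vf_\<xi>[OF i] Z] koszul_\<xi>[OF i X Z] g_simps)
  qed
qed

end

theorem theorem3p9:
  fixes A :: "('m::{t2_space, second_countable_topology}, 'e::euclidean_space) atlas"
    and n s :: nat
    and \<phi> :: "('m, 'e) endo_field"
    and \<xi> :: "nat \<Rightarrow> ('m, 'e) vector_field"
    and \<eta> :: "nat \<Rightarrow> ('m, 'e) one_form"
    and g :: "('m, 'e) bilinear_field"
  assumes "metric_f_manifold A n s \<phi> \<xi> \<eta> g"
    and "\<forall>i\<in>{1..s}. \<forall>j\<in>{1..s}. lie_bracket A (\<xi> i) (\<xi> j) = (\<lambda>_. 0)"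
    and "\<forall>i\<in>{1..s}. killing A g (\<xi> i)"
    and "is_three_form A (nijenhuis1_form A s \<phi> \<xi> \<eta> g)"
  shows "(\<exists>!D. metric_connection A g D \<and> skew_torsion A g D \<and>
               structure_preserving A s \<phi> \<xi> \<eta> D) \<and>
         (\<forall>D. metric_connection A g D \<and> skew_torsion A g D \<and>
               structure_preserving A s \<phi> \<xi> \<eta> D \<longrightarrow>
           (\<forall>X Y Z. smooth_vf A X \<and> smooth_vf A Y \<and> smooth_vf A Z \<longrightarrow>
              torsion3 A g D X Y Z =
                (\<lambda>p. (\<Sum>i=1..s. wedge12 (\<eta> i) (ext_deriv1 A (\<eta> i)) X Y Z p)
                   + d_phi_F A \<phi> g X Y Z p
                   + nijenhuis1_form A s \<phi> \<xi> \<eta> g X Y Z p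
                   - (\<Sum>i=1..s. wedge12 (\<eta> i)
                        (contract3 (\<xi> i) (nijenhuis1_form A s \<phi> \<xi> \<eta> g)) X Y Z p))) \<and>
           (\<forall>i\<in>{1..s}. \<forall>j\<in>{1..s}. torsion A D (\<xi> i) (\<xi> j) = (\<lambda>_. 0)) \<and>
           (\<forall>j\<in>{1..s}. \<forall>X Y. smooth_vf A X \<and> smooth_vf A Y \<longrightarrow>
              contract3 (\<xi> j) (torsion3 A g D) X Y = ext_deriv1 A (\<eta> j) X Y \<and>
              ext_deriv1 A (\<eta> j) X Y =
                (\<lambda>p. 2 * nabla_form A (levi_civita A g) (\<eta> j) X Y p)))"
proof -
  interpret killing_f_structure A n s \<phi> \<xi> \<eta> g
    using assms by unfold_locales auto
  note N = assms(4)
  define adapted where "adapted = (\<lambda>D. metric_connection A g D \<and> skew_torsion A g D \<and>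
    structure_preserving A s \<phi> \<xi> \<eta> D)"
  have xi: "xi_parallel_connection A n s \<phi> \<xi> \<eta> g D" if "adapted D" for D
    using that by unfold_locales (auto simp: adapted_def structure_preserving_def)
  have T: "torsion3 A g D X Y Z = char_torsion X Y Z"
    if a: "adapted D" and v: "smooth_vf A X" "smooth_vf A Y" "smooth_vf A Z" for D X Y Z
  proof
    interpret xi_parallel_connection A n s \<phi> \<xi> \<eta> g D by (rule xi[OF a])
    show "T3 X Y Z p = char_torsion X Y Z p" for p
      by (rule torsion_eq_char_torsion[OF _ v]) (use a in \<open>simp add: adapted_def structure_preserving_def\<close>)
  qed
  have adapted: "adapted (skew_connection char_torsion)"
  proof -
    interpret xi_parallel_connection A n s \<phi> \<xi> \<eta> g "skew_connection char_torsion"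
      by (rule char_connection[OF N])
    have "\<nu> X Y = (\<lambda>_. 0)" if "smooth_vf A X" "smooth_vf A Y" for X Y
      by (rule ext, rule \<phi>_parallel[OF _ N that])
        (simp add: torsion3_skew_connection[OF is_three_form_char_torsion[OF N]])
    then show ?thesis
      using D skew D_\<xi> nabla_form_\<eta> by (simp add: adapted_def structure_preserving_def)
  qed
  have unique: "D = skew_connection char_torsion" if a: "adapted D" for D
    by (rule metric_connection_eqI[OF _ _ is_three_form_char_torsion[OF N] T[OF a] T[OF adapted]])
      (use a adapted in \<open>simp_all add: adapted_def\<close>)
  have adapted_iff: "metric_connection A g D \<and> skew_torsion A g D \<and> structure_preserving A s \<phi> \<xi> \<eta> D
      \<longleftrightarrow> adapted D" for D
    by (simp add: adapted_def)
  show ?thesis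
    unfolding adapted_iff
  proof (intro conjI allI impI ballI; (elim conjE)?)
    show "\<exists>!D. adapted D" using adapted unique by blast
  next
    fix D assume a: "adapted D"
    interpret xi_parallel_connection A n s \<phi> \<xi> \<eta> g D by (rule xi[OF a])
    show "T3 X Y Z = (\<lambda>p. (\<Sum>i=1..s. wedge12 (\<eta> i) (ext_deriv1 A (\<eta> i)) X Y Z p) + d_phi_F A \<phi> g X Y Z p
        + N3 X Y Z p - (\<Sum>i=1..s. wedge12 (\<eta> i) (contract3 (\<xi> i) N3) X Y Z p))"
      if "smooth_vf A X" "smooth_vf A Y" "smooth_vf A Z" for X Y Z
      using T[OF a that] by (simp add: char_torsion_def[abs_def])
    show "\<tau> (\<xi> i) (\<xi> j) = (\<lambda>_. 0)" if "i \<in> {1..s}" "j \<in> {1..s}" for i j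
      using that by (simp add: torsion_def D_\<xi> smooth_vf_\<xi> commute)
    fix j X Y assume j: "j \<in> {1..s}" and v: "smooth_vf A X" "smooth_vf A Y"
    show "contract3 (\<xi> j) T3 X Y = ext_deriv1 A (\<eta> j) X Y"
      using T3_\<xi>(2)[OF j v] by (auto simp: contract3_def)
    show "ext_deriv1 A (\<eta> j) X Y = (\<lambda>p. 2 * nabla_form A (levi_civita A g) (\<eta> j) X Y p)"
      using nabla_form_levi_civita[OF j v] by auto
  qed
qed

end
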